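(* Let $A=\bigoplus_{k\ge 0}A_k$ be the graded coordinate algebra of a Kleinian singularity or of a Fuchsian singularity of genus $g=0$, let $\alpha_1\le\dots\le\alpha_r$ be the integers occurring in its orbit invariants, and let $p_A(t)=\sum_{k=0}^\infty \dim_{\mathbb C}(A_k)\,t^k$ be its Poincaré series. Let $\Delta_-,\Delta_0,\Delta_+$ be the characteristic polynomials of the Coxeter elements $\tau_-,\tau_0,\tau_+$ of the lattices $V_-$, $V_0=V_-[u]$, $V_+=V_-[u,w]$ attached to $(\alpha_1,\dots,\alpha_r)$ with the ordered bases $B_-,B_0,B_+$ (as defined in the context). Then: (i) For a Kleinian singularity, $$p_A(t)=\frac{\Delta_-(t)}{\Delta_0(t)}.$$ (ii) For a Fuchsian singularity with $g=0$, $$p_A(t)=\frac{\Delta_+(t)}{\Delta_0(t)}.$$ The equalities are understood as identities of power series in $t$, with the rational functions expanded at $t=0$.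
   Context: **Singularities.** A normal surface singularity $(X,x)$ with good $\mathbb C^*$-action is $X=\mathrm{Spec}(A)$, where $A=\bigoplus_{k\ge0}A_k$, $A_0=\mathbb C$, is a graded $\mathbb C$-algebra, $X$ is a normal affine surface smooth outside the vertex $x$, and $x$ is defined by the ideal $\bigoplus_{k\ge1}A_k$. For such $A$ there are a compact Riemann surface $Z$ of genus $g$, a divisor $D_0$ on $Z$, distinct points $p_1,\dots,p_r\in Z$ and integers $0<\beta_i<\alpha_i$ with $(\alpha_i,\beta_i)=1$ (numbered so that $\alpha_1\le\dots\le\alpha_r$) such that $$A_k=L(D^{(k)})=H^0(Z,\mathcal O_Z(D^{(k)})),\qquad D^{(k)}=kD_0+\sum_{i=1}^r\left[k\,\frac{\alpha_i-\beta_i}{\alpha_i}\right]p_i\quad(k\ge0),$$ where $[x]$ is the largest integer $\le x$. With $b=\deg D_0+r$, the data $\{g;b;(\alpha_1,\beta_1),\dots,(\alpha_r,\beta_r)\}$ are the orbit invariants. - *Kleinian singularity* (rational double point, graded as follows): $g=0$, so $Z=\mathbb P^1(\mathbb C)$, the orbit invariants are $\{0;2;(\alpha_1,\alpha_1-1),\dots,(\alpha_r,\alpha_r-1)\}$ and $\sum_{i=1}^r\frac1{\alpha_i}>r-2$ (hence $r\le3$). Thus $D^{(k)}=D^{(k)}_{\rm Klein}=kD_0+\sum_{i=1}^r\left[\frac{k}{\alpha_i}\right]p_i$ with $\deg D_0=2-r$. - *Fuchsian singularity*: there is a finitely generated cocompact Fuchsian group of the first kind $\Gamma\subset PSL(2,\mathbb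 R)$ acting on the upper half plane $\mathbb H$ such that $A_k=H^0(\mathbb H,T_{\mathbb H}^{-k})^\Gamma$ ($T_{\mathbb H}^{-1}$ being the cotangent bundle). Here $Z=\mathbb H/\Gamma$, the $p_i$ are the branch points of $\mathbb H\to Z$, $\alpha_i$ is the ramification index over $p_i$, $\beta_i=1$ for all $i$, $D_0$ is the canonical divisor (of degree $2g-2$), and $\sum_{i=1}^r\frac1{\alpha_i}<r+2g-2$. The orbit invariants are $\{g;2g-2+r;(\alpha_1,1),\dots,(\alpha_r,1)\}$ and $D^{(k)}=D^{(k)}_{\rm Fuchs}=kD_0+\sum_{i=1}^r\left[k\frac{\alpha_i-1}{\alpha_i}\right]p_i$. The genus of the Fuchsian singularity is the genus $g$ of $Z$; for $g=0$ one has $r\ge3$. **Lattices and Coxeter elements.** A lattice is a free $\mathbb Z$-module of finite rank with a symmetric integral bilinear form $\langle-,-\rangle$ (possibly degenerate). A root is an element $e$ with $\langle e,e\rangle=-2$; its reflection is $s_e(x)=x+\langle x,e\rangle e$. For an ordered basis $B=(e_1,\dots,e_n)$ consisting of roots, the Coxeter element is $\tau=s_{e_1}s_{e_2}\cdots s_{e_n}$ (composition of maps, $s_{e_n}$ applied first), and its characteristic polynomial is $\Delta(t)=\det(t\cdot\mathrm{id}-\tau)$. For a lattice $V$: $V[u]:=V\oplus\mathbb Zu$ (orthogonal sum) with $\langle u,u\rangle=0$; $V[u,w]:=V\oplus\mathbb Zu\oplus\mathbb Zw$, where $V$ is orthogonal to $\mathbb Zu\oplus\mathbb Zw$ and $\langle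 u,u\rangle=\langle w,w\rangle=0$, $\langle u,w\rangle=\langle w,u\rangle=1$. $V_-$ is the lattice with ordered basis $$B_-=(E_1^1,\dots,E_{\alpha_1-1}^1;\ \dots;\ E_1^r,\dots,E_{\alpha_r-1}^r;\ E)$$ consisting of roots, where $\langle E_j^i,E_{j+1}^i\rangle=1$ for $1\le j\le\alpha_i-2$, $\langle E_{\alpha_i-1}^i,E\rangle=1$ for $1\le i\le r$, and all other products of distinct basis elements are $0$ (a star with centre $E$ and $r$ arms of lengths $\alpha_i-1$). $V_0:=V_-[u]$ with ordered basis $B_0:=(B_-,E-u)$, and $V_+:=V_-[u,w]$ with ordered basis $B_+:=(B_-,E-u,u-w)$. $\tau_-,\tau_0,\tau_+$ are the Coxeter elements for $B_-,B_0,B_+$. *)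

theory Defs
  imports
    "HOL-Complex_Analysis.Complex_Analysis"
    "HOL-Computational_Algebra.Computational_Algebra"
    "HOL-Computational_Algebra.Field_as_Ring"
    "HOL-Library.Function_Algebras"
    "Jordan_Normal_Form.Char_Poly"
begin

no_notation vec_index (infixl "$" 100)

section \<open>Graded algebras and Poincare series\<close>

text \<open>The graded algebra is the internal direct sum of the subspaces \<open>A k\<close> of an ambient
  commutative complex algebra; the ambient type need not be exhausted by it.\<close>

locale graded_algebra = vector_space scl
  for scl :: "complex \<Rightarrow> 'a::comm_ring_1 \<Rightarrow> 'a" +
  fixes A :: "nat \<Rightarrow> 'a set"
  assumes scale_mult: "scl c (x * y) = scl c x * y"
    and subspace_piece: "subspace (A k)"
    and mult_piece: "x \<in> A k \<Longrightarrow> y \<in> A l \<Longrightarrow> x * y \<in> A (k + l)"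
    and piece_0: "A 0 = range (\<lambda>c. scl c 1)"
    and direct: "(\<And>k. k \<le> n \<Longrightarrow> f k \<in> A k) \<Longrightarrow> (\<Sum>k\<le>n. f k) = 0 \<Longrightarrow> k \<le> n \<Longrightarrow> f k = 0"

definition graded_algebra_iso ::
  "(complex \<Rightarrow> 'a::comm_ring_1 \<Rightarrow> 'a) \<Rightarrow> (nat \<Rightarrow> 'a set) \<Rightarrow>
   (complex \<Rightarrow> 'b::comm_ring_1 \<Rightarrow> 'b) \<Rightarrow> (nat \<Rightarrow> 'b set) \<Rightarrow> bool" where
  "graded_algebra_iso scl A scl' F \<longleftrightarrow>
     (\<exists>\<phi>. (\<forall>k. bij_betw (\<phi> k) (A k) (F k)) \<and>
          (\<forall>k. \<forall>x\<in>A k. \<forall>y\<in>A k. \<phi> k (x + y) = \<phi> k x + \<phi> k y) \<and>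
          (\<forall>k c. \<forall>x\<in>A k. \<phi> k (scl c x) = scl' c (\<phi> k x)) \<and>
          (\<forall>k l. \<forall>x\<in>A k. \<forall>y\<in>A l. \<phi> (k + l) (x * y) = \<phi> k x * \<phi> l y))"

definition finite_dim :: "(complex \<Rightarrow> 'a::ab_group_add \<Rightarrow> 'a) \<Rightarrow> 'a set \<Rightarrow> bool" where
  "finite_dim scl V \<longleftrightarrow> (\<exists>B. finite B \<and> module.span scl B = V)"

definition poincare_series ::
  "(complex \<Rightarrow> 'a::ab_group_add \<Rightarrow> 'a) \<Rightarrow> (nat \<Rightarrow> 'a set) \<Rightarrow> rat fps" where
  "poincare_series scl A = Abs_fps (\<lambda>k. of_nat (vector_space.dim scl (A k)))"

section \<open>Divisors on the projective line\<close>

text \<open>Points of the complex projective line: \<open>Some a\<close> is the affine point \<open>a\<close> and \<open>None\<close> is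
  the point at infinity. Its function field is the field of complex rational functions.\<close>

type_synonym P1 = "complex option"

definition ratfun_scale :: "complex \<Rightarrow> complex poly fract \<Rightarrow> complex poly fract" where
  "ratfun_scale c F = to_fract [:c:] * F"

text \<open>Order of vanishing at a point, for nonzero \<open>F\<close>.\<close>

definition ratfun_order :: "P1 \<Rightarrow> complex poly fract \<Rightarrow> int" where
  "ratfun_order p F = (case quot_of_fract F of (P, Q) \<Rightarrow>
     (case p of Some a \<Rightarrow> int (order a P) - int (order a Q)
              | None \<Rightarrow> int (degree Q) - int (degree P)))"

definition is_divisor :: "(P1 \<Rightarrow> int) \<Rightarrow> bool" where
  "is_divisor D \<longleftrightarrow> finite {p. D p \<noteq> 0}"

definition divisor_degree :: "(P1 \<Rightarrow> int) \<Rightarrow> int" where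
  "divisor_degree D = (\<Sum>p | D p \<noteq> 0. D p)"

definition divisor_sections :: "(P1 \<Rightarrow> int) \<Rightarrow> complex poly fract set" where
  "divisor_sections D = {F. F = 0 \<or> (\<forall>p. ratfun_order p F + D p \<ge> 0)}"

text \<open>The divisor $D^{(k)}$ attached to $D_0$, the points $p_i$ and the pairs
  $(\alpha_i, \beta_i)$.\<close>

definition orbit_divisor ::
  "(P1 \<Rightarrow> int) \<Rightarrow> P1 list \<Rightarrow> nat list \<Rightarrow> nat list \<Rightarrow> nat \<Rightarrow> P1 \<Rightarrow> int" where
  "orbit_divisor D0 ps \<alpha>s \<beta>s k = (\<lambda>p. int k * D0 p +
     (\<Sum>i<length ps. if p = ps ! i
        then \<lfloor>real k * ((real (\<alpha>s ! i) - real (\<beta>s ! i)) / real (\<alpha>s ! i))\<rfloor> else 0))"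

section \<open>Kleinian singularities\<close>

definition kleinian_algebra ::
  "(complex \<Rightarrow> 'a::comm_ring_1 \<Rightarrow> 'a) \<Rightarrow> (nat \<Rightarrow> 'a set) \<Rightarrow> nat list \<Rightarrow> bool" where
  "kleinian_algebra scl A \<alpha>s \<longleftrightarrow>
     graded_algebra scl A \<and>
     sorted \<alpha>s \<and> (\<forall>\<alpha>\<in>set \<alpha>s. \<alpha> \<ge> 2) \<and>
     (\<Sum>\<alpha>\<leftarrow>\<alpha>s. 1 / real \<alpha>) > real (length \<alpha>s) - 2 \<and>
     (\<exists>D0 ps. is_divisor D0 \<and> divisor_degree D0 + int (length \<alpha>s) = 2 \<and>
        distinct ps \<and> length ps = length \<alpha>s \<and>
        graded_algebra_iso scl A ratfun_scale
          (\<lambda>k. divisor_sections (orbit_divisor D0 ps \<alpha>s (map (\<lambda>\<alpha>. \<alpha> - 1) \<alpha>s) k)))"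

section \<open>Fuchsian singularities of genus 0\<close>

abbreviation upper_half_plane :: "complex set" where
  "upper_half_plane \<equiv> {z. Im z > 0}"

text \<open>A subgroup of $PSL(2,R)$ is represented by its full preimage in $SL(2,R)$, that is, by a
  subgroup of $SL(2,R)$ containing $-1$; one of them is discrete if and only if the other is.\<close>

definition psl2R_subgroup :: "(real^2^2) set \<Rightarrow> bool" where
  "psl2R_subgroup \<Gamma> \<longleftrightarrow>
     (\<forall>M\<in>\<Gamma>. Determinants.det M = 1) \<and>
     Finite_Cartesian_Product.mat 1 \<in> \<Gamma> \<and> - Finite_Cartesian_Product.mat 1 \<in> \<Gamma> \<and>
     (\<forall>M\<in>\<Gamma>. \<forall>N\<in>\<Gamma>. M ** N \<in> \<Gamma>) \<and> (\<forall>M\<in>\<Gamma>. matrix_inv M \<in> \<Gamma>)"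

definition psl2R_finitely_generated :: "(real^2^2) set \<Rightarrow> bool" where
  "psl2R_finitely_generated \<Gamma> \<longleftrightarrow> (\<exists>S. finite S \<and> psl2R_subgroup hull S = \<Gamma>)"

definition moebius :: "real^2^2 \<Rightarrow> complex \<Rightarrow> complex" where
  "moebius M z = (of_real (M$1$1) * z + of_real (M$1$2)) / (of_real (M$2$1) * z + of_real (M$2$2))"

definition orbit :: "(real^2^2) set \<Rightarrow> complex \<Rightarrow> complex set" where
  "orbit \<Gamma> z = (\<lambda>M. moebius M z) ` \<Gamma>"

text \<open>First kind: every point of the boundary (the real line together with infinity) is a limit
  point of each orbit.\<close>

definition first_kind :: "(real^2^2) set \<Rightarrow> bool" where
  "first_kind \<Gamma> \<longleftrightarrow> (\<forall>z\<in>upper_half_plane.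
     (\<forall>x::real. of_real x \<in> closure (orbit \<Gamma> z)) \<and> \<not> bounded (orbit \<Gamma> z))"

text \<open>Compactness of the quotient of the (locally compact) half plane.\<close>

definition cocompact :: "(real^2^2) set \<Rightarrow> bool" where
  "cocompact \<Gamma> \<longleftrightarrow> (\<exists>K. compact K \<and> K \<subseteq> upper_half_plane \<and>
     (\<forall>z\<in>upper_half_plane. \<exists>w\<in>K. z \<in> orbit \<Gamma> w))"

definition cocompact_fuchsian_group :: "(real^2^2) set \<Rightarrow> bool" where
  "cocompact_fuchsian_group \<Gamma> \<longleftrightarrow> psl2R_subgroup \<Gamma> \<and> discrete \<Gamma> \<and>
     psl2R_finitely_generated \<Gamma> \<and> first_kind \<Gamma> \<and> cocompact \<Gamma>"

text \<open>The invariant sections $f(z)\,(dz)^k$ of the \<open>k\<close>-th power of the cotangent bundle. The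
  function \<open>f\<close> is set to 0 outside the half plane, so that it is determined by the section.\<close>

definition automorphic_forms :: "(real^2^2) set \<Rightarrow> nat \<Rightarrow> (complex \<Rightarrow> complex) set" where
  "automorphic_forms \<Gamma> k = {f. f holomorphic_on upper_half_plane \<and>
     (\<forall>z. z \<notin> upper_half_plane \<longrightarrow> f z = 0) \<and>
     (\<forall>M\<in>\<Gamma>. \<forall>z\<in>upper_half_plane. f (moebius M z) * deriv (moebius M) z ^ k = f z)}"

text \<open>The map to the projective line given by a meromorphic function, and its local degree.\<close>

definition P1_map :: "(complex \<Rightarrow> complex) \<Rightarrow> complex \<Rightarrow> P1" where
  "P1_map h z = (if is_pole h z then None else Some (h z))"

definition ramification_index :: "(complex \<Rightarrow> complex) \<Rightarrow> complex \<Rightarrow> int" where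
  "ramification_index h z = (if is_pole h z then - zorder h z else zorder (\<lambda>w. h w - h z) z)"

text \<open>The quotient of the half plane by \<open>\<Gamma>\<close> is a compact Riemann surface of genus 0, that is, a
  projective line: a holomorphic map onto the projective line whose fibres are the orbits induces
  a holomorphic bijection of the quotient with it, hence an isomorphism of Riemann surfaces.\<close>

definition genus_0_quotient_map :: "(real^2^2) set \<Rightarrow> (complex \<Rightarrow> complex) \<Rightarrow> bool" where
  "genus_0_quotient_map \<Gamma> h \<longleftrightarrow> h nicely_meromorphic_on upper_half_plane \<and>
     P1_map h ` upper_half_plane = UNIV \<and>
     (\<forall>z\<in>upper_half_plane. \<forall>w\<in>upper_half_plane. P1_map h z = P1_map h w \<longleftrightarrow> w \<in> orbit \<Gamma> z)"

definition fuchsian_genus_0_algebra ::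
  "(complex \<Rightarrow> 'a::comm_ring_1 \<Rightarrow> 'a) \<Rightarrow> (nat \<Rightarrow> 'a set) \<Rightarrow> nat list \<Rightarrow> bool" where
  "fuchsian_genus_0_algebra scl A \<alpha>s \<longleftrightarrow>
     graded_algebra scl A \<and>
     sorted \<alpha>s \<and>
     (\<Sum>\<alpha>\<leftarrow>\<alpha>s. 1 / real \<alpha>) < real (length \<alpha>s) - 2 \<and>
     (\<exists>\<Gamma> h ps. cocompact_fuchsian_group \<Gamma> \<and> genus_0_quotient_map \<Gamma> h \<and>
        distinct ps \<and> length ps = length \<alpha>s \<and>
        set ps = P1_map h ` {z\<in>upper_half_plane. ramification_index h z > 1} \<and>
        (\<forall>i<length ps. \<forall>z\<in>upper_half_plane.
           P1_map h z = ps ! i \<longrightarrow> ramification_index h z = int (\<alpha>s ! i)) \<and>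
        graded_algebra_iso scl A (\<lambda>c f z. c * f z) (automorphic_forms \<Gamma>))"

section \<open>Lattices and Coxeter elements\<close>

text \<open>A lattice of rank \<open>n\<close> is given by the Gram matrix of its form on integer vectors of
  dimension \<open>n\<close>.\<close>

definition lattice_form :: "int Matrix.mat \<Rightarrow> int Matrix.vec \<Rightarrow> int Matrix.vec \<Rightarrow> int" where
  "lattice_form G x y = x \<bullet> (G *\<^sub>v y)"

definition reflection :: "int Matrix.mat \<Rightarrow> int Matrix.vec \<Rightarrow> int Matrix.vec \<Rightarrow> int Matrix.vec" where
  "reflection G e x = x + lattice_form G x e \<cdot>\<^sub>v e"

definition coxeter_element ::
  "int Matrix.mat \<Rightarrow> int Matrix.vec list \<Rightarrow> int Matrix.vec \<Rightarrow> int Matrix.vec" where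
  "coxeter_element G B = foldr (\<lambda>e f. reflection G e \<circ> f) B id"

text \<open>Characteristic polynomial of an endomorphism of integer vectors of dimension \<open>n\<close>, from its
  matrix in the standard basis.\<close>

definition endo_char_poly :: "nat \<Rightarrow> (int Matrix.vec \<Rightarrow> int Matrix.vec) \<Rightarrow> int poly" where
  "endo_char_poly n f = char_poly (Matrix.mat n n (\<lambda>(i, j). vec_index (f (unit_vec n j)) i))"

definition coxeter_poly :: "int Matrix.mat \<Rightarrow> int Matrix.vec list \<Rightarrow> int poly" where
  "coxeter_poly G B = endo_char_poly (dim_row G) (coxeter_element G B)"

definition lattice_u :: "int Matrix.mat \<Rightarrow> int Matrix.mat" where
  "lattice_u G = diag_block_mat [G, 0\<^sub>m 1 1]"

definition lattice_uw :: "int Matrix.mat \<Rightarrow> int Matrix.mat" where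
  "lattice_uw G = diag_block_mat [G, mat_of_rows_list 2 [[0, 1], [1, 0]]]"

text \<open>\<open>Arm i j\<close> is the \<open>j\<close>-th vertex of the \<open>i\<close>-th arm; arms are counted from 0, the vertices of
  an arm from 1, the last one being joined to the centre.\<close>

datatype star_vertex = Arm nat nat | Centre

definition star_vertices :: "nat list \<Rightarrow> star_vertex list" where
  "star_vertices \<alpha>s = concat (map (\<lambda>i. map (Arm i) [1..<\<alpha>s ! i]) [0..<length \<alpha>s]) @ [Centre]"

fun star_form :: "nat list \<Rightarrow> star_vertex \<Rightarrow> star_vertex \<Rightarrow> int" where
  "star_form \<alpha>s (Arm i j) (Arm i' j') =
     (if i \<noteq> i' then 0 else if j = j' then -2 else if j' = Suc j \<or> j = Suc j' then 1 else 0)"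
| "star_form \<alpha>s (Arm i j) Centre = (if j = \<alpha>s ! i - 1 then 1 else 0)"
| "star_form \<alpha>s Centre (Arm i j) = (if j = \<alpha>s ! i - 1 then 1 else 0)"
| "star_form \<alpha>s Centre Centre = -2"

definition star_rank :: "nat list \<Rightarrow> nat" where
  "star_rank \<alpha>s = length (star_vertices \<alpha>s)"

definition V_minus :: "nat list \<Rightarrow> int Matrix.mat" where
  "V_minus \<alpha>s = Matrix.mat (star_rank \<alpha>s) (star_rank \<alpha>s)
     (\<lambda>(a, b). star_form \<alpha>s (star_vertices \<alpha>s ! a) (star_vertices \<alpha>s ! b))"

definition V_zero :: "nat list \<Rightarrow> int Matrix.mat" where
  "V_zero \<alpha>s = lattice_u (V_minus \<alpha>s)"

definition V_plus :: "nat list \<Rightarrow> int Matrix.mat" where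
  "V_plus \<alpha>s = lattice_uw (V_minus \<alpha>s)"

definition B_minus :: "nat list \<Rightarrow> int Matrix.vec list" where
  "B_minus \<alpha>s = map (unit_vec (star_rank \<alpha>s)) [0..<star_rank \<alpha>s]"

text \<open>In the larger lattices the vectors of \<open>B_minus\<close> are padded with zeros; \<open>E\<close> is the last of
  them, corresponding to the centre.\<close>

definition B_zero :: "nat list \<Rightarrow> int Matrix.vec list" where
  "B_zero \<alpha>s = (let n = star_rank \<alpha>s; B = map (\<lambda>v. v @\<^sub>v 0\<^sub>v 1) (B_minus \<alpha>s);
       E = last B; u = unit_vec (n + 1) n
     in B @ [E - u])"

definition B_plus :: "nat list \<Rightarrow> int Matrix.vec list" where
  "B_plus \<alpha>s = (let n = star_rank \<alpha>s; B = map (\<lambda>v. v @\<^sub>v 0\<^sub>v 2) (B_minus \<alpha>s);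
       E = last B; u = unit_vec (n + 2) n; w = unit_vec (n + 2) (n + 1)
     in B @ [E - u, u - w])"

definition Delta_minus :: "nat list \<Rightarrow> int poly" where
  "Delta_minus \<alpha>s = coxeter_poly (V_minus \<alpha>s) (B_minus \<alpha>s)"

definition Delta_zero :: "nat list \<Rightarrow> int poly" where
  "Delta_zero \<alpha>s = coxeter_poly (V_zero \<alpha>s) (B_zero \<alpha>s)"

definition Delta_plus :: "nat list \<Rightarrow> int poly" where
  "Delta_plus \<alpha>s = coxeter_poly (V_plus \<alpha>s) (B_plus \<alpha>s)"

definition fps_of_int_poly :: "int poly \<Rightarrow> rat fps" where
  "fps_of_int_poly p = fps_of_poly (map_poly of_int p)"

end

theory Submission
  imports Defs
begin

text \<open>
  Both sides are computed as explicit rational functions. Write \<open>q n\<close> for the polynomial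
  \<open>1 + t + \<dots> + t^(n - 1)\<close>, \<open>p\<close> for the product of the \<open>q \<alpha>\<^sub>i\<close>, and \<open>s\<close> for
  \<open>t \<Sum> q (\<alpha>\<^sub>i - 1) / q \<alpha>\<^sub>i\<close>.

  The lattice side. In coordinates with respect to a basis of roots the Coxeter element solves a
  triangular linear system \<open>U \<tau> = - L\<close>, where \<open>U\<close> and \<open>L\<close> are the upper and lower unitriangular
  halves of minus the Gram matrix. Hence its characteristic polynomial is \<open>det (t U + L)\<close>
  (\<open>coxeter_poly_eq_pencil\<close>), a determinant that is as sparse as the graph. For a star whose
  arms are listed before its central vectors, eliminating each arm from its tip to the centre
  creates no new entries. The arms contribute the factor \<open>p\<close> and change each entry of the
  \<open>2 \<times> 2\<close> block belonging to \<open>E\<close> and \<open>E - u\<close> by \<open>- s\<close> (\<open>det_ext_pencil\<close>). What remains is a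
  determinant of size one, two or three, and \<open>Delta_formulas\<close> reads off
  \<open>\<Delta>\<^sub>- = p (1 + t - s)\<close>, \<open>\<Delta>\<^sub>0 = p (1 - t)\<^sup>2\<close> and \<open>\<Delta>\<^sub>+ = (1 + t) \<Delta>\<^sub>0 - t \<Delta>\<^sub>-\<close>.

  The algebra side. In both cases \<open>A\<^sub>k\<close> is linearly isomorphic to the space of polynomials of degree
  at most the degree \<open>d\<^sub>k\<close> of the divisor \<open>D^(k)\<close>, and so has dimension \<open>max 0 (d\<^sub>k + 1)\<close>. For
  Kleinian singularities this is the description of \<open>L(D)\<close> on the projective line
  (\<open>divisor_sections_param\<close>). For Fuchsian ones let \<open>h\<close> be the quotient map. A polynomial \<open>P\<close>
  gives the form \<open>P(h) h'^k / Q(h)\<close>, where \<open>Q\<close> has at each affine branch point of order \<open>e\<close> a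
  zero of order \<open>\<lfloor>k (e - 1) / e\<rfloor>\<close>, the largest that the zeros of \<open>h'^k\<close> can compensate
  (\<open>corresponding_form_exists\<close>). Conversely, for a form \<open>f\<close> the function \<open>f Q(h) / h'^k\<close> is
  invariant under the group, so it is a function of \<open>h\<close>. Because \<open>f\<close> is holomorphic, the
  singularities of this function at branch points are milder than a simple pole and its growth at
  infinity is slower than that of \<open>w^(d\<^sub>k + 1)\<close>; by Riemann and Liouville it is a polynomial of degree
  at most \<open>d\<^sub>k\<close> (\<open>corresponds_exists\<close>).

  The comparison. The hypotheses on \<open>\<Sum> 1 / \<alpha>\<^sub>i\<close> imply \<open>d\<^sub>k \<ge> -1\<close>, so that the
  dimension is \<open>d\<^sub>k + 1\<close>, with one exception: for Fuchsian singularities \<open>d\<^sub>1 = -2\<close>, which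
  adds the term \<open>t\<close> to the series. Summing the floor functions in \<open>d\<^sub>k\<close> gives
  \<open>1 + t - s\<close> and \<open>1 - 3 t + t s + t (1 - t)\<^sup>2\<close> for \<open>(1 - t)\<^sup>2\<close> times the Poincare series, in
  agreement with the quotients of the \<open>\<Delta>\<close>'s.
\<close>

section \<open>Characteristic polynomials of Coxeter elements\<close>

lemma reflection_as_matrix:
  assumes "G \<in> carrier_mat n n" "e \<in> carrier_vec n"
  shows "\<exists>R\<in>carrier_mat n n. \<forall>x\<in>carrier_vec n. reflection G e x = R *\<^sub>v x"
proof
  let ?R = "Matrix.mat n n (\<lambda>(i, j). (if i = j then 1 else 0) + vec_index e i * vec_index (G *\<^sub>v e) j)"
  show "?R \<in> carrier_mat n n" by simp
  show "\<forall>x\<in>carrier_vec n. reflection G e x = ?R *\<^sub>v x"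
  proof
    fix x :: "int Matrix.vec" assume x: "x \<in> carrier_vec n"
    show "reflection G e x = ?R *\<^sub>v x"
    proof (rule eq_vecI)
      fix i assume "i < dim_vec (?R *\<^sub>v x)"
      then have i: "i < n" by simp
      have "vec_index (?R *\<^sub>v x) i = (\<Sum>j<n. ((if i = j then 1 else 0) + vec_index e i * vec_index (G *\<^sub>v e) j) * vec_index x j)"
        using i x by (simp add: scalar_prod_def atLeast0LessThan)
      also have "\<dots> = (\<Sum>j<n. if i = j then vec_index x j else 0)
          + (\<Sum>j<n. vec_index x j * vec_index (G *\<^sub>v e) j) * vec_index e i"
        unfolding sum_distrib_right sum.distrib[symmetric]
        by (intro sum.cong) (auto simp: algebra_simps)
      also have "\<dots> = vec_index x i + lattice_form G x e * vec_index e i"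
      proof -
        have "lattice_form G x e = (\<Sum>j<n. vec_index x j * vec_index (G *\<^sub>v e) j)"
          using assms x unfolding lattice_form_def scalar_prod_def
          by (intro sum.cong) auto
        then show ?thesis using i by simp
      qed
      finally show "vec_index (reflection G e x) i = vec_index (?R *\<^sub>v x) i"
        using i x assms by (simp add: reflection_def)
    qed (use assms x in \<open>auto simp: reflection_def\<close>)
  qed
qed

lemma coxeter_element_as_matrix:
  assumes "G \<in> carrier_mat n n" "set B \<subseteq> carrier_vec n"
  shows "\<exists>A\<in>carrier_mat n n. \<forall>x\<in>carrier_vec n. coxeter_element G B x = A *\<^sub>v x"
  using assms(2)
proof (induction B)
  case Nil
  show ?case by (intro bexI[of _ "1\<^sub>m n"]) (auto simp: coxeter_element_def)
next
  case (Cons e B)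
  then obtain A where A: "A \<in> carrier_mat n n" "\<forall>x\<in>carrier_vec n. coxeter_element G B x = A *\<^sub>v x"
    by auto
  obtain R where R: "R \<in> carrier_mat n n" "\<forall>x\<in>carrier_vec n. reflection G e x = R *\<^sub>v x"
    using reflection_as_matrix[OF assms(1)] Cons.prems by (meson list.set_intros(1) subsetD)
  have "coxeter_element G (e # B) x = (R * A) *\<^sub>v x" if x: "x \<in> carrier_vec n" for x
  proof -
    have "coxeter_element G (e # B) x = reflection G e (coxeter_element G B x)"
      by (simp add: coxeter_element_def)
    also have "\<dots> = R *\<^sub>v (A *\<^sub>v x)" using A R x by simp
    also have "\<dots> = (R * A) *\<^sub>v x" using A(1) R(1) x by simp
    finally show ?thesis .
  qed
  then show ?case using A(1) R(1) by (intro bexI[of _ "R * A"]) auto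
qed

text \<open>Here \<open>c\<close> lists the coordinates of a vector with respect to the basis. A reflection in the
  \<open>i\<close>-th basis vector changes the \<open>i\<close>-th coordinate alone, which is what makes the composition of
  all reflections a triangular system.\<close>

lemma reflection_in_coordinates:
  assumes G: "G \<in> carrier_mat n n" and B: "length B = n" "set B \<subseteq> carrier_vec n" and i: "i < n"
  shows "reflection G (B ! i) (mat_of_cols n B *\<^sub>v Matrix.vec n c) =
    mat_of_cols n B *\<^sub>v Matrix.vec n (c(i := c i + (\<Sum>j<n. c j * lattice_form G (B ! j) (B ! i))))"
proof -
  let ?P = "mat_of_cols n B"
  have Bi: "B ! j \<in> carrier_vec n" if "j < n" for j using B that by auto
  have P: "?P \<in> carrier_mat n n" using B(1) by auto
  have Pc: "vec_index (?P *\<^sub>v Matrix.vec n d) l = (\<Sum>j<n. d j * vec_index (B ! j) l)" if "l < n" for d l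
    using that B(1) P by (simp add: scalar_prod_def atLeast0LessThan mat_of_cols_def mult.commute)
  have form: "lattice_form G (?P *\<^sub>v Matrix.vec n c) (B ! i) = (\<Sum>j<n. c j * lattice_form G (B ! j) (B ! i))"
  proof -
    have *: "lattice_form G v (B ! i) = (\<Sum>l<n. vec_index v l * vec_index (G *\<^sub>v (B ! i)) l)"
      if "v \<in> carrier_vec n" for v
      using that G unfolding lattice_form_def scalar_prod_def by (intro sum.cong) auto
    have "lattice_form G (?P *\<^sub>v Matrix.vec n c) (B ! i) =
        (\<Sum>l<n. (\<Sum>j<n. c j * vec_index (B ! j) l) * vec_index (G *\<^sub>v (B ! i)) l)"
      using P by (subst *) (auto intro!: sum.cong simp: Pc simp del: index_mult_mat_vec)
    also have "\<dots> = (\<Sum>l<n. \<Sum>j<n. c j * (vec_index (B ! j) l * vec_index (G *\<^sub>v (B ! i)) l))"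
      by (simp add: sum_distrib_right mult.assoc)
    also have "\<dots> = (\<Sum>j<n. \<Sum>l<n. c j * (vec_index (B ! j) l * vec_index (G *\<^sub>v (B ! i)) l))"
      by (rule sum.swap)
    also have "\<dots> = (\<Sum>j<n. c j * lattice_form G (B ! j) (B ! i))"
      by (intro sum.cong refl) (simp add: * Bi sum_distrib_left del: index_mult_mat_vec)
    finally show ?thesis .
  qed
  show ?thesis
  proof (rule eq_vecI)
    fix l assume "l < dim_vec (?P *\<^sub>v Matrix.vec n (c(i := c i + (\<Sum>j<n. c j * lattice_form G (B ! j) (B ! i)))))"
    then have l: "l < n" using P by simp
    let ?s = "\<Sum>j<n. c j * lattice_form G (B ! j) (B ! i)"
    have "vec_index (reflection G (B ! i) (?P *\<^sub>v Matrix.vec n c)) l =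
        (\<Sum>j<n. c j * vec_index (B ! j) l) + ?s * vec_index (B ! i) l"
      unfolding reflection_def form using l P Bi[OF i] Pc[OF l, of c]
      by (simp del: index_mult_mat_vec)
    also have "\<dots> = (\<Sum>j<n. c j * vec_index (B ! j) l) + (\<Sum>j<n. if j = i then ?s * vec_index (B ! j) l else 0)"
      using i by simp
    also have "\<dots> = (\<Sum>j<n. (c(i := c i + ?s)) j * vec_index (B ! j) l)"
      unfolding sum.distrib[symmetric] by (intro sum.cong) (auto simp: algebra_simps)
    also have "\<dots> = vec_index (?P *\<^sub>v Matrix.vec n (c(i := c i + ?s))) l"
      using Pc[OF l] by simp
    finally show "vec_index (reflection G (B ! i) (?P *\<^sub>v Matrix.vec n c)) l =
        vec_index (?P *\<^sub>v Matrix.vec n (c(i := c i + ?s))) l" .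
  qed (use P Bi[OF i] in \<open>auto simp: reflection_def\<close>)
qed

text \<open>The reflections are applied from the last to the first, and each changes its own coordinate once.
  So when the \<open>i\<close>-th reflection acts, the coordinates after \<open>i\<close> have their final values \<open>y\<close> and
  the others still have their initial values \<open>c\<close>.\<close>

lemma coxeter_element_in_coordinates:
  assumes G: "G \<in> carrier_mat n n" and B: "length B = n" "set B \<subseteq> carrier_vec n"
  shows "\<exists>y. coxeter_element G B (mat_of_cols n B *\<^sub>v Matrix.vec n c) = mat_of_cols n B *\<^sub>v Matrix.vec n y \<and>
    (\<forall>i<n. y i = c i + (\<Sum>j\<le>i. c j * lattice_form G (B ! j) (B ! i))
                    + (\<Sum>j\<in>{i<..<n}. y j * lattice_form G (B ! j) (B ! i)))"
proof -
  let ?P = "mat_of_cols n B" and ?H = "\<lambda>j i. lattice_form G (B ! j) (B ! i)"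
  have "\<exists>y. coxeter_element G (drop k B) (?P *\<^sub>v Matrix.vec n c) = ?P *\<^sub>v Matrix.vec n y \<and>
    (\<forall>i<k. y i = c i) \<and>
    (\<forall>i. k \<le> i \<and> i < n \<longrightarrow> y i = c i + (\<Sum>j\<le>i. c j * ?H j i) + (\<Sum>j\<in>{i<..<n}. y j * ?H j i))"
    if "k \<le> n" for k
    using that
  proof (induction rule: inc_induct)
    case base
    show ?case using B(1) by (intro exI[of _ c]) (simp add: coxeter_element_def)
  next
    case (step k)
    then obtain y where y: "coxeter_element G (drop (Suc k) B) (?P *\<^sub>v Matrix.vec n c) = ?P *\<^sub>v Matrix.vec n y"
      "\<forall>i<Suc k. y i = c i"
      "\<forall>i. Suc k \<le> i \<and> i < n \<longrightarrow> y i = c i + (\<Sum>j\<le>i. c j * ?H j i) + (\<Sum>j\<in>{i<..<n}. y j * ?H j i)"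
      by blast
    define z where "z = y(k := y k + (\<Sum>j<n. y j * ?H j k))"
    have "coxeter_element G (drop k B) (?P *\<^sub>v Matrix.vec n c) =
        reflection G (B ! k) (coxeter_element G (drop (Suc k) B) (?P *\<^sub>v Matrix.vec n c))"
      using step(2) B(1) by (simp add: coxeter_element_def Cons_nth_drop_Suc[symmetric])
    also have "\<dots> = ?P *\<^sub>v Matrix.vec n z"
      unfolding y(1) z_def using reflection_in_coordinates[OF G B step(2)] .
    finally have 1: "coxeter_element G (drop k B) (?P *\<^sub>v Matrix.vec n c) = ?P *\<^sub>v Matrix.vec n z" .
    have "(\<Sum>j<n. y j * ?H j k) = (\<Sum>j\<le>k. c j * ?H j k) + (\<Sum>j\<in>{k<..<n}. z j * ?H j k)"
    proof -
      have "{..<n} = {..k} \<union> {k<..<n}" using step(2) by auto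
      then have "(\<Sum>j<n. y j * ?H j k) = (\<Sum>j\<le>k. y j * ?H j k) + (\<Sum>j\<in>{k<..<n}. y j * ?H j k)"
        by (simp add: sum.union_disjoint ivl_disj_int)
      then show ?thesis using y(2) by (simp add: z_def)
    qed
    then have zk: "z k = c k + (\<Sum>j\<le>k. c j * ?H j k) + (\<Sum>j\<in>{k<..<n}. z j * ?H j k)"
      using y(2) by (simp add: z_def)
    have "z i = c i + (\<Sum>j\<le>i. c j * ?H j i) + (\<Sum>j\<in>{i<..<n}. z j * ?H j i)" if i: "k \<le> i" "i < n" for i
    proof (cases "i = k")
      case True then show ?thesis using zk by simp
    next
      case False
      then have "Suc k \<le> i" using i by simp
      then have "y i = c i + (\<Sum>j\<le>i. c j * ?H j i) + (\<Sum>j\<in>{i<..<n}. y j * ?H j i)" using y(3) i by blast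
      moreover have "(\<Sum>j\<in>{i<..<n}. y j * ?H j i) = (\<Sum>j\<in>{i<..<n}. z j * ?H j i)"
        using i by (intro sum.cong) (auto simp: z_def)
      ultimately show ?thesis using False by (simp add: z_def)
    qed
    moreover have "\<forall>i<k. z i = c i" using y(2) by (simp add: z_def)
    ultimately show ?case using 1 by (intro exI[of _ z]) simp
  qed
  from this[of 0] show ?thesis by simp
qed

text \<open>The matrix \<open>t U + L\<close>, where \<open>U\<close> is the upper and \<open>L\<close> the lower unitriangular half of \<open>- H\<close>; the
  diagonal of \<open>- H\<close>, which consists of the number 2, is split evenly.\<close>

definition coxeter_pencil :: "nat \<Rightarrow> (nat \<Rightarrow> nat \<Rightarrow> int) \<Rightarrow> int poly Matrix.mat" where
  "coxeter_pencil n H = Matrix.mat n n (\<lambda>(i, j).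
     if i = j then [:1, 1:] else if i < j then [:0, - H i j:] else [:- H i j:])"

lemma const_poly_hom: "comm_ring_hom (\<lambda>a::int. [:a:])"
  by unfold_locales (auto simp: one_pCons)

text \<open>With \<open>A\<close> the matrix of the Coxeter element, \<open>P\<close> that of the basis and \<open>M\<close> that of the Coxeter
  element in this basis, \<open>A P = P M\<close> and \<open>U M = - L\<close>. So \<open>det (t - A) = det (t - M)\<close>, because
  \<open>det P\<close> is nonzero and cancels, and multiplication by \<open>U\<close>, of determinant 1, turns
  \<open>t - M\<close> into \<open>t U + L\<close>.\<close>

theorem coxeter_poly_eq_pencil:
  assumes G: "G \<in> carrier_mat n n" and B: "length B = n" "set B \<subseteq> carrier_vec n"
    and basis: "Determinant.det (mat_of_cols n B) \<noteq> 0"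
    and H: "\<And>i j. i < n \<Longrightarrow> j < n \<Longrightarrow> lattice_form G (B ! i) (B ! j) = H i j"
    and sym: "\<And>i j. i < n \<Longrightarrow> j < n \<Longrightarrow> H i j = H j i"
    and root: "\<And>i. i < n \<Longrightarrow> H i i = -2"
  shows "coxeter_poly G B = Determinant.det (coxeter_pencil n H)"
proof -
  let ?P = "mat_of_cols n B" and ?C = "map_mat (\<lambda>a::int. [:a:])"
  interpret comm_ring_hom "\<lambda>a::int. [:a:]" by (rule const_poly_hom)
  have P: "?P \<in> carrier_mat n n" using B(1) by auto
  obtain A where A: "A \<in> carrier_mat n n" "\<forall>x\<in>carrier_vec n. coxeter_element G B x = A *\<^sub>v x"
    using coxeter_element_as_matrix[OF G B(2)] by blast
  have dG: "dim_row G = n" using G by auto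
  have cp: "coxeter_poly G B = char_poly A"
  proof -
    have "Matrix.mat n n (\<lambda>(i, j). vec_index (coxeter_element G B (unit_vec n j)) i) = A"
      by (rule eq_matI) (use A in auto)
    then show ?thesis unfolding coxeter_poly_def endo_char_poly_def dG by simp
  qed
  have "\<exists>y. A *\<^sub>v (?P *\<^sub>v unit_vec n m) = ?P *\<^sub>v Matrix.vec n y \<and>
    (\<forall>i<n. y i = (if i = m then 1 else 0) + (\<Sum>j\<le>i. (if j = m then 1 else 0) * H j i)
                    + (\<Sum>j\<in>{i<..<n}. y j * H j i))" if m: "m < n" for m
  proof -
    let ?c = "\<lambda>i. if i = m then 1 else (0::int)"
    have u: "unit_vec n m = Matrix.vec n ?c" using m by (intro eq_vecI) auto
    obtain y where y: "coxeter_element G B (?P *\<^sub>v Matrix.vec n ?c) = ?P *\<^sub>v Matrix.vec n y"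
      "\<forall>i<n. y i = ?c i + (\<Sum>j\<le>i. ?c j * lattice_form G (B ! j) (B ! i))
                    + (\<Sum>j\<in>{i<..<n}. y j * lattice_form G (B ! j) (B ! i))"
      using coxeter_element_in_coordinates[OF G B, of ?c] by blast
    have "y i = ?c i + (\<Sum>j\<le>i. ?c j * H j i) + (\<Sum>j\<in>{i<..<n}. y j * H j i)" if "i < n" for i
    proof -
      have "(\<Sum>j\<le>i. ?c j * lattice_form G (B ! j) (B ! i)) = (\<Sum>j\<le>i. ?c j * H j i)"
        using that by (intro sum.cong) (auto simp: H)
      moreover have "(\<Sum>j\<in>{i<..<n}. y j * lattice_form G (B ! j) (B ! i)) = (\<Sum>j\<in>{i<..<n}. y j * H j i)"
        using that by (intro sum.cong) (auto simp: H)
      ultimately show ?thesis using y(2) that by simp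
    qed
    moreover have "A *\<^sub>v (?P *\<^sub>v unit_vec n m) = ?P *\<^sub>v Matrix.vec n y"
      using y(1) A(2) P unfolding u by (metis mult_mat_vec_carrier vec_carrier)
    ultimately show "\<exists>y. A *\<^sub>v (?P *\<^sub>v unit_vec n m) = ?P *\<^sub>v Matrix.vec n y \<and>
      (\<forall>i<n. y i = ?c i + (\<Sum>j\<le>i. ?c j * H j i) + (\<Sum>j\<in>{i<..<n}. y j * H j i))" by blast
  qed
  note coords = this
  define Y where "Y m = (SOME y. A *\<^sub>v (?P *\<^sub>v unit_vec n m) = ?P *\<^sub>v Matrix.vec n y \<and>
    (\<forall>i<n. y i = (if i = m then 1 else 0) + (\<Sum>j\<le>i. (if j = m then 1 else 0) * H j i)
                    + (\<Sum>j\<in>{i<..<n}. y j * H j i)))" for m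
  have Y: "A *\<^sub>v (?P *\<^sub>v unit_vec n m) = ?P *\<^sub>v Matrix.vec n (Y m)"
    "i < n \<Longrightarrow> Y m i = (if i = m then 1 else 0) + (\<Sum>j\<le>i. (if j = m then 1 else 0) * H j i)
                    + (\<Sum>j\<in>{i<..<n}. Y m j * H j i)" if "m < n" for m i
    using someI_ex[OF coords[OF that], folded Y_def] by blast+
  define M where "M = Matrix.mat n n (\<lambda>(i, m). Y m i)"
  define U where "U = Matrix.mat n n (\<lambda>(i, j). if i = j then 1 else if i < j then - H i j else 0)"
  define L where "L = Matrix.mat n n (\<lambda>(i, j). if i = j then 1 else if j < i then - H i j else 0)"
  have M: "M \<in> carrier_mat n n" and U: "U \<in> carrier_mat n n" and L: "L \<in> carrier_mat n n"
    by (auto simp: M_def U_def L_def)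
  have AP: "A * ?P = ?P * M"
  proof (rule mat_col_eqI)
    fix m assume "m < dim_col (?P * M)"
    then have m: "m < n" using M by simp
    have "col (A * ?P) m = A *\<^sub>v (?P *\<^sub>v unit_vec n m)"
    proof -
      have "col (A * ?P) m = A *\<^sub>v col ?P m" using A(1) P m by (rule col_mult2)
      also have "col ?P m = ?P *\<^sub>v unit_vec n m"
        using P m by (intro eq_vecI) auto
      finally show ?thesis .
    qed
    also have "\<dots> = ?P *\<^sub>v col M m"
      unfolding Y(1)[OF m] using m by (intro arg_cong[of _ _ "\<lambda>v. ?P *\<^sub>v v"] eq_vecI) (auto simp: M_def)
    also have "\<dots> = col (?P * M) m" by (rule col_mult2[OF P M m, symmetric])
    finally show "col (A * ?P) m = col (?P * M) m" .
  qed (use A P M in auto)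
  \<comment> \<open>This is the system of coxeter_element_in_coordinates, solved for each unit vector.\<close>
  have UM: "U * M = - L"
  proof (rule eq_matI)
    fix i m assume "i < dim_row (- L)" "m < dim_col (- L)"
    then have i: "i < n" and m: "m < n" using L by auto
    have "(U * M) $$ (i, m) = (\<Sum>j<n. (if i = j then 1 else if i < j then - H i j else 0) * Y m j)"
      using i m by (simp add: U_def M_def scalar_prod_def atLeast0LessThan)
    also have "\<dots> = (\<Sum>j<n. (if j = i then Y m j else 0) - (if i < j then Y m j * H j i else 0))"
      using sym i by (intro sum.cong) auto
    also have "\<dots> = Y m i - (\<Sum>j\<in>{i<..<n}. Y m j * H j i)"
    proof -
      have "(\<Sum>j<n. if i < j then Y m j * H j i else 0) = (\<Sum>j\<in>{i<..<n}. Y m j * H j i)"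
        by (subst sum.inter_filter[symmetric]) (auto intro!: sum.cong)
      then show ?thesis using i by (simp add: sum_subtractf)
    qed
    also have "\<dots> = (if i = m then 1 else 0) + (\<Sum>j\<le>i. (if j = m then 1 else 0) * H j i)"
      using Y(2)[OF m i] by simp
    also have "(\<Sum>j\<le>i. (if j = m then 1 else 0) * H j i) = (if m \<le> i then H m i else 0)"
      by (simp add: if_distrib[of "\<lambda>x. x * _"] cong: if_cong)
    also have "(if i = m then 1 else 0) + (if m \<le> i then H m i else 0) = (- L) $$ (i, m)"
      using i m root sym[of i m] by (auto simp: L_def)
    finally show "(U * M) $$ (i, m) = (- L) $$ (i, m)" .
  qed (use U M L in auto)
  have "Determinant.det U = prod_list (diag_mat U)"
    by (rule det_upper_triangular[OF _ U]) (auto simp: U_def)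
  also have "\<dots> = 1" unfolding prod_list_diag_prod by (intro prod.neutral) (auto simp: U_def)
  finally have detU: "Determinant.det U = 1" .
  let ?T = "[:0, 1:] \<cdot>\<^sub>m 1\<^sub>m n :: int poly Matrix.mat"
  have cm: "char_poly_matrix X = ?T - ?C X" if "X \<in> carrier_mat n n" for X
    by (rule eq_matI) (use that in \<open>auto simp: char_poly_matrix_def\<close>)
  have CC: "?C X \<in> carrier_mat n n" if "X \<in> carrier_mat n n" for X using that by simp
  have TX: "?T * X = [:0, 1:] \<cdot>\<^sub>m X" and XT: "X * ?T = [:0, 1:] \<cdot>\<^sub>m X"
    if "X \<in> carrier_mat n n" for X :: "int poly Matrix.mat"
    using that by (auto simp: mult_smult_assoc_mat[of _ n n _ n] mult_smult_distrib[of _ n n _ n])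
  have T: "?T \<in> carrier_mat n n" by simp
  have 1: "char_poly_matrix A * ?C ?P = ?C ?P * char_poly_matrix M"
  proof -
    have "char_poly_matrix A * ?C ?P = ?T * ?C ?P - ?C A * ?C ?P"
      unfolding cm[OF A(1)] by (rule minus_mult_distrib_mat[OF T CC[OF A(1)] CC[OF P]])
    also have "\<dots> = ?C ?P * ?T - ?C (A * ?P)"
      by (simp only: TX[OF CC[OF P]] XT[OF CC[OF P]] mat_hom_mult[OF A(1) P])
    also have "\<dots> = ?C ?P * ?T - ?C ?P * ?C M" unfolding AP mat_hom_mult[OF P M] ..
    also have "\<dots> = ?C ?P * char_poly_matrix M"
      unfolding cm[OF M] by (rule mult_minus_distrib_mat[OF CC[OF P] T CC[OF M], symmetric])
    finally show ?thesis .
  qed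
  have 2: "?C U * char_poly_matrix M = coxeter_pencil n H"
  proof -
    have "?C U * char_poly_matrix M = ?C U * ?T - ?C U * ?C M"
      unfolding cm[OF M] by (rule mult_minus_distrib_mat[OF CC[OF U] T CC[OF M]])
    also have "\<dots> = [:0, 1:] \<cdot>\<^sub>m ?C U - ?C (- L)"
      unfolding XT[OF CC[OF U]] mat_hom_mult[OF U M, symmetric] UM ..
    also have "\<dots> = coxeter_pencil n H"
      by (rule eq_matI) (auto simp: U_def L_def coxeter_pencil_def)
    finally show ?thesis .
  qed
  have "char_poly A * Determinant.det (?C ?P) = Determinant.det (?C ?P) * char_poly M"
    using arg_cong[OF 1, of Determinant.det] A(1) P M unfolding char_poly_def
    by (subst (asm) (1 2) det_mult[of _ n]) auto
  moreover have "Determinant.det (?C ?P) \<noteq> 0" using basis by simp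
  ultimately have "char_poly A = char_poly M" by (metis mult.commute mult_right_cancel)
  also have "\<dots> = Determinant.det (?C U) * Determinant.det (char_poly_matrix M)"
    using detU by (simp add: char_poly_def)
  also have "\<dots> = Determinant.det (coxeter_pencil n H)"
    unfolding 2[symmetric] using U M by (intro det_mult[of _ n, symmetric]) auto
  finally show ?thesis using cp by simp
qed

section \<open>The Gram matrices of the extended star lattices\<close>

definition arms :: "nat list \<Rightarrow> (nat \<times> nat) list" where
  "arms \<alpha>s = concat (map (\<lambda>i. map (Pair i) [1..<\<alpha>s ! i]) [0..<length \<alpha>s])"

text \<open>\<open>Inl (i, j)\<close> is the \<open>j\<close>-th vertex of arm \<open>i\<close>; \<open>Inr 0\<close>, \<open>Inr 1\<close> and \<open>Inr 2\<close> are the basis vectors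
  \<open>E\<close>, \<open>E - u\<close> and \<open>u - w\<close>. So \<open>s = 1, 2, 3\<close> yields the bases \<open>B\<^sub>-\<close>, \<open>B\<^sub>0\<close> and \<open>B\<^sub>+\<close>.\<close>

definition nodes :: "nat list \<Rightarrow> nat \<Rightarrow> ((nat \<times> nat) + nat) list" where
  "nodes \<alpha>s s = map Inl (arms \<alpha>s) @ map Inr [0..<s]"

text \<open>The form in these bases. As \<open>u\<close> is isotropic and orthogonal to the star, \<open>E - u\<close> has the same
  products with the arms as \<open>E\<close>, and \<open>\<langle>E, E - u\<rangle> = -2\<close>; \<open>u - w\<close> has product 1 with \<open>E - u\<close> and is
  orthogonal to the rest.\<close>

fun ext_form :: "nat list \<Rightarrow> (nat \<times> nat) + nat \<Rightarrow> (nat \<times> nat) + nat \<Rightarrow> int" where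
  "ext_form \<alpha>s (Inl (i, j)) (Inl (i', j')) = star_form \<alpha>s (Arm i j) (Arm i' j')"
| "ext_form \<alpha>s (Inl (i, j)) (Inr c) = (if c < 2 \<and> j = \<alpha>s ! i - 1 then 1 else 0)"
| "ext_form \<alpha>s (Inr c) (Inl (i, j)) = (if c < 2 \<and> j = \<alpha>s ! i - 1 then 1 else 0)"
| "ext_form \<alpha>s (Inr c) (Inr c') = (if c = c' \<or> c + c' = 1 then -2 else if c + c' = 3 then 1 else 0)"

lemma ext_form_sym: "ext_form \<alpha>s v w = ext_form \<alpha>s w v"
  by (cases "(\<alpha>s, v, w)" rule: ext_form.cases) (auto simp: add.commute)

lemma ext_form_root: "ext_form \<alpha>s v v = -2"
  by (cases v) auto

lemma set_arms: "set (arms \<alpha>s) = Sigma {..<length \<alpha>s} (\<lambda>i. {1..<\<alpha>s ! i})"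
  unfolding arms_def by auto

text \<open>Arm by arm, and in each arm from the tip to the centre. This decides which entry of a pair in the
  pencil carries the factor \<open>t\<close>.\<close>

lemma sorted_arms:
  "sorted_wrt (\<lambda>v w. fst v < fst w \<or> (fst v = fst w \<and> snd v < snd w)) (arms \<alpha>s)"
proof -
  have "sorted_wrt (\<lambda>v w. fst v < fst w \<or> (fst v = fst w \<and> snd v < snd w))
      (concat (map (\<lambda>i. map (Pair i) [1..<g i]) [0..<k]))" for g :: "nat \<Rightarrow> nat" and k
    by (induction k) (auto simp: sorted_wrt_append sorted_wrt_map)
  then show ?thesis unfolding arms_def .
qed

lemma arms_less:
  assumes "a < b" "b < length (arms \<alpha>s)" "arms \<alpha>s ! a = (i, j)" "arms \<alpha>s ! b = (i', j')"
  shows "i < i' \<or> (i = i' \<and> j < j')"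
  using sorted_wrt_nth_less[OF sorted_arms assms(1,2)] assms(3,4) by simp

lemma distinct_arms: "distinct (arms \<alpha>s)"
  unfolding distinct_conv_nth
proof (intro allI impI)
  fix a b assume "a < length (arms \<alpha>s)" "b < length (arms \<alpha>s)" "a \<noteq> b"
  then show "arms \<alpha>s ! a \<noteq> arms \<alpha>s ! b"
    using arms_less[of a b \<alpha>s] arms_less[of b a \<alpha>s]
    by (metis less_irrefl nat_neq_iff surj_pair)
qed

lemma sum_arms:
  "(\<Sum>b<length (arms \<alpha>s). F (arms \<alpha>s ! b)) = (\<Sum>v\<in>set (arms \<alpha>s). F v)"
  using sum.reindex_bij_betw[OF bij_betw_nth[OF distinct_arms refl refl], of F] .

lemma star_vertices_eq:
  "star_vertices \<alpha>s = map (\<lambda>(i, j). Arm i j) (arms \<alpha>s) @ [Centre]"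
  unfolding star_vertices_def arms_def by (simp add: map_concat comp_def)

lemma star_rank_eq: "star_rank \<alpha>s = Suc (length (arms \<alpha>s))"
  unfolding star_rank_def star_vertices_eq by simp

lemma star_form_eq_ext_form:
  assumes "a < star_rank \<alpha>s" "b < star_rank \<alpha>s" "s \<ge> 1"
  shows "star_form \<alpha>s (star_vertices \<alpha>s ! a) (star_vertices \<alpha>s ! b) =
    ext_form \<alpha>s (nodes \<alpha>s s ! a) (nodes \<alpha>s s ! b)"
proof -
  have *: "(\<exists>i j. star_vertices \<alpha>s ! a = Arm i j \<and> nodes \<alpha>s s ! a = Inl (i, j)) \<or>
    (star_vertices \<alpha>s ! a = Centre \<and> nodes \<alpha>s s ! a = Inr 0)" if "a < star_rank \<alpha>s" for a
  proof (cases "a < length (arms \<alpha>s)")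
    case True
    then show ?thesis unfolding star_vertices_eq nodes_def
      by (cases "arms \<alpha>s ! a") (simp add: nth_append)
  next
    case False
    then have "a = length (arms \<alpha>s)" using that by (simp add: star_rank_eq)
    then show ?thesis unfolding star_vertices_eq nodes_def using assms(3)
      by (simp add: nth_append)
  qed
  show ?thesis using *[OF assms(1)] *[OF assms(2)] by auto
qed

lemma nodes_centre:
  "c < s \<Longrightarrow> nodes \<alpha>s s ! (length (arms \<alpha>s) + c) = Inr c"
  unfolding nodes_def by (simp add: nth_append)

definition ext_pencil :: "nat list \<Rightarrow> nat \<Rightarrow> int poly Matrix.mat" where
  "ext_pencil \<alpha>s s = coxeter_pencil (length (arms \<alpha>s) + s)
     (\<lambda>a b. ext_form \<alpha>s (nodes \<alpha>s s ! a) (nodes \<alpha>s s ! b))"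

lemma lattice_form_diff_left:
  assumes "G \<in> carrier_mat n n" "x \<in> carrier_vec n" "y \<in> carrier_vec n" "z \<in> carrier_vec n"
  shows "lattice_form G (x - y) z = lattice_form G x z - lattice_form G y z"
  using assms unfolding lattice_form_def by (intro minus_scalar_prod_distrib[of _ n]) auto

lemma lattice_form_diff_right:
  assumes "G \<in> carrier_mat n n" "x \<in> carrier_vec n" "y \<in> carrier_vec n" "z \<in> carrier_vec n"
  shows "lattice_form G z (x - y) = lattice_form G z x - lattice_form G z y"
proof -
  have "G *\<^sub>v (x - y) = G *\<^sub>v x - G *\<^sub>v y" using assms by (intro mult_minus_distrib_mat_vec) auto
  then show ?thesis using assms unfolding lattice_form_def
    by (simp add: scalar_prod_minus_distrib[of _ n])
qed

lemma lattice_form_unit: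
  assumes "G \<in> carrier_mat n n" "a < n" "b < n"
  shows "lattice_form G (unit_vec n a) (unit_vec n b) = G $$ (a, b)"
proof -
  have "lattice_form G (unit_vec n a) (unit_vec n b) = vec_index (G *\<^sub>v unit_vec n b) a"
    unfolding lattice_form_def using assms by (intro scalar_prod_left_unit) auto
  then show ?thesis using assms by simp
qed

lemma det_mat_of_cols_triangular:
  assumes "length B = n" "\<And>i j. j < i \<Longrightarrow> i < n \<Longrightarrow> vec_index (B ! j) i = 0"
    "\<And>i. i < n \<Longrightarrow> vec_index (B ! i) i \<noteq> (0::int)"
  shows "Determinant.det (mat_of_cols n B) \<noteq> 0"
proof -
  have P: "mat_of_cols n B \<in> carrier_mat n n" using assms(1) by auto
  have "Determinant.det (mat_of_cols n B) = prod_list (diag_mat (mat_of_cols n B))"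
    by (rule det_upper_triangular[OF _ P]) (use assms in \<open>auto simp: mat_of_cols_def\<close>)
  also have "\<dots> = (\<Prod>i = 0..<n. vec_index (B ! i) i)"
    unfolding prod_list_diag_prod by (intro prod.cong) (use assms in \<open>auto simp: mat_of_cols_def\<close>)
  finally show ?thesis using assms(3) by simp
qed

lemma V_minus_carrier: "V_minus \<alpha>s \<in> carrier_mat (star_rank \<alpha>s) (star_rank \<alpha>s)"
  by (simp add: V_minus_def)

lemma V_minus_index:
  assumes "a < star_rank \<alpha>s" "b < star_rank \<alpha>s" "s \<ge> 1"
  shows "V_minus \<alpha>s $$ (a, b) = ext_form \<alpha>s (nodes \<alpha>s s ! a) (nodes \<alpha>s s ! b)"
  unfolding V_minus_def using assms star_form_eq_ext_form[OF assms] by simp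

lemma Delta_minus_eq: "Delta_minus \<alpha>s = Determinant.det (ext_pencil \<alpha>s 1)"
proof -
  let ?n = "star_rank \<alpha>s"
  have B: "B_minus \<alpha>s ! a = unit_vec ?n a" if "a < ?n" for a using that by (simp add: B_minus_def)
  have "coxeter_poly (V_minus \<alpha>s) (B_minus \<alpha>s) = Determinant.det (coxeter_pencil ?n
     (\<lambda>a b. ext_form \<alpha>s (nodes \<alpha>s 1 ! a) (nodes \<alpha>s 1 ! b)))"
  proof (rule coxeter_poly_eq_pencil[OF V_minus_carrier])
    show "Determinant.det (mat_of_cols ?n (B_minus \<alpha>s)) \<noteq> 0"
      by (rule det_mat_of_cols_triangular) (auto simp: B_minus_def)
    show "lattice_form (V_minus \<alpha>s) (B_minus \<alpha>s ! i) (B_minus \<alpha>s ! j) =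
        ext_form \<alpha>s (nodes \<alpha>s 1 ! i) (nodes \<alpha>s 1 ! j)" if "i < ?n" "j < ?n" for i j
      using that by (simp add: B lattice_form_unit[OF V_minus_carrier] V_minus_index)
  qed (auto simp: B_minus_def ext_form_root intro: ext_form_sym)
  then show ?thesis unfolding Delta_minus_def ext_pencil_def by (simp add: star_rank_eq)
qed

lemma append_zero_unit_vec:
  "a < n \<Longrightarrow> unit_vec n a @\<^sub>v 0\<^sub>v k = (unit_vec (n + k) a :: int Matrix.vec)"
  by (rule eq_vecI) auto

text \<open>Both extensions have this shape: after the star the basis continues with differences of consecutive
  unit vectors, the unit vectors with indices \<open>m\<close>, \<open>m + 1\<close>, \<open>m + 2\<close> being \<open>E\<close>, \<open>u\<close>, \<open>w\<close>. The matrix of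
  the basis is triangular with diagonal entries 1 and -1.\<close>

lemma coxeter_poly_extended_star:
  fixes \<alpha>s
  defines "m \<equiv> length (arms \<alpha>s)"
  assumes s: "s \<in> {2, 3}" and N: "N = m + s" and G: "G \<in> carrier_mat N N"
    and Gi: "\<And>a b. a < N \<Longrightarrow> b < N \<Longrightarrow> G $$ (a, b) =
      (if a < m + 1 \<and> b < m + 1 then ext_form \<alpha>s (nodes \<alpha>s s ! a) (nodes \<alpha>s s ! b)
       else if (a = m + 1 \<and> b = m + 2) \<or> (a = m + 2 \<and> b = m + 1) then 1 else 0)"
    and B: "B = map (unit_vec N) [0..<m + 1] @
      map (\<lambda>c. unit_vec N (m + c) - unit_vec N (m + c + 1)) [0..<s - 1]"
  shows "coxeter_poly G B = Determinant.det (ext_pencil \<alpha>s s)"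
  unfolding ext_pencil_def m_def[symmetric] N[symmetric]
proof (rule coxeter_poly_eq_pencil[OF G])
  show lenB: "length B = N" unfolding B using s by (auto simp: N)
  have BU: "B ! a = unit_vec N a" if "a < m + 1" for a
    using that unfolding B by (simp add: nth_append del: upt_Suc)
  have BL: "B ! (m + 1 + c) = unit_vec N (m + c) - unit_vec N (m + c + 1)" if "c < s - 1" for c
    using that unfolding B by (simp add: nth_append del: upt_Suc)
  have v: "nodes \<alpha>s s ! (m + c) = Inr c" if "c < s" for c
    using nodes_centre[OF that] by (simp add: m_def)
  have arm: "\<exists>i j. nodes \<alpha>s s ! a = Inl (i, j)" if "a < m" for a
    using that unfolding nodes_def m_def by (cases "arms \<alpha>s ! a") (simp add: nth_append)
  have range: "a < m + 1 \<or> a = m + 1 \<or> (a = m + 2 \<and> 2 < s)" if "a < N" for a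
    using that s by (auto simp: N)
  show "set B \<subseteq> carrier_vec N" unfolding B by auto
  show "Determinant.det (mat_of_cols N B) \<noteq> 0"
  proof (rule det_mat_of_cols_triangular[OF lenB])
    show "vec_index (B ! j) i = 0" if "j < i" "i < N" for i j
      using that range[of j] BU[of j] BL[of 0] BL[of 1] s by (auto simp: N)
    show "vec_index (B ! i) i \<noteq> 0" if "i < N" for i
      using that range[of i] BU[of i] BL[of 0] BL[of 1] s by (auto simp: N)
  qed
  show "lattice_form G (B ! a) (B ! b) = ext_form \<alpha>s (nodes \<alpha>s s ! a) (nodes \<alpha>s s ! b)"
    if "a < N" "b < N" for a b
  proof -
    have lt: "\<And>a. a < m \<Longrightarrow> a < N" "m < N" "Suc m < N" "2 < s \<Longrightarrow> Suc (Suc m) < N" "0 < s - Suc 0"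
      "2 < s \<Longrightarrow> Suc 0 < s - Suc 0" "0 < s" "Suc 0 < s"
      using s by (auto simp: N)
    have v2: "nodes \<alpha>s s ! Suc (Suc m) = Inr 2" if "2 < s" using v[OF that] by simp
    have "a < m \<or> a = m \<or> a = m + 1 \<or> (a = m + 2 \<and> 2 < s)"
      "b < m \<or> b = m \<or> b = m + 1 \<or> (b = m + 2 \<and> 2 < s)" using range that by fastforce+
    then show ?thesis
      using arm[of a] arm[of b]
      by (elim disjE) (auto simp: BU BL[of 0, simplified] BL[of 1, simplified] v[of 0, simplified]
        v[of 1, simplified] v2 Gi lt lattice_form_unit[OF G]
        lattice_form_diff_left[OF G] lattice_form_diff_right[OF G])
  qed
qed (auto simp: ext_form_root intro: ext_form_sym)

lemma Delta_zero_eq: "Delta_zero \<alpha>s = Determinant.det (ext_pencil \<alpha>s 2)"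
  unfolding Delta_zero_def
proof (rule coxeter_poly_extended_star)
  let ?m = "length (arms \<alpha>s)"
  have n: "star_rank \<alpha>s = ?m + 1" by (simp add: star_rank_eq)
  show "V_zero \<alpha>s \<in> carrier_mat (?m + 2) (?m + 2)"
    using V_minus_carrier[of \<alpha>s] unfolding V_zero_def lattice_u_def n by (auto simp: Let_def)
  show "V_zero \<alpha>s $$ (a, b) =
      (if a < ?m + 1 \<and> b < ?m + 1 then ext_form \<alpha>s (nodes \<alpha>s 2 ! a) (nodes \<alpha>s 2 ! b)
       else if (a = ?m + 1 \<and> b = ?m + 2) \<or> (a = ?m + 2 \<and> b = ?m + 1) then 1 else 0)"
    if "a < ?m + 2" "b < ?m + 2" for a b
    using that V_minus_carrier[of \<alpha>s] V_minus_index[of a \<alpha>s b 2]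
    unfolding V_zero_def lattice_u_def n by (auto simp: Let_def)
  show "B_zero \<alpha>s = map (unit_vec (?m + 2)) [0..<?m + 1] @
      map (\<lambda>c. unit_vec (?m + 2) (?m + c) - unit_vec (?m + 2) (?m + c + 1)) [0..<2 - 1]"
    unfolding B_zero_def Let_def B_minus_def n by (auto simp: append_zero_unit_vec)
qed auto

lemma Delta_plus_eq: "Delta_plus \<alpha>s = Determinant.det (ext_pencil \<alpha>s 3)"
  unfolding Delta_plus_def
proof (rule coxeter_poly_extended_star)
  let ?m = "length (arms \<alpha>s)"
  have n: "star_rank \<alpha>s = ?m + 1" by (simp add: star_rank_eq)
  show "V_plus \<alpha>s \<in> carrier_mat (?m + 3) (?m + 3)"
    using V_minus_carrier[of \<alpha>s] unfolding V_plus_def lattice_uw_def n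
    by (auto simp: Let_def mat_of_rows_list_def)
  show "V_plus \<alpha>s $$ (a, b) =
      (if a < ?m + 1 \<and> b < ?m + 1 then ext_form \<alpha>s (nodes \<alpha>s 3 ! a) (nodes \<alpha>s 3 ! b)
       else if (a = ?m + 1 \<and> b = ?m + 2) \<or> (a = ?m + 2 \<and> b = ?m + 1) then 1 else 0)"
    if "a < ?m + 3" "b < ?m + 3" for a b
  proof -
    have "a < ?m + 1 \<or> a = ?m + 1 \<or> a = ?m + 2" "b < ?m + 1 \<or> b = ?m + 1 \<or> b = ?m + 2" using that by auto
    then show ?thesis
      using that V_minus_carrier[of \<alpha>s] V_minus_index[of a \<alpha>s b 3]
      unfolding V_plus_def lattice_uw_def n
      by (elim disjE) (auto simp: Let_def mat_of_rows_list_def)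
  qed
  have N: "?m + 1 + 2 = ?m + 3" "[0..<3 - 1] = [0, 1 :: nat]" by (simp_all add: upt_rec)
  show "B_plus \<alpha>s = map (unit_vec (?m + 3)) [0..<?m + 1] @
      map (\<lambda>c. unit_vec (?m + 3) (?m + c) - unit_vec (?m + 3) (?m + c + 1)) [0..<3 - 1]"
    unfolding B_plus_def Let_def B_minus_def n N
    using append_zero_unit_vec[of _ "?m + 1" 2] unfolding N by auto
qed auto

section \<open>Elimination of the arms\<close>

lemma fps_of_int_poly_hom: "comm_ring_hom fps_of_int_poly"
  by unfold_locales
     (simp_all add: fps_of_int_poly_def of_int_poly_hom.hom_mult of_int_poly_hom.hom_add
        fps_of_poly_mult fps_of_poly_add)

lemma fps_of_int_poly_pCons: "fps_of_int_poly (pCons a p) = of_int a + fps_X * fps_of_int_poly p"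
  unfolding fps_of_int_poly_def
  by (simp add: of_int_hom.map_poly_pCons_hom fps_of_poly_pCons fps_of_int mult.commute)

lemma fps_of_int_poly_0: "fps_of_int_poly 0 = 0"
  unfolding fps_of_int_poly_def by simp

text \<open>These are the characteristic polynomials of the Coxeter elements of the arms, that is of type \<open>A\<close>.
  They are taken as power series because there they are units.\<close>

definition qnum :: "nat \<Rightarrow> rat fps" where
  "qnum n = (\<Sum>i<n. fps_X ^ i)"

lemma qnum_0 [simp]: "qnum 0 = 0" and qnum_1 [simp]: "qnum (Suc 0) = 1"
  by (simp_all add: qnum_def)

lemma qnum_Suc: "qnum (Suc n) = 1 + fps_X * qnum n"
  unfolding qnum_def sum_distrib_left by (subst sum.lessThan_Suc_shift) simp

lemma qnum_Suc_Suc: "qnum (Suc (Suc n)) = (1 + fps_X) * qnum (Suc n) - fps_X * qnum n"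
  by (simp add: qnum_Suc algebra_simps)

lemma qnum_unit: "n \<ge> 1 \<Longrightarrow> qnum n * inverse (qnum n) = 1"
proof -
  assume "n \<ge> 1"
  then obtain k where "n = Suc k" by (cases n) auto
  then have "fps_nth (qnum n) 0 \<noteq> 0" by (simp add: qnum_Suc)
  then show ?thesis by (simp add: inverse_mult_eq_1')
qed

lemma qnum_closed: "(1 - fps_X) * qnum n = 1 - fps_X ^ n"
  unfolding qnum_def by (simp add: one_diff_power_eq)

definition arm_entry :: "nat \<times> nat \<Rightarrow> nat \<times> nat \<Rightarrow> rat fps" where
  "arm_entry v w = (if fst v \<noteq> fst w then 0 else if snd v = snd w then 1 + fps_X
     else if snd w = Suc (snd v) then - fps_X else if snd v = Suc (snd w) then -1 else 0)"

lemma arm_row_sum: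
  assumes "(i, j) \<in> set (arms \<alpha>s)"
  shows "(\<Sum>w\<in>set (arms \<alpha>s). arm_entry (i, j) w * g w) =
    (1 + fps_X) * g (i, j) - (if 1 < j then g (i, j - 1) else 0)
      - (if Suc j < \<alpha>s ! i then fps_X * g (i, Suc j) else 0)"
proof -
  have ij: "i < length \<alpha>s" "1 \<le> j" "j < \<alpha>s ! i" using assms by (auto simp: set_arms)
  have "(\<Sum>w\<in>set (arms \<alpha>s). arm_entry (i, j) w * g w) =
    (\<Sum>w\<in>set (arms \<alpha>s). (if w = (i, j) then (1 + fps_X) * g w else 0)
      + (if w = (i, j - 1) then - g w else 0) + (if w = (i, Suc j) then - fps_X * g w else 0))"
    by (intro sum.cong refl) (use ij in \<open>auto simp: arm_entry_def split: prod.splits\<close>)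
  also have "\<dots> = (1 + fps_X) * g (i, j) - (if 1 < j then g (i, j - 1) else 0)
      - (if Suc j < \<alpha>s ! i then fps_X * g (i, Suc j) else 0)"
    unfolding sum.distrib using ij by (auto simp: set_arms)
  finally show ?thesis .
qed

text \<open>The four blocks of the pencil, according to the division of the basis into arms and central
  vectors.\<close>

definition arm_matrix :: "nat list \<Rightarrow> rat fps Matrix.mat" where
  "arm_matrix \<alpha>s = (let v = arms \<alpha>s in
     Matrix.mat (length v) (length v) (\<lambda>(a, b). arm_entry (v ! a) (v ! b)))"

definition arm_to_centre :: "nat list \<Rightarrow> nat \<Rightarrow> rat fps Matrix.mat" where
  "arm_to_centre \<alpha>s s = Matrix.mat (length (arms \<alpha>s)) s
     (\<lambda>(a, c). - of_int (ext_form \<alpha>s (Inl (arms \<alpha>s ! a)) (Inr c)) * fps_X)"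

definition centre_to_arm :: "nat list \<Rightarrow> nat \<Rightarrow> rat fps Matrix.mat" where
  "centre_to_arm \<alpha>s s = Matrix.mat s (length (arms \<alpha>s))
     (\<lambda>(c, a). - of_int (ext_form \<alpha>s (Inr c) (Inl (arms \<alpha>s ! a))))"

definition centre_matrix :: "nat list \<Rightarrow> nat \<Rightarrow> rat fps Matrix.mat" where
  "centre_matrix \<alpha>s s = Matrix.mat s s (\<lambda>(c, d). if c = d then 1 + fps_X
     else if c < d then - of_int (ext_form \<alpha>s (Inr c) (Inr d)) * fps_X
     else - of_int (ext_form \<alpha>s (Inr c) (Inr d)))"

lemma ext_pencil_blocks:
  "map_mat fps_of_int_poly (ext_pencil \<alpha>s s) =
     four_block_mat (arm_matrix \<alpha>s) (arm_to_centre \<alpha>s s) (centre_to_arm \<alpha>s s) (centre_matrix \<alpha>s s)"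
  (is "?L = ?R")
proof (rule eq_matI)
  let ?m = "length (arms \<alpha>s)"
  show dims: "dim_row ?L = dim_row ?R" "dim_col ?L = dim_col ?R"
    by (simp_all add: ext_pencil_def coxeter_pencil_def arm_matrix_def Let_def centre_matrix_def)
  fix a b assume "a < dim_row ?R" "b < dim_col ?R"
  then have ab: "a < ?m + s" "b < ?m + s"
    by (simp_all add: arm_matrix_def Let_def centre_matrix_def)
  have L: "?L $$ (a, b) = (if a = b then 1 + fps_X
     else if a < b then - of_int (ext_form \<alpha>s (nodes \<alpha>s s ! a) (nodes \<alpha>s s ! b)) * fps_X
     else - of_int (ext_form \<alpha>s (nodes \<alpha>s s ! a) (nodes \<alpha>s s ! b)))"
    using ab by (simp add: ext_pencil_def coxeter_pencil_def fps_of_int_poly_pCons fps_of_int_poly_0)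
  have arm: "nodes \<alpha>s s ! a = Inl (arms \<alpha>s ! a)" if "a < ?m" for a
    using that by (simp add: nodes_def nth_append)
  have cen: "nodes \<alpha>s s ! a = Inr (a - ?m)" if "\<not> a < ?m" "a < ?m + s" for a
    using that by (auto simp: nodes_def nth_append)
  show "?L $$ (a, b) = ?R $$ (a, b)"
  proof (cases "a < ?m"; cases "b < ?m")
    assume a: "a < ?m" and b: "b < ?m"
    obtain i j i' j' where v: "arms \<alpha>s ! a = (i, j)" "arms \<alpha>s ! b = (i', j')"
      by (metis surj_pair)
    have R: "?R $$ (a, b) = arm_entry (i, j) (i', j')"
      using a b v by (simp add: arm_matrix_def Let_def centre_matrix_def)
    consider "a = b" | "a < b" | "b < a" by linarith
    then show ?thesis
    proof cases
      case 1
      then show ?thesis using v unfolding L R by (simp add: arm_entry_def)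
    next
      case 2
      then show ?thesis using arms_less[OF 2 b v] v
        unfolding L R arm[OF a] arm[OF b] by (auto simp: arm_entry_def)
    next
      case 3
      then show ?thesis using arms_less[OF 3 a v(2,1)] v
        unfolding L R arm[OF a] arm[OF b] by (auto simp: arm_entry_def)
    qed
  next
    assume a: "a < ?m" and b: "\<not> b < ?m"
    then show ?thesis using ab unfolding L arm[OF a] cen[OF b ab(2)]
      by (simp add: arm_matrix_def Let_def centre_matrix_def arm_to_centre_def)
  next
    assume a: "\<not> a < ?m" and b: "b < ?m"
    then show ?thesis using ab unfolding L arm[OF b] cen[OF a ab(1)]
      by (simp add: arm_matrix_def Let_def centre_matrix_def centre_to_arm_def)
  next
    assume a: "\<not> a < ?m" and b: "\<not> b < ?m"
    then show ?thesis using ab unfolding L cen[OF a ab(1)] cen[OF b ab(2)]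
      by (auto simp: arm_matrix_def Let_def centre_matrix_def)
  qed
qed

text \<open>The matrix \<open>W\<close> below is upper unitriangular, and its columns are the solutions of the three-term
  recurrence of \<open>qnum\<close>; multiplication by it makes the block of the arms lower triangular with
  diagonal entries \<open>q (j + 1) / q j\<close>, whose product over an arm telescopes.\<close>

lemma det_arm_matrix:
  assumes "\<And>\<alpha>. \<alpha> \<in> set \<alpha>s \<Longrightarrow> \<alpha> \<ge> 1"
  shows "Determinant.det (arm_matrix \<alpha>s) = (\<Prod>i<length \<alpha>s. qnum (\<alpha>s ! i))"
proof -
  define v where "v = arms \<alpha>s"
  define m where "m = length v"
  define w where "w = (\<lambda>(i' :: nat, j') (i, j). if i = i' \<and> j \<le> j'
     then fps_X ^ (j' - j) * qnum j * inverse (qnum j') else (0 :: rat fps))"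
  define W where "W = Matrix.mat m m (\<lambda>(a, b). w (v ! b) (v ! a))"
  have vs: "v ! a \<in> set (arms \<alpha>s)" if "a < m" for a
    using that by (simp add: m_def v_def)
  have A: "arm_matrix \<alpha>s \<in> carrier_mat m m" and W: "W \<in> carrier_mat m m"
    by (simp_all add: arm_matrix_def Let_def v_def m_def W_def)
  have AW: "(arm_matrix \<alpha>s * W) $$ (a, b) = (1 + fps_X) * w (v ! b) (i, j)
       - (if 1 < j then w (v ! b) (i, j - 1) else 0) - (if Suc j < \<alpha>s ! i then fps_X * w (v ! b) (i, Suc j) else 0)"
    if a: "a < m" and b: "b < m" and ij: "v ! a = (i, j)" for a b i j
  proof -
    have "(arm_matrix \<alpha>s * W) $$ (a, b) = (\<Sum>c<m. arm_entry (v ! a) (v ! c) * w (v ! b) (v ! c))"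
      using a b A by (simp add: scalar_prod_def atLeast0LessThan W_def)
         (simp add: arm_matrix_def Let_def v_def m_def)
    also have "\<dots> = (\<Sum>u\<in>set (arms \<alpha>s). arm_entry (i, j) u * w (v ! b) u)"
      unfolding ij unfolding m_def v_def by (rule sum_arms)
    finally show ?thesis using arm_row_sum[of i j \<alpha>s "w (v ! b)"] vs[OF a] ij by simp
  qed
  have lower: "(arm_matrix \<alpha>s * W) $$ (a, b) = 0" if "a < b" "b < m" for a b
  proof -
    obtain i j i' j' where ij: "v ! a = (i, j)" "v ! b = (i', j')" by (metis surj_pair)
    have lt: "i < i' \<or> (i = i' \<and> j < j')"
      using arms_less[OF that(1) _ ij[unfolded v_def]] that(2) by (simp add: m_def v_def)
    show ?thesis
    proof (cases "i < i'")
      case True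
      then show ?thesis using AW[OF _ that(2) ij(1)] that unfolding ij(2) by (simp add: w_def)
    next
      case False
      then have l: "i = i'" "j < j'" using lt by auto
      have j: "1 \<le> j" and j': "j' < \<alpha>s ! i" using vs[of a] vs[of b] that ij l by (auto simp: set_arms)
      obtain d where d: "j' = Suc (j + d)" using l(2) less_iff_Suc_add by blast
      obtain k where k: "j = Suc k" using j by (cases j) auto
      have m1: "(if 1 < j then w (i', j') (i, j - 1) else 0) = fps_X ^ (d + 2) * qnum k * inverse (qnum j')"
        using l d k by (cases k) (auto simp: w_def Suc_diff_le)
      have m2: "w (i', j') (i, j) = fps_X ^ (d + 1) * qnum (Suc k) * inverse (qnum j')"
        using l d k by (auto simp: w_def Suc_diff_le)
      have m3: "(if Suc j < \<alpha>s ! i then fps_X * w (i', j') (i, Suc j) else 0) =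
          fps_X ^ (d + 1) * qnum (Suc (Suc k)) * inverse (qnum j')"
        using l d k j' by (auto simp: w_def)
      have "(arm_matrix \<alpha>s * W) $$ (a, b) =
          (1 + fps_X) * (fps_X ^ (d + 1) * qnum (Suc k) * inverse (qnum j'))
          - fps_X ^ (d + 2) * qnum k * inverse (qnum j')
          - fps_X ^ (d + 1) * qnum (Suc (Suc k)) * inverse (qnum j')"
        using AW[OF _ that(2) ij(1)] that unfolding ij(2) m1 m2 m3 by simp
      then show ?thesis unfolding qnum_Suc_Suc by (simp add: algebra_simps)
    qed
  qed
  have diag: "(arm_matrix \<alpha>s * W) $$ (a, a) = qnum (Suc (snd (v ! a))) * inverse (qnum (snd (v ! a)))"
    if "a < m" for a
  proof -
    obtain i j where ij: "v ! a = (i, j)" by (metis surj_pair)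
    have j: "1 \<le> j" using vs[OF that] ij by (auto simp: set_arms)
    then obtain k where k: "j = Suc k" by (cases j) auto
    have m1: "(if 1 < j then w (i, j) (i, j - 1) else 0) = fps_X * qnum k * inverse (qnum j)"
      using k by (cases k) (auto simp: w_def)
    have "(arm_matrix \<alpha>s * W) $$ (a, a) =
        (1 + fps_X) * (qnum (Suc k) * inverse (qnum j)) - fps_X * qnum k * inverse (qnum j)"
      using AW[OF that that ij] unfolding ij m1 using k by (simp add: w_def)
    then show ?thesis unfolding ij snd_conv k qnum_Suc_Suc by (simp add: algebra_simps)
  qed
  have "Determinant.det W = prod_list (diag_mat W)"
  proof (rule det_upper_triangular[OF upper_triangularI W])
    fix a b assume "b < a" "a < dim_row W"
    then have a: "b < a" "a < m" using W by auto
    obtain i j i' j' where ij: "v ! a = (i, j)" "v ! b = (i', j')" by (metis surj_pair)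
    have "i' < i \<or> (i' = i \<and> j' < j)"
      using arms_less[OF a(1) _ ij(2,1)[unfolded v_def]] a(2) by (simp add: m_def v_def)
    then show "W $$ (a, b) = 0" using a ij by (auto simp: W_def w_def)
  qed
  also have "\<dots> = 1" unfolding prod_list_diag_prod
  proof (intro prod.neutral ballI)
    fix a assume "a \<in> {0..<dim_row W}"
    then have a: "a < m" using W by auto
    obtain i j where ij: "v ! a = (i, j)" by (metis surj_pair)
    have "1 \<le> j" using vs[OF a] ij by (auto simp: set_arms)
    then show "W $$ (a, a) = 1" using a ij qnum_unit[of j] by (simp add: W_def w_def)
  qed
  finally have "Determinant.det (arm_matrix \<alpha>s) = Determinant.det (arm_matrix \<alpha>s * W)"
    using det_mult[OF A W] by simp
  also have "\<dots> = prod_list (diag_mat (arm_matrix \<alpha>s * W))"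
    by (rule det_lower_triangular[of m]) (use lower A W in auto)
  also have "\<dots> = (\<Prod>a<m. qnum (Suc (snd (v ! a))) * inverse (qnum (snd (v ! a))))"
    unfolding prod_list_diag_prod using A by (simp add: atLeast0LessThan diag)
  also have "\<dots> = (\<Prod>u\<in>set v. qnum (Suc (snd u)) * inverse (qnum (snd u)))"
    unfolding m_def v_def by (rule prod.reindex_bij_betw[OF bij_betw_nth[OF distinct_arms refl refl]])
  also have "\<dots> = (\<Prod>i<length \<alpha>s. \<Prod>j\<in>{1..<\<alpha>s ! i}. qnum (Suc j) * inverse (qnum j))"
    unfolding v_def set_arms by (subst prod.Sigma) (auto intro!: prod.cong)
  also have "\<dots> = (\<Prod>i<length \<alpha>s. qnum (\<alpha>s ! i))"
  proof (intro prod.cong refl)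
    fix i assume "i \<in> {..<length \<alpha>s}"
    then have "\<alpha>s ! i \<ge> 1" using assms by auto
    have tele: "(\<Prod>j\<in>{1..<Suc n}. qnum (Suc j) * inverse (qnum j)) = qnum (Suc n)" for n
    proof (induction n)
      case (Suc n)
      have "(\<Prod>j\<in>{1..<Suc (Suc n)}. qnum (Suc j) * inverse (qnum j)) =
          qnum (Suc n) * (qnum (Suc (Suc n)) * inverse (qnum (Suc n)))"
        using Suc by simp
      also have "\<dots> = qnum (Suc (Suc n)) * (qnum (Suc n) * inverse (qnum (Suc n)))"
        by (simp only: ac_simps)
      finally show ?case using qnum_unit[of "Suc n"] by simp
    qed simp
    show "(\<Prod>j\<in>{1..<\<alpha>s ! i}. qnum (Suc j) * inverse (qnum j)) = qnum (\<alpha>s ! i)"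
      using tele[of "\<alpha>s ! i - 1"] \<open>\<alpha>s ! i \<ge> 1\<close> by simp
  qed
  finally show ?thesis .
qed

text \<open>Each arm, once eliminated, subtracts \<open>t q (\<alpha> - 1) / q \<alpha>\<close>, which is \<open>t\<close> times the lower right corner of
  the inverse of its block.\<close>

definition arm_sum :: "nat list \<Rightarrow> rat fps" where
  "arm_sum \<alpha>s = fps_X * (\<Sum>i<length \<alpha>s. qnum (\<alpha>s ! i - 1) * inverse (qnum (\<alpha>s ! i)))"

text \<open>A Schur complement. The columns of \<open>X\<close> solve \<open>A X = - C\<close>; they are explicit, because on each arm
  the solution vanishes just before the tip and is determined by its value at the vertex next to the
  centre. Multiplication by the unitriangular matrix with block \<open>X\<close> clears the block \<open>C\<close>.\<close>

lemma det_ext_pencil: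
  assumes "\<And>\<alpha>. \<alpha> \<in> set \<alpha>s \<Longrightarrow> \<alpha> \<ge> 2"
  shows "fps_of_int_poly (Determinant.det (ext_pencil \<alpha>s s)) = (\<Prod>i<length \<alpha>s. qnum (\<alpha>s ! i)) *
    Determinant.det (Matrix.mat s s (\<lambda>(c, d).
      centre_matrix \<alpha>s s $$ (c, d) - (if c < 2 \<and> d < 2 then arm_sum \<alpha>s else 0)))"
proof -
  define v where "v = arms \<alpha>s"
  define m where "m = length v"
  define x where "x = (\<lambda>(i, j). fps_X ^ (\<alpha>s ! i - j) * qnum j * inverse (qnum (\<alpha>s ! i)))"
  define X where "X = Matrix.mat m s (\<lambda>(a, c). if c < 2 then x (v ! a) else 0)"
  let ?A = "arm_matrix \<alpha>s" and ?C = "arm_to_centre \<alpha>s s" and ?R = "centre_to_arm \<alpha>s s"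
  let ?D = "centre_matrix \<alpha>s s"
  interpret comm_ring_hom fps_of_int_poly by (rule fps_of_int_poly_hom)
  have A: "?A \<in> carrier_mat m m" and C: "?C \<in> carrier_mat m s" and R: "?R \<in> carrier_mat s m"
    and D: "?D \<in> carrier_mat s s" and X: "X \<in> carrier_mat m s"
    by (simp_all add: arm_matrix_def Let_def v_def m_def X_def arm_to_centre_def centre_to_arm_def
        centre_matrix_def)
  have AX: "?A * X + ?C = 0\<^sub>m m s"
  proof (rule eq_matI)
    fix a c assume "a < dim_row (0\<^sub>m m s :: rat fps Matrix.mat)" "c < dim_col (0\<^sub>m m s :: rat fps Matrix.mat)"
    then have a: "a < m" and c: "c < s" by auto
    obtain i j where ij: "v ! a = (i, j)" by (metis surj_pair)
    have "(i, j) \<in> set (arms \<alpha>s)" using a ij by (metis m_def v_def nth_mem)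
    note row = arm_row_sum[OF this] and this
    then have j: "i < length \<alpha>s" "1 \<le> j" "j < \<alpha>s ! i" by (auto simp: set_arms)
    have "(?A * X) $$ (a, c) = (\<Sum>b<m. arm_entry (v ! a) (v ! b) * (if c < 2 then x (v ! b) else 0))"
      using a c A by (simp add: scalar_prod_def atLeast0LessThan X_def)
         (simp add: arm_matrix_def Let_def v_def m_def)
    also have "\<dots> = (\<Sum>u\<in>set (arms \<alpha>s). arm_entry (i, j) u * (if c < 2 then x u else 0))"
      unfolding ij unfolding m_def v_def by (rule sum_arms)
    also have "\<dots> = (if c < 2 \<and> j = \<alpha>s ! i - 1 then fps_X else 0)"
    proof (cases "c < 2")
      case True
      obtain k where k: "j = Suc k" using j(2) by (cases j) auto
      let ?q = "inverse (qnum (\<alpha>s ! i))"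
      obtain d where d: "\<alpha>s ! i = Suc (j + d)" using j(3) less_iff_Suc_add by blast
      have m1: "(if 1 < j then x (i, j - 1) else 0) = fps_X ^ (d + 2) * qnum k * ?q"
        using d k by (cases k) (auto simp: x_def Suc_diff_le)
      have m2: "x (i, j) = fps_X ^ (d + 1) * qnum (Suc k) * ?q"
        using d k by (auto simp: x_def Suc_diff_le)
      have m3: "(if Suc j < \<alpha>s ! i then fps_X * x (i, Suc j) else 0) =
          (if d = 0 then 0 else fps_X ^ (d + 1) * qnum (Suc (Suc k)) * ?q)"
        using d k by (auto simp: x_def)
      have "(\<Sum>u\<in>set (arms \<alpha>s). arm_entry (i, j) u * (if c < 2 then x u else 0)) =
          (1 + fps_X) * (fps_X ^ (d + 1) * qnum (Suc k) * ?q) - fps_X ^ (d + 2) * qnum k * ?q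
          - (if d = 0 then 0 else fps_X ^ (d + 1) * qnum (Suc (Suc k)) * ?q)"
        unfolding row using True by (simp only: m1 m2 m3 if_True)
      also have "\<dots> = (if d = 0 then fps_X else 0)"
      proof (cases "d = 0")
        case True
        have "(1 + fps_X) * (fps_X ^ (d + 1) * qnum (Suc k) * ?q) - fps_X ^ (d + 2) * qnum k * ?q =
            fps_X * (qnum (Suc (Suc k)) * ?q)"
          unfolding qnum_Suc_Suc True by (simp add: algebra_simps power2_eq_square)
        also have "\<dots> = fps_X" using d k True qnum_unit[of "\<alpha>s ! i"] by simp
        finally show ?thesis using True by simp
      next
        case False
        then show ?thesis unfolding qnum_Suc_Suc by (simp add: algebra_simps)
      qed
      finally show ?thesis using True d by auto
    qed simp
    finally show "(?A * X + ?C) $$ (a, c) = 0\<^sub>m m s $$ (a, c)"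
      using a c A X ij unfolding arm_to_centre_def v_def m_def by simp
  qed (use A X C in auto)
  have RX: "?D + ?R * X = Matrix.mat s s (\<lambda>(c, d).
      ?D $$ (c, d) - (if c < 2 \<and> d < 2 then arm_sum \<alpha>s else 0))" (is "_ = ?S")
  proof (rule eq_matI)
    fix c d assume "c < dim_row ?S" "d < dim_col ?S"
    then have c: "c < s" and d: "d < s" by auto
    have "(?R * X) $$ (c, d) = (\<Sum>a<m. - of_int (ext_form \<alpha>s (Inr c) (Inl (v ! a))) * (if d < 2 then x (v ! a) else 0))"
      using c d R by (simp add: scalar_prod_def atLeast0LessThan X_def)
         (simp add: centre_to_arm_def v_def m_def)
    also have "\<dots> = (\<Sum>u\<in>set (arms \<alpha>s). - of_int (ext_form \<alpha>s (Inr c) (Inl u)) * (if d < 2 then x u else 0))"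
      unfolding m_def v_def by (rule sum_arms)
    also have "\<dots> = (\<Sum>i<length \<alpha>s. \<Sum>j\<in>{1..<\<alpha>s ! i}.
        if j = \<alpha>s ! i - 1 then (if c < 2 \<and> d < 2 then - x (i, j) else 0) else 0)"
      unfolding set_arms by (subst sum.Sigma) (auto intro!: sum.cong)
    also have "\<dots> = (\<Sum>i<length \<alpha>s. if c < 2 \<and> d < 2 then - x (i, \<alpha>s ! i - 1) else 0)"
    proof (intro sum.cong refl)
      fix i assume "i \<in> {..<length \<alpha>s}"
      then have "\<alpha>s ! i \<ge> 2" using assms by auto
      then show "(\<Sum>j\<in>{1..<\<alpha>s ! i}. if j = \<alpha>s ! i - 1 then (if c < 2 \<and> d < 2 then - x (i, j) else 0) else 0)
          = (if c < 2 \<and> d < 2 then - x (i, \<alpha>s ! i - 1) else 0)" by auto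
    qed
    also have "\<dots> = - (if c < 2 \<and> d < 2 then arm_sum \<alpha>s else 0)"
    proof -
      have "x (i, \<alpha>s ! i - 1) = fps_X * (qnum (\<alpha>s ! i - 1) * inverse (qnum (\<alpha>s ! i)))"
        if "i \<in> {..<length \<alpha>s}" for i
      proof -
        have "\<alpha>s ! i \<ge> 2" using assms that by auto
        then have "\<alpha>s ! i - (\<alpha>s ! i - 1) = 1" by simp
        then show ?thesis by (simp add: x_def mult.assoc)
      qed
      then show ?thesis unfolding arm_sum_def
        by (cases "c < 2"; cases "d < 2") (simp_all add: sum_negf sum_distrib_left)
    qed
    finally show "(?D + ?R * X) $$ (c, d) = ?S $$ (c, d)" using c d D R X by simp
  qed (use D R X in auto)
  have "map_mat fps_of_int_poly (ext_pencil \<alpha>s s) * four_block_mat (1\<^sub>m m) X (0\<^sub>m s m) (1\<^sub>m s) =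
      four_block_mat (?A * 1\<^sub>m m + ?C * 0\<^sub>m s m) (?A * X + ?C * 1\<^sub>m s)
        (?R * 1\<^sub>m m + ?D * 0\<^sub>m s m) (?R * X + ?D * 1\<^sub>m s)"
    unfolding ext_pencil_blocks by (rule mult_four_block_mat[OF A C R D _ X]) auto
  also have "\<dots> = four_block_mat ?A (0\<^sub>m m s) ?R (?D + ?R * X)"
  proof -
    have "?A * 1\<^sub>m m + ?C * 0\<^sub>m s m = ?A" "?R * 1\<^sub>m m + ?D * 0\<^sub>m s m = ?R" "?C * 1\<^sub>m s = ?C" "?D * 1\<^sub>m s = ?D"
      using A C R D by auto
    moreover have "?R * X + ?D = ?D + ?R * X" using R X D by (intro comm_add_mat) auto
    ultimately show ?thesis using AX by simp
  qed
  finally have eq: "map_mat fps_of_int_poly (ext_pencil \<alpha>s s) * four_block_mat (1\<^sub>m m) X (0\<^sub>m s m) (1\<^sub>m s) =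
      four_block_mat ?A (0\<^sub>m m s) ?R (?D + ?R * X)" .
  have N: "map_mat fps_of_int_poly (ext_pencil \<alpha>s s) \<in> carrier_mat (m + s) (m + s)"
    by (simp add: ext_pencil_def coxeter_pencil_def m_def v_def)
  have "Determinant.det (four_block_mat (1\<^sub>m m) X (0\<^sub>m s m) (1\<^sub>m s)) = 1"
    using X by (subst det_four_block_mat_lower_left_zero[of _ m _ s]) auto
  then have "Determinant.det (map_mat fps_of_int_poly (ext_pencil \<alpha>s s)) =
      Determinant.det (map_mat fps_of_int_poly (ext_pencil \<alpha>s s)) *
      Determinant.det (four_block_mat (1\<^sub>m m) X (0\<^sub>m s m) (1\<^sub>m s))" by simp
  also have "\<dots> = Determinant.det (four_block_mat ?A (0\<^sub>m m s) ?R (?D + ?R * X))"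
    unfolding eq[symmetric] using X by (intro det_mult[OF N, symmetric]) auto
  also have "\<dots> = Determinant.det ?A * Determinant.det (?D + ?R * X)"
    using D R X by (intro det_four_block_mat_upper_right_zero[OF A refl R]) auto
  also have "Determinant.det ?A = (\<Prod>i<length \<alpha>s. qnum (\<alpha>s ! i))"
    using assms by (intro det_arm_matrix) (meson le_trans one_le_numeral)
  finally show ?thesis unfolding RX by simp
qed

lemma det_dim_2:
  assumes "M \<in> carrier_mat 2 2"
  shows "Determinant.det (M :: 'a::comm_ring_1 Matrix.mat) = M $$ (0,0) * M $$ (1,1) - M $$ (0,1) * M $$ (1,0)"
proof -
  have "Determinant.det M = (\<Sum>j<2. M $$ (0, j) * cofactor M 0 j)"
    by (rule laplace_expansion_row[OF assms]) simp
  also have "\<dots> = M $$ (0,0) * cofactor M 0 0 + M $$ (0,1) * cofactor M 0 1"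
    by (simp add: numeral_2_eq_2)
  also have "cofactor M 0 0 = M $$ (1,1)"
    using assms by (simp add: cofactor_def mat_delete_def det_single)
  also have "cofactor M 0 1 = - M $$ (1,0)"
    using assms by (simp add: cofactor_def mat_delete_def det_single)
  finally show ?thesis by simp
qed

lemma det_dim_3_last_row:
  assumes "M \<in> carrier_mat 3 3" "M $$ (2,0) = 0"
  shows "Determinant.det (M :: 'a::comm_ring_1 Matrix.mat) =
    M $$ (2,2) * (M $$ (0,0) * M $$ (1,1) - M $$ (0,1) * M $$ (1,0))
    - M $$ (2,1) * (M $$ (0,0) * M $$ (1,2) - M $$ (0,2) * M $$ (1,0))"
proof -
  have "Determinant.det M = (\<Sum>j<3. M $$ (2, j) * cofactor M 2 j)"
    by (rule laplace_expansion_row[OF assms(1)]) simp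
  also have "\<dots> = M $$ (2,1) * cofactor M 2 1 + M $$ (2,2) * cofactor M 2 2"
    using assms(2) by (simp add: eval_nat_numeral)
  also have "cofactor M 2 2 = M $$ (0,0) * M $$ (1,1) - M $$ (0,1) * M $$ (1,0)"
    using assms(1) by (simp add: cofactor_def mat_delete_def det_dim_2 numeral_2_eq_2)
  also have "cofactor M 2 1 = - (M $$ (0,0) * M $$ (1,2) - M $$ (0,2) * M $$ (1,0))"
    using assms(1) by (simp add: cofactor_def mat_delete_def det_dim_2 numeral_2_eq_2)
  finally show ?thesis by (simp add: algebra_simps)
qed

theorem Delta_formulas:
  assumes "\<And>\<alpha>. \<alpha> \<in> set \<alpha>s \<Longrightarrow> \<alpha> \<ge> 2"
  defines "p \<equiv> (\<Prod>i<length \<alpha>s. qnum (\<alpha>s ! i))"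
  shows "fps_of_int_poly (Delta_minus \<alpha>s) = p * (1 + fps_X - arm_sum \<alpha>s)"
    and "fps_of_int_poly (Delta_zero \<alpha>s) = p * (1 - fps_X) ^ 2"
    and "fps_of_int_poly (Delta_plus \<alpha>s) =
      p * ((1 + fps_X) * (1 - fps_X) ^ 2 - fps_X * (1 + fps_X - arm_sum \<alpha>s))"
proof -
  let ?S = "\<lambda>s. Matrix.mat s s (\<lambda>(c, d). centre_matrix \<alpha>s s $$ (c, d) - (if c < 2 \<and> d < 2 then arm_sum \<alpha>s else 0))"
  have 1: "Determinant.det (?S 1) = 1 + fps_X - arm_sum \<alpha>s"
    by (subst det_single) (simp_all add: centre_matrix_def)
  have 2: "Determinant.det (?S 2) = (1 - fps_X) ^ 2"
    by (subst det_dim_2) (simp_all add: centre_matrix_def algebra_simps power2_eq_square)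
  have 3: "Determinant.det (?S 3) = (1 + fps_X) * (1 - fps_X) ^ 2 - fps_X * (1 + fps_X - arm_sum \<alpha>s)"
    by (subst det_dim_3_last_row) (simp_all add: centre_matrix_def algebra_simps power2_eq_square)
  have D: "fps_of_int_poly (Determinant.det (ext_pencil \<alpha>s s)) = p * Determinant.det (?S s)" for s
    unfolding p_def by (intro det_ext_pencil assms(1))
  show "fps_of_int_poly (Delta_minus \<alpha>s) = p * (1 + fps_X - arm_sum \<alpha>s)"
    unfolding Delta_minus_eq D 1 ..
  show "fps_of_int_poly (Delta_zero \<alpha>s) = p * (1 - fps_X) ^ 2"
    unfolding Delta_zero_eq D 2 ..
  show "fps_of_int_poly (Delta_plus \<alpha>s) =
      p * ((1 + fps_X) * (1 - fps_X) ^ 2 - fps_X * (1 + fps_X - arm_sum \<alpha>s))"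
    unfolding Delta_plus_eq D 3 ..
qed

section \<open>Divisors on the projective line and dimensions\<close>

text \<open>The bound is an integer, since degrees of divisors can be negative; the space is then zero.\<close>

definition polys_le :: "int \<Rightarrow> complex poly set" where
  "polys_le d = {P. P = 0 \<or> int (degree P) \<le> d}"

definition linear_iso_polys :: "(complex \<Rightarrow> 'v::ab_group_add \<Rightarrow> 'v) \<Rightarrow> int \<Rightarrow> 'v set \<Rightarrow> bool" where
  "linear_iso_polys scl d V \<longleftrightarrow> (\<exists>T. bij_betw T (polys_le d) V \<and>
     (\<forall>P\<in>polys_le d. \<forall>R\<in>polys_le d. T (P + R) = T P + T R) \<and>
     (\<forall>c. \<forall>P\<in>polys_le d. T (Polynomial.smult c P) = scl c (T P)))"

definition poly_order :: "P1 \<Rightarrow> complex poly \<Rightarrow> int" where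
  "poly_order p P = (case p of Some a \<Rightarrow> int (order a P) | None \<Rightarrow> - int (degree P))"

lemma poly_order_mult:
  "P \<noteq> 0 \<Longrightarrow> Q \<noteq> 0 \<Longrightarrow> poly_order p (P * Q) = poly_order p P + poly_order p Q"
  by (simp add: poly_order_def order_mult degree_mult_eq split: option.split)

lemma poly_order_one [simp]: "poly_order p 1 = 0"
  by (simp add: poly_order_def split: option.split)

lemma poly_order_linear_power:
  "poly_order (Some b) ([:- a, 1:] ^ n) = (if b = a then int n else 0)"
  "poly_order None ([:- a, 1:] ^ n) = - int n"
proof -
  have "order b ([:- a, 1:] ^ n) = 0" if "b \<noteq> a"
    using that by (intro order_0I) (simp add: poly_power)
  then show "poly_order (Some b) ([:- a, 1:] ^ n) = (if b = a then int n else 0)"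
    by (simp add: poly_order_def order_power_n_n)
  show "poly_order None ([:- a, 1:] ^ n) = - int n"
    by (simp add: poly_order_def degree_linear_power)
qed

lemma poly_order_prod:
  assumes "\<And>i. i \<in> I \<Longrightarrow> P i \<noteq> 0"
  shows "poly_order p (\<Prod>i\<in>I. P i) = (\<Sum>i\<in>I. poly_order p (P i))"
  using assms
  by (induction I rule: infinite_finite_induct) (simp_all add: poly_order_mult prod_zero_iff)

lemma ratfun_order_Fract:
  assumes "P \<noteq> 0" "Q \<noteq> 0"
  shows "ratfun_order p (Fract P Q) = poly_order p P - poly_order p Q"
proof -
  obtain C E where CE: "quot_of_fract (Fract P Q) = (C, E)" by (metis surj_pair)
  have E: "E \<noteq> 0" using snd_quot_of_fract_nonzero[of "Fract P Q"] CE by simp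
  have "Fract C E = Fract P Q" using quot_to_fract_quot_of_fract[of "Fract P Q"] CE
    by (simp add: quot_to_fract_def)
  then have eq: "C * Q = P * E" using E assms by (simp add: eq_fract)
  then have C: "C \<noteq> 0" using E assms by auto
  have "poly_order p C + poly_order p Q = poly_order p P + poly_order p E"
    using poly_order_mult[OF C assms(2)] poly_order_mult[OF assms(1) E] eq by metis
  moreover have "ratfun_order p (Fract P Q) = poly_order p C - poly_order p E"
    unfolding ratfun_order_def CE by (simp add: poly_order_def split: option.split)
  ultimately show ?thesis by simp
qed

text \<open>In lowest terms, a root of the denominator would be a pole, because it is not a root of the numerator. So the
  denominator has no roots and is constant.\<close>

lemma regular_ratfun_is_poly:
  assumes "\<And>a. ratfun_order (Some a) F \<ge> 0" "F \<noteq> 0"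
  shows "\<exists>P. F = to_fract P"
proof -
  obtain C E where CE: "quot_of_fract F = (C, E)" by (metis surj_pair)
  have E: "E \<noteq> 0" using snd_quot_of_fract_nonzero[of F] CE by simp
  have cop: "coprime C E" using coprime_quot_of_fract[of F] CE by simp
  have F: "F = Fract C E" using quot_to_fract_quot_of_fract[of F] CE
    by (simp add: quot_to_fract_def)
  then have C: "C \<noteq> 0" using assms(2) by (auto simp: fract_collapse)
  have "poly E a \<noteq> 0" for a
  proof
    assume "poly E a = 0"
    then have "order a E \<ge> 1" using E order_root[of E a] by simp
    moreover have "order a C \<ge> order a E"
      using assms(1)[of a] unfolding F ratfun_order_Fract[OF C E] by (simp add: poly_order_def)
    ultimately have "poly C a = 0" using C order_root[of C a] by simp
    then have "[:- a, 1:] dvd C" "[:- a, 1:] dvd E"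
      using \<open>poly E a = 0\<close> by (simp_all add: poly_eq_0_iff_dvd)
    then have "is_unit [:- a, 1:]" using cop coprime_common_divisor by blast
    then show False by (simp add: is_unit_poly_iff)
  qed
  then have "constant (poly E)" using fundamental_theorem_of_algebra by blast
  then have "degree E = 0" by (simp add: constant_degree)
  then obtain c where c: "E = [:c:]" using degree_eq_zeroE by blast
  then have c0: "c \<noteq> 0" using E by simp
  have "F = Fract (C * [:inverse c:]) 1"
    unfolding F using E c c0 by (simp add: eq_fract)
  then show ?thesis by (metis to_fract_def)
qed

lemma sum_over_P1:
  fixes n :: "P1 \<Rightarrow> int"
  assumes fin: "finite {p. R p}" and "\<And>p. \<not> R p \<Longrightarrow> n p = 0"
  shows "(\<Sum>p | R p. n p) = (\<Sum>a | R (Some a). n (Some a)) + n None"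
    and "finite {a. R (Some a)}"
proof -
  let ?S = "{a. R (Some a)}"
  have eq: "{p. R p} - {None} = Some ` ?S"
    by (auto simp: image_iff) (metis option.exhaust)
  have "finite (Some ` ?S)" unfolding eq[symmetric] using fin by simp
  then show "finite ?S" by (simp add: finite_image_iff)
  have "(\<Sum>p | R p. n p) = (\<Sum>p\<in>insert None {p. R p}. n p)"
    by (intro sum.mono_neutral_left) (use assms in auto)
  also have "\<dots> = n None + (\<Sum>p\<in>{p. R p} - {None}. n p)"
    using fin by (rule sum.insert_remove)
  also have "(\<Sum>p\<in>{p. R p} - {None}. n p) = (\<Sum>a\<in>?S. n (Some a))"
    unfolding eq by (subst sum.reindex) auto
  finally show "(\<Sum>p | R p. n p) = (\<Sum>a | R (Some a). n (Some a)) + n None" by simp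
qed

lemma divisor_degree_P1:
  assumes "is_divisor D"
  shows "divisor_degree D = (\<Sum>a | D (Some a) \<noteq> 0. D (Some a)) + D None"
    and "finite {a. D (Some a) \<noteq> 0}"
  using sum_over_P1[of "\<lambda>p. D p \<noteq> 0" D] assms
  unfolding divisor_degree_def is_divisor_def by auto

text \<open>The function \<open>N / M\<close> has divisor \<open>- D\<close> on the affine line, so a section divided by it is regular
  there, hence a polynomial. The order of \<open>N / M\<close> at infinity is the affine part of the degree of \<open>D\<close>,
  and this turns the condition at infinity into the bound on the degree of the polynomial.\<close>

lemma divisor_sections_param:
  assumes D: "is_divisor D"
  shows "linear_iso_polys ratfun_scale (divisor_degree D) (divisor_sections D)"
proof -
  let ?S = "{a. D (Some a) \<noteq> 0}"
  have S: "finite ?S" using divisor_degree_P1(2)[OF D] .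
  define N where "N = (\<Prod>a\<in>?S. [:- a, 1:] ^ nat (- D (Some a)))"
  define M where "M = (\<Prod>a\<in>?S. [:- a, 1:] ^ nat (D (Some a)))"
  have N0: "N \<noteq> 0" and M0: "M \<noteq> 0" unfolding N_def M_def using S by (simp_all add: prod_zero_iff)
  have diff: "poly_order p N - poly_order p M =
      (\<Sum>a\<in>?S. poly_order p ([:- a, 1:] ^ nat (- D (Some a))) - poly_order p ([:- a, 1:] ^ nat (D (Some a))))" for p
    unfolding N_def M_def by (subst (1 2) poly_order_prod) (simp_all add: sum_subtractf)
  have at_affine: "poly_order (Some b) N - poly_order (Some b) M = - D (Some b)" for b
  proof -
    have "poly_order (Some b) N - poly_order (Some b) M = (\<Sum>a\<in>?S. if a = b then - D (Some b) else 0)"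
      unfolding diff poly_order_linear_power by (intro sum.cong) auto
    also have "\<dots> = - D (Some b)" using S by simp
    finally show ?thesis .
  qed
  have at_infinity: "poly_order None N - poly_order None M = divisor_degree D - D None"
  proof -
    have "poly_order None N - poly_order None M = (\<Sum>a\<in>?S. D (Some a))"
      unfolding diff poly_order_linear_power by (intro sum.cong) auto
    then show ?thesis using divisor_degree_P1(1)[OF D] by simp
  qed
  define T where "T = (\<lambda>P. to_fract P * Fract N M)"
  have T: "T P = Fract (P * N) M" for P by (simp add: T_def to_fract_def)
  have T0: "T P = 0 \<longleftrightarrow> P = 0" for P
    unfolding T using N0 M0 by (simp add: Zero_fract_def eq_fract)
  have ord: "ratfun_order p (T P) = poly_order p P + (poly_order p N - poly_order p M)" if "P \<noteq> 0" for p P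
    unfolding T using that N0 M0 by (subst ratfun_order_Fract) (simp_all add: poly_order_mult)
  have mem: "T P \<in> divisor_sections D \<longleftrightarrow> P \<in> polys_le (divisor_degree D)" for P
  proof (cases "P = 0")
    case True
    then show ?thesis using T0 by (simp add: divisor_sections_def polys_le_def)
  next
    case False
    have "(\<forall>p. ratfun_order p (T P) + D p \<ge> 0) \<longleftrightarrow>
        ratfun_order None (T P) + D None \<ge> 0 \<and> (\<forall>a. ratfun_order (Some a) (T P) + D (Some a) \<ge> 0)"
      by (metis option.exhaust)
    also have "\<dots> \<longleftrightarrow> int (degree P) \<le> divisor_degree D"
      unfolding ord[OF False] at_affine at_infinity by (simp add: poly_order_def)
    finally show ?thesis using False T0 by (simp add: divisor_sections_def polys_le_def)
  qed
  show ?thesis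
    unfolding linear_iso_polys_def
  proof (intro exI[of _ T] conjI ballI allI)
    show "bij_betw T (polys_le (divisor_degree D)) (divisor_sections D)"
    proof (rule bij_betwI')
      fix P R
      have "Fract N M \<noteq> 0" using N0 M0 by (simp add: Zero_fract_def eq_fract)
      then show "T P = T R \<longleftrightarrow> P = R" by (simp add: T_def)
    next
      fix F assume F: "F \<in> divisor_sections D"
      show "\<exists>P\<in>polys_le (divisor_degree D). F = T P"
      proof (cases "F = 0")
        case True
        then show ?thesis using T0[of 0] mem[of 0] F by metis
      next
        case False
        then obtain A B where AB: "F = Fract A B" "B \<noteq> 0" "A \<noteq> 0"
          by (cases F rule: Fract_cases_nonzero) auto
        have "ratfun_order (Some a) (Fract (A * M) (B * N)) \<ge> 0" for a
        proof -
          have "ratfun_order (Some a) F + D (Some a) \<ge> 0" using F False by (simp add: divisor_sections_def)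
          then show ?thesis using at_affine[of a] AB N0 M0
            by (simp add: ratfun_order_Fract poly_order_mult)
        qed
        moreover have "Fract (A * M) (B * N) \<noteq> 0"
          using AB N0 M0 by (simp add: Zero_fract_def eq_fract)
        ultimately obtain P where P: "Fract (A * M) (B * N) = to_fract P"
          using regular_ratfun_is_poly by blast
        have "F = T P"
          unfolding T_def P[symmetric] AB(1) using AB(2,3) N0 M0 by (simp add: eq_fract)
        then show ?thesis using F mem by auto
      qed
    qed (use mem in auto)
  next
    fix P R
    show "T (P + R) = T P + T R" by (simp add: T_def distrib_right)
  next
    fix c :: complex and P :: "complex poly"
    have "Polynomial.smult c P = [:c:] * P" by simp
    then show "T (Polynomial.smult c P) = ratfun_scale c (T P)"
      unfolding T_def ratfun_scale_def by (simp only: to_fract_mult mult.assoc)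
  qed
qed

lemma dim_of_poly_param:
  fixes scl :: "complex \<Rightarrow> 'v::ab_group_add \<Rightarrow> 'v"
  assumes vs: "vector_space scl"
    and iso: "linear_iso_polys scl d V"
  shows "finite_dim scl V" "vector_space.dim scl V = nat (d + 1)"
proof -
  interpret vector_space scl by (rule vs)
  obtain T where bij: "bij_betw T (polys_le d) V"
    and add: "\<And>P R. P \<in> polys_le d \<Longrightarrow> R \<in> polys_le d \<Longrightarrow> T (P + R) = T P + T R"
    and scale: "\<And>c P. P \<in> polys_le d \<Longrightarrow> T (Polynomial.smult c P) = scl c (T P)"
    using iso unfolding linear_iso_polys_def by blast
  define n where "n = nat (d + 1)"
  have mem: "P \<in> polys_le d \<longleftrightarrow> (\<forall>i\<ge>n. coeff P i = 0)" for P
  proof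
    assume "P \<in> polys_le d"
    then show "\<forall>i\<ge>n. coeff P i = 0"
      unfolding polys_le_def n_def by (cases "P = 0") (auto intro!: coeff_eq_0)
  next
    assume z: "\<forall>i\<ge>n. coeff P i = 0"
    show "P \<in> polys_le d"
    proof (cases "P = 0")
      case False
      then have "degree P < n" using z by (metis leading_coeff_0_iff not_less)
      then show ?thesis unfolding polys_le_def n_def by auto
    qed (simp add: polys_le_def)
  qed
  define v where "v = (\<lambda>i. T (monom 1 i))"
  have mon: "monom c i \<in> polys_le d" if "i < n" for c i
    using that unfolding mem by simp
  have sum_mem: "(\<Sum>i\<in>I. monom (c i) i) \<in> polys_le d" if "I \<subseteq> {..<n}" for I c
    using that unfolding mem by (auto simp: coeff_sum intro!: sum.neutral)
  have T_zero: "T 0 = 0" using add[of 0 0] by (simp add: mem)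
  have T_sum: "T (\<Sum>i\<in>I. monom (c i) i) = (\<Sum>i\<in>I. scl (c i) (v i))" if "I \<subseteq> {..<n}" "finite I" for I c
    using that(2,1)
  proof (induction I)
    case (insert i I)
    have "monom (c i) i = Polynomial.smult (c i) (monom 1 i)" by (simp add: smult_monom)
    then have "T (monom (c i) i) = scl (c i) (v i)"
      using scale[OF mon[of i 1]] insert.prems unfolding v_def by simp
    then show ?case using insert add[OF mon sum_mem] by simp
  qed (simp add: T_zero)
  have inj: "inj_on v {..<n}"
  proof
    fix i j assume ij: "i \<in> {..<n}" "j \<in> {..<n}" "v i = v j"
    then have "monom (1::complex) i = monom 1 j"
      using bij mon unfolding bij_betw_def inj_on_def v_def by blast
    then show "i = j" by (simp add: monom_eq_iff')
  qed
  define B where "B = v ` {..<n}"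
  have finB: "finite B" and cardB: "card B = n"
    unfolding B_def using card_image[OF inj] by auto
  have V: "x \<in> V \<longleftrightarrow> (\<exists>c. x = (\<Sum>i<n. scl (c i) (v i)))" for x
  proof
    assume "x \<in> V"
    then obtain P where P: "P \<in> polys_le d" "x = T P" using bij unfolding bij_betw_def by blast
    have "P = (\<Sum>i<n. monom (coeff P i) i)"
      using P(1) unfolding mem by (intro poly_eqI) (auto simp: coeff_sum)
    then have "T P = T (\<Sum>i<n. monom (coeff P i) i)" by (rule arg_cong)
    then have "x = (\<Sum>i<n. scl (coeff P i) (v i))" using T_sum[of "{..<n}" "coeff P"] P(2) by simp
    then show "\<exists>c. x = (\<Sum>i<n. scl (c i) (v i))" by blast
  next
    assume "\<exists>c. x = (\<Sum>i<n. scl (c i) (v i))"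
    then obtain c where "x = T (\<Sum>i<n. monom (c i) i)" using T_sum[of "{..<n}"] by auto
    then show "x \<in> V" using sum_mem[of "{..<n}" c] bij unfolding bij_betw_def by auto
  qed
  have span: "span B = V"
  proof
    show "span B \<subseteq> V"
    proof
      fix x assume "x \<in> span B"
      then obtain u where "x = (\<Sum>b\<in>B. scl (u b) b)" using span_finite[OF finB] by auto
      then have "x = (\<Sum>i<n. scl (u (v i)) (v i))" unfolding B_def by (simp add: sum.reindex[OF inj])
      then show "x \<in> V" unfolding V by (rule exI[of _ "\<lambda>i. u (v i)"])
    qed
    show "V \<subseteq> span B"
    proof
      fix x assume "x \<in> V"
      from this[unfolded V] obtain c where "x = (\<Sum>i<n. scl (c i) (v i))" by (rule exE)
      then show "x \<in> span B" unfolding B_def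
        by (simp only:) (rule span_sum, rule span_scale, rule span_base, rule imageI)
    qed
  qed
  have "independent B"
  proof (rule independent_if_scalars_zero[OF finB])
    fix f x assume f: "(\<Sum>x\<in>B. scl (f x) x) = 0" and x: "x \<in> B"
    then obtain i where i: "i < n" "x = v i" unfolding B_def by blast
    have "T (\<Sum>i<n. monom (f (v i)) i) = T 0"
      using f unfolding B_def by (simp add: sum.reindex[OF inj] T_sum T_zero)
    then have "(\<Sum>i<n. monom (f (v i)) i) = 0"
      by (rule inj_onD[OF bij_betw_imp_inj_on[OF bij]]) (simp_all add: sum_mem, simp add: mem)
    then have "coeff (\<Sum>i<n. monom (f (v i)) i) i = 0" by simp
    then show "f x = 0" using i by (simp add: coeff_sum)
  qed
  then have "dim V = card B" using span by (metis dim_eq_card span_span)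
  then show "dim V = nat (d + 1)" using cardB n_def by simp
  show "finite_dim scl V" unfolding finite_dim_def using finB span by blast
qed

text \<open>The common endpoint of both cases: a parametrisation of the model \<open>F k\<close> is carried back to \<open>A k\<close>
  along the isomorphism.\<close>

lemma graded_iso_piece_dim:
  fixes scl :: "complex \<Rightarrow> 'a::comm_ring_1 \<Rightarrow> 'a" and scl' :: "complex \<Rightarrow> 'b::comm_ring_1 \<Rightarrow> 'b"
  assumes A: "graded_algebra scl A" and iso: "graded_algebra_iso scl A scl' F"
    and F: "linear_iso_polys scl' d (F k)"
  shows "finite_dim scl (A k)" "vector_space.dim scl (A k) = nat (d + 1)"
proof -
  interpret graded_algebra scl A by (rule A)
  obtain T where bij: "bij_betw T (polys_le d) (F k)"
    and add: "\<And>P R. P \<in> polys_le d \<Longrightarrow> R \<in> polys_le d \<Longrightarrow> T (P + R) = T P + T R"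
    and scale: "\<And>c P. P \<in> polys_le d \<Longrightarrow> T (Polynomial.smult c P) = scl' c (T P)"
    using F unfolding linear_iso_polys_def by blast
  obtain \<phi> where \<phi>: "bij_betw \<phi> (A k) (F k)"
    "\<And>x y. x \<in> A k \<Longrightarrow> y \<in> A k \<Longrightarrow> \<phi> (x + y) = \<phi> x + \<phi> y"
    "\<And>c x. x \<in> A k \<Longrightarrow> \<phi> (scl c x) = scl' c (\<phi> x)"
    using iso unfolding graded_algebra_iso_def by metis
  define U where "U = inv_into (A k) \<phi> \<circ> T"
  have bijU: "bij_betw U (polys_le d) (A k)"
    unfolding U_def using bij bij_betw_inv_into[OF \<phi>(1)] by (rule bij_betw_trans)
  have UA: "U P \<in> A k" if "P \<in> polys_le d" for P using bijU that bij_betwE by blast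
  have \<phi>U: "\<phi> (U P) = T P" if "P \<in> polys_le d" for P
    using bij_betw_inv_into_right[OF \<phi>(1)] bij that unfolding U_def bij_betw_def by auto
  have eqI: "x = y" if "x \<in> A k" "y \<in> A k" "\<phi> x = \<phi> y" for x y
    using \<phi>(1) that unfolding bij_betw_def inj_on_def by blast
  have addU: "U (P + R) = U P + U R" if "P \<in> polys_le d" "R \<in> polys_le d" for P R
  proof (rule eqI)
    have PR: "P + R \<in> polys_le d"
      using that degree_add_le_max[of P R] unfolding polys_le_def by auto
    show "U (P + R) \<in> A k" by (rule UA[OF PR])
    show "U P + U R \<in> A k" using UA that subspace_add[OF subspace_piece] by blast
    show "\<phi> (U (P + R)) = \<phi> (U P + U R)" using that PR \<phi>U \<phi>(2) UA add by simp
  qed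
  have scaleU: "U (Polynomial.smult c P) = scl c (U P)" if "P \<in> polys_le d" for c P
  proof (rule eqI)
    have cP: "Polynomial.smult c P \<in> polys_le d" using that unfolding polys_le_def by auto
    show "U (Polynomial.smult c P) \<in> A k" by (rule UA[OF cP])
    show "scl c (U P) \<in> A k" using UA that subspace_scale[OF subspace_piece] by blast
    show "\<phi> (U (Polynomial.smult c P)) = \<phi> (scl c (U P))" using that cP \<phi>U \<phi>(3) UA scale by simp
  qed
  have "linear_iso_polys scl d (A k)"
    unfolding linear_iso_polys_def
    using bijU addU scaleU by (intro exI[of _ U] conjI ballI allI)
  then show "finite_dim scl (A k)" "dim (A k) = nat (d + 1)"
    using dim_of_poly_param[OF vector_space_axioms] by auto
qed

section \<open>Orders of functions at a point\<close>

text \<open>Only the behaviour on a punctured neighbourhood counts, so values at poles and at removable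
  singularities do not matter. The weaker \<open>order_ge\<close> admits the zero function and is stable under
  addition.\<close>

definition has_order :: "(complex \<Rightarrow> complex) \<Rightarrow> complex \<Rightarrow> int \<Rightarrow> bool" where
  "has_order F z m \<longleftrightarrow> (\<exists>g. g analytic_on {z} \<and> g z \<noteq> 0 \<and>
     (\<forall>\<^sub>F w in at z. F w = g w * (w - z) powi m))"

definition order_ge :: "(complex \<Rightarrow> complex) \<Rightarrow> complex \<Rightarrow> int \<Rightarrow> bool" where
  "order_ge F z m \<longleftrightarrow> (\<exists>g. g analytic_on {z} \<and> (\<forall>\<^sub>F w in at z. F w = g w * (w - z) powi m))"

lemma has_order_ge: "has_order F z m \<Longrightarrow> order_ge F z m"
  unfolding has_order_def order_ge_def by blast

lemma order_ge_analytic: "F analytic_on {z} \<Longrightarrow> order_ge F z 0"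
  unfolding order_ge_def by (rule exI[of _ F]) auto

lemma has_order_analytic: "F analytic_on {z} \<Longrightarrow> F z \<noteq> 0 \<Longrightarrow> has_order F z 0"
  unfolding has_order_def by (rule exI[of _ F]) auto

lemma power_int_nat_add: "(x::complex) \<noteq> 0 \<Longrightarrow> x powi (int k + n) = x ^ k * x powi n"
  by (simp add: power_int_add)

lemma order_ge_mono:
  assumes "order_ge F z m" "n \<le> m"
  shows "order_ge F z n"
proof -
  obtain g where g: "g analytic_on {z}" "\<forall>\<^sub>F w in at z. F w = g w * (w - z) powi m"
    using assms(1) unfolding order_ge_def by blast
  have "(\<lambda>w. g w * (w - z) ^ nat (m - n)) analytic_on {z}"
    by (intro analytic_intros g(1))
  moreover have "\<forall>\<^sub>F w in at z. F w = (g w * (w - z) ^ nat (m - n)) * (w - z) powi n"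
    using g(2) eventually_neq_at_within[of z]
  proof eventually_elim
    case (elim w)
    have "(w - z) powi m = (w - z) powi (int (nat (m - n)) + n)"
      using assms(2) by simp
    also have "\<dots> = (w - z) ^ nat (m - n) * (w - z) powi n"
      using elim(2) by (intro power_int_nat_add) auto
    finally show ?case using elim(1) by simp
  qed
  ultimately show ?thesis unfolding order_ge_def by blast
qed

lemma order_ge_mult:
  assumes "order_ge F z m" "order_ge G z n"
  shows "order_ge (\<lambda>w. F w * G w) z (m + n)"
proof -
  obtain f where f: "f analytic_on {z}" "\<forall>\<^sub>F w in at z. F w = f w * (w - z) powi m"
    using assms(1) unfolding order_ge_def by blast
  obtain g where g: "g analytic_on {z}" "\<forall>\<^sub>F w in at z. G w = g w * (w - z) powi n"
    using assms(2) unfolding order_ge_def by blast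
  have "(\<lambda>w. f w * g w) analytic_on {z}" by (intro analytic_intros f(1) g(1))
  moreover have "\<forall>\<^sub>F w in at z. F w * G w = (f w * g w) * (w - z) powi (m + n)"
    using f(2) g(2) eventually_neq_at_within[of z]
    by eventually_elim (simp add: power_int_add)
  ultimately show ?thesis unfolding order_ge_def by (intro exI[of _ "\<lambda>w. f w * g w"]) auto
qed

lemma order_ge_add:
  assumes "order_ge F z m" "order_ge G z m"
  shows "order_ge (\<lambda>w. F w + G w) z m"
proof -
  obtain f where f: "f analytic_on {z}" "\<forall>\<^sub>F w in at z. F w = f w * (w - z) powi m"
    using assms(1) unfolding order_ge_def by blast
  obtain g where g: "g analytic_on {z}" "\<forall>\<^sub>F w in at z. G w = g w * (w - z) powi m"
    using assms(2) unfolding order_ge_def by blast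
  have "(\<lambda>w. f w + g w) analytic_on {z}" by (intro analytic_intros f(1) g(1))
  moreover have "\<forall>\<^sub>F w in at z. F w + G w = (f w + g w) * (w - z) powi m"
    using f(2) g(2) by eventually_elim (simp add: algebra_simps)
  ultimately show ?thesis unfolding order_ge_def by (intro exI[of _ "\<lambda>w. f w + g w"]) auto
qed

lemma order_ge_zero: "order_ge (\<lambda>w. 0) z m"
  unfolding order_ge_def by (intro exI[of _ "\<lambda>w. 0"]) auto

lemma order_ge_sum:
  assumes "\<And>i. i \<in> I \<Longrightarrow> order_ge (F i) z m"
  shows "order_ge (\<lambda>w. \<Sum>i\<in>I. F i w) z m"
  using assms
  by (induction I rule: infinite_finite_induct) (auto intro: order_ge_zero order_ge_add)

lemma has_order_mult:
  assumes "has_order F z m" "has_order G z n"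
  shows "has_order (\<lambda>w. F w * G w) z (m + n)"
proof -
  obtain f where f: "f analytic_on {z}" "f z \<noteq> 0" "\<forall>\<^sub>F w in at z. F w = f w * (w - z) powi m"
    using assms(1) unfolding has_order_def by blast
  obtain g where g: "g analytic_on {z}" "g z \<noteq> 0" "\<forall>\<^sub>F w in at z. G w = g w * (w - z) powi n"
    using assms(2) unfolding has_order_def by blast
  have "(\<lambda>w. f w * g w) analytic_on {z}" by (intro analytic_intros f(1) g(1))
  moreover have "\<forall>\<^sub>F w in at z. F w * G w = (f w * g w) * (w - z) powi (m + n)"
    using f(3) g(3) eventually_neq_at_within[of z]
    by eventually_elim (simp add: power_int_add)
  ultimately show ?thesis unfolding has_order_def using f(2) g(2)
    by (intro exI[of _ "\<lambda>w. f w * g w"]) auto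
qed

lemma has_order_power:
  assumes "has_order F z m"
  shows "has_order (\<lambda>w. F w ^ n) z (int n * m)"
proof (induction n)
  case 0
  show ?case using has_order_analytic[of "\<lambda>w. 1" z] by simp
next
  case (Suc n)
  show ?case using has_order_mult[OF assms Suc] by (simp add: algebra_simps)
qed

lemma has_order_prod:
  assumes "\<And>i. i \<in> I \<Longrightarrow> has_order (F i) z (m i)"
  shows "has_order (\<lambda>w. \<Prod>i\<in>I. F i w) z (\<Sum>i\<in>I. m i)"
  using assms
proof (induction I rule: infinite_finite_induct)
  case (insert i I)
  then show ?case using has_order_mult[of "F i" z "m i" "\<lambda>w. \<Prod>i\<in>I. F i w"] by simp
qed (use has_order_analytic[of "\<lambda>w. 1" z] in simp_all)

lemma has_order_inverse:
  assumes "has_order F z m"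
  shows "has_order (\<lambda>w. inverse (F w)) z (- m)"
proof -
  obtain f where f: "f analytic_on {z}" "f z \<noteq> 0" "\<forall>\<^sub>F w in at z. F w = f w * (w - z) powi m"
    using assms(1) unfolding has_order_def by blast
  have "(\<lambda>w. inverse (f w)) analytic_on {z}" by (intro analytic_intros f(1)) (use f(2) in auto)
  moreover have "\<forall>\<^sub>F w in at z. inverse (F w) = inverse (f w) * (w - z) powi (- m)"
    using f(3) by eventually_elim (simp add: power_int_minus)
  ultimately show ?thesis unfolding has_order_def using f(2)
    by (intro exI[of _ "\<lambda>w. inverse (f w)"]) auto
qed

lemma has_order_eventually_nonzero:
  assumes "has_order F z m"
  shows "\<forall>\<^sub>F w in at z. F w \<noteq> 0"
proof -
  obtain f where f: "f analytic_on {z}" "f z \<noteq> 0" "\<forall>\<^sub>F w in at z. F w = f w * (w - z) powi m"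
    using assms(1) unfolding has_order_def by blast
  have "\<forall>\<^sub>F w in at z. f w \<noteq> 0"
    using f(1,2) analytic_at_neq_imp_eventually_neq by blast
  then show ?thesis using f(3) eventually_neq_at_within[of z]
    by eventually_elim simp
qed

lemma has_order_0_imp_nonzero:
  assumes "has_order F z 0" "isCont F z"
  shows "F z \<noteq> 0"
proof -
  obtain f where f: "f analytic_on {z}" "f z \<noteq> 0" "\<forall>\<^sub>F w in at z. F w = f w"
    using assms(1) unfolding has_order_def by auto
  have "f \<midarrow>z\<rightarrow> f z" using f(1) analytic_at_imp_isCont isContD by blast
  then have "F \<midarrow>z\<rightarrow> f z" using filterlim_cong[OF refl refl f(3)] by blast
  moreover have "F \<midarrow>z\<rightarrow> F z" using assms(2) isContD by blast
  ultimately have "F z = f z" using LIM_unique by blast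
  then show ?thesis using f(2) by simp
qed

lemma has_order_diff_const:
  assumes "has_order F z m" "m < 0"
  shows "has_order (\<lambda>w. F w - c) z m"
proof -
  obtain f where f: "f analytic_on {z}" "f z \<noteq> 0" "\<forall>\<^sub>F w in at z. F w = f w * (w - z) powi m"
    using assms(1) unfolding has_order_def by blast
  define g where "g = (\<lambda>w. f w - c * (w - z) ^ nat (- m))"
  have "g analytic_on {z}" unfolding g_def by (intro analytic_intros f(1))
  moreover have "g z \<noteq> 0" using f(2) assms(2) unfolding g_def by (simp add: zero_power)
  moreover have "\<forall>\<^sub>F w in at z. F w - c = g w * (w - z) powi m"
    using f(3) eventually_neq_at_within[of z]
  proof eventually_elim
    case (elim w)
    have "(w - z) ^ nat (- m) * (w - z) powi m = (w - z) powi (int (nat (- m)) + m)"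
      using elim(2) by (intro power_int_nat_add[symmetric]) auto
    also have "\<dots> = 1" using assms(2) by simp
    finally show ?case using elim(1) by (simp add: g_def algebra_simps)
  qed
  ultimately show ?thesis unfolding has_order_def by blast
qed

lemma eventually_at_ballE:
  fixes z :: complex
  assumes "\<forall>\<^sub>F w in at z. P w"
  obtains r where "r > 0" "\<And>w. w \<in> ball z r - {z} \<Longrightarrow> P w"
  using assms unfolding eventually_at by (auto simp: dist_commute)

lemma has_order_deriv:
  assumes "has_order F z m" "m \<noteq> 0"
  shows "has_order (deriv F) z (m - 1)"
proof -
  obtain f where f: "f analytic_on {z}" "f z \<noteq> 0" "\<forall>\<^sub>F w in at z. F w = f w * (w - z) powi m"
    using assms(1) unfolding has_order_def by blast
  obtain r where r: "r > 0" "f holomorphic_on ball z r" using f(1) analytic_at_ball by blast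
  obtain s where s: "s > 0" "\<And>w. w \<in> ball z s - {z} \<Longrightarrow> F w = f w * (w - z) powi m"
    using eventually_at_ballE[OF f(3)] by metis
  define g where "g = (\<lambda>w. deriv f w * (w - z) + of_int m * f w)"
  have "g analytic_on {z}" unfolding g_def by (intro analytic_intros f(1))
  moreover have "g z \<noteq> 0" using f(2) assms(2) unfolding g_def by simp
  moreover have "\<forall>\<^sub>F w in at z. deriv F w = g w * (w - z) powi (m - 1)"
  proof -
    have "\<forall>\<^sub>F w in at z. w \<in> ball z (min r s) - {z}"
      using r(1) s(1) by (intro eventually_at_in_open) auto
    then show ?thesis
    proof eventually_elim
      case (elim w)
      then have w: "w \<noteq> z" "w \<in> ball z r" by auto
      have "(f has_field_derivative deriv f w) (at w)"
        using r(2) w(2) holomorphic_derivI by blast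
      then have "((\<lambda>w. f w * (w - z) powi m) has_field_derivative
          deriv f w * (w - z) powi m + of_int m * (w - z) powi (m - 1) * f w) (at w)"
        using w(1) by (auto intro!: derivative_eq_intros)
      then have "(F has_field_derivative
          deriv f w * (w - z) powi m + of_int m * (w - z) powi (m - 1) * f w) (at w)"
        by (rule has_field_derivative_transform_within_open[of _ _ _ "ball z s - {z}"])
           (use elim s(2) in auto)
      then have "deriv F w = deriv f w * (w - z) powi m + of_int m * (w - z) powi (m - 1) * f w"
        by (rule DERIV_imp_deriv)
      moreover have "(w - z) powi m = (w - z) * (w - z) powi (m - 1)"
        using w(1) power_int_add[of "w - z" 1 "m - 1"] by simp
      ultimately show ?case by (simp add: g_def algebra_simps)
    qed
  qed
  ultimately show ?thesis unfolding has_order_def by blast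
qed

lemma order_ge_pos_tendsto:
  assumes "order_ge F z m" "m > 0"
  shows "F \<midarrow>z\<rightarrow> 0"
proof -
  obtain g where g: "g analytic_on {z}" "\<forall>\<^sub>F w in at z. F w = g w * (w - z) powi m"
    using assms(1) unfolding order_ge_def by blast
  have c: "isCont g z" using g(1) analytic_at_imp_isCont by blast
  have "isCont (\<lambda>w. g w * (w - z) ^ nat m) z" by (intro continuous_intros c)
  then have "(\<lambda>w. g w * (w - z) ^ nat m) \<midarrow>z\<rightarrow> 0"
    using assms(2) unfolding isCont_def by (simp add: zero_power)
  moreover have "\<forall>\<^sub>F w in at z. F w = g w * (w - z) ^ nat m"
    using g(2) assms(2) by (auto simp: power_int_def)
  ultimately show ?thesis by (subst filterlim_cong[OF refl refl])
qed

text \<open>The representing analytic function agrees with the given one near the point, so the limits that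
  define \<open>remove_sings\<close> exist there and are its values.\<close>

lemma order_ge_0_removable:
  assumes "order_ge F z 0"
  shows "remove_sings F analytic_on {z}" "\<forall>\<^sub>F w in at z. remove_sings F w = F w"
proof -
  obtain g where g: "g analytic_on {z}" "\<forall>\<^sub>F w in at z. F w = g w"
    using assms(1) unfolding order_ge_def by auto
  obtain r where r: "r > 0" "g holomorphic_on ball z r" using g(1) analytic_at_ball by blast
  obtain s where s: "s > 0" "\<And>w. w \<in> ball z s - {z} \<Longrightarrow> F w = g w"
    using eventually_at_ballE[OF g(2)] by metis
  have eq: "remove_sings F w = g w" if w: "w \<in> ball z (min r s)" for w
  proof (rule remove_sings_eqI)
    have "\<forall>\<^sub>F v in at w. v \<in> ball z s - {z}"
    proof (cases "w = z")
      case True show ?thesis unfolding True using s(1) by (intro eventually_at_in_open) auto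
    next
      case False
      have "\<forall>\<^sub>F v in nhds w. v \<in> ball z s - {z}"
        using False w by (intro eventually_nhds_in_open) auto
      then show ?thesis unfolding eventually_at_filter by (rule eventually_mono) auto
    qed
    then have "\<forall>\<^sub>F v in at w. F v = g v" by eventually_elim (use s(2) in auto)
    moreover have "g \<midarrow>w\<rightarrow> g w"
    proof -
      have "continuous_on (ball z r) g" using r(2) holomorphic_on_imp_continuous_on by blast
      then have "isCont g w" using w by (simp add: continuous_on_eq_continuous_at)
      then show ?thesis by (rule isContD)
    qed
    ultimately show "F \<midarrow>w\<rightarrow> g w" using filterlim_cong[OF refl refl] by blast
  qed
  have "remove_sings F holomorphic_on ball z (min r s)"
    by (rule holomorphic_transform[of g]) (use r(2) eq in \<open>auto intro: holomorphic_on_subset\<close>)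
  then show "remove_sings F analytic_on {z}"
    using r(1) s(1) by (intro holomorphic_on_imp_analytic_at[of _ "ball z (min r s)"]) auto
  have "\<forall>\<^sub>F w in at z. w \<in> ball z (min r s) - {z}"
    using r(1) s(1) by (intro eventually_at_in_open) auto
  then show "\<forall>\<^sub>F w in at z. remove_sings F w = F w"
    by eventually_elim (use eq s(2) in auto)
qed

text \<open>If the degree were larger, the reflected polynomial, evaluated at \<open>1 / w\<close>, would tend to zero, but
  its value at zero is the leading coefficient.\<close>

lemma poly_tendsto_0_at_infinity_degree:
  fixes P :: "complex poly"
  assumes "((\<lambda>w. poly P w * w powi (- (d + 1))) \<longlongrightarrow> 0) at_infinity" "P \<noteq> 0"
  shows "int (degree P) \<le> d"
proof (rule ccontr)
  assume "\<not> ?thesis"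
  then have m: "d + 1 \<le> int (degree P)" by simp
  let ?m = "degree P"
  have "\<forall>\<^sub>F w in at_infinity. norm (poly (reflect_poly P) (inverse w)) \<le> norm (poly P w * w powi (- (d + 1)))"
  proof -
    have e: "\<forall>\<^sub>F w::complex in at_infinity. norm w \<ge> 1"
      by (auto simp: eventually_at_infinity)
    show ?thesis using e
    proof eventually_elim
      case (elim w)
      then have w: "w \<noteq> 0" by auto
      have "poly (reflect_poly P) (inverse w) = inverse w ^ ?m * poly P w"
        using w by (subst poly_reflect_poly_nz) auto
      also have "inverse w ^ ?m = w powi (- (d + 1)) * w powi (d + 1 - int ?m)"
      proof -
        have "w powi (- (d + 1)) * w powi (d + 1 - int ?m) = w powi (- int ?m)"
          using w by (subst power_int_add[symmetric]) auto
        then show ?thesis by (simp add: power_int_minus power_inverse)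
      qed
      finally have "norm (poly (reflect_poly P) (inverse w))
          = norm (poly P w * w powi (- (d + 1))) * norm w powi (d + 1 - int ?m)"
        by (simp add: norm_mult norm_power_int)
      moreover have "norm w powi (d + 1 - int ?m) \<le> 1"
      proof -
        have "norm w powi (d + 1 - int ?m) = inverse (norm w ^ nat (int ?m - (d + 1)))"
          using m by (simp add: power_int_def power_inverse)
        also have "\<dots> \<le> 1" using elim by (intro inverse_le_1_iff[THEN iffD2]) auto
        finally show ?thesis .
      qed
      ultimately show ?case by (simp add: mult_left_le)
    qed
  qed
  then have "((\<lambda>w. poly (reflect_poly P) (inverse w)) \<longlongrightarrow> 0) at_infinity"
    by (rule Lim_null_comparison[OF _ tendsto_norm_zero[OF assms(1)]])
  moreover have "((\<lambda>w. poly (reflect_poly P) (inverse w)) \<longlongrightarrow> poly (reflect_poly P) 0) at_infinity"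
    by (intro tendsto_intros tendsto_inverse_0)
  ultimately have "poly (reflect_poly P) 0 = 0"
    using tendsto_unique trivial_limit_at_infinity by blast
  then show False using assms(2) by simp
qed

section \<open>The quotient map of genus 0\<close>

lemma moebius_upper_half_plane:
  fixes M :: "real^2^2"
  assumes "Determinants.det M = 1" "z \<in> upper_half_plane"
  shows "of_real (M$2$1) * z + of_real (M$2$2) \<noteq> 0" "moebius M z \<in> upper_half_plane"
proof -
  let ?n = "of_real (M$1$1) * z + of_real (M$1$2)"
  let ?q = "of_real (M$2$1) * z + of_real (M$2$2)"
  have det: "M$1$1 * M$2$2 - M$1$2 * M$2$1 = 1" using assms(1) by (simp add: det_2)
  show q: "?q \<noteq> 0"
  proof
    assume "?q = 0"
    then have "Im ?q = 0" "Re ?q = 0" by simp_all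
    then show False using assms(2) det by auto
  qed
  have "Im (?n * cnj ?q) = (M$1$1 * M$2$2 - M$1$2 * M$2$1) * Im z"
    by (simp add: algebra_simps)
  then have "Im (?n * cnj ?q) > 0" using det assms(2) by simp
  moreover have "?n / ?q = (?n * cnj ?q) / of_real ((cmod ?q)\<^sup>2)"
    by (subst complex_div_cnj) simp
  ultimately show "moebius M z \<in> upper_half_plane"
    using q unfolding moebius_def by (simp only: Im_divide_of_real mem_Collect_eq) simp
qed

lemma moebius_analytic:
  fixes M :: "real^2^2"
  assumes "Determinants.det M = 1" "z \<in> upper_half_plane"
  shows "moebius M analytic_on {z}"
  unfolding moebius_def
  by (intro analytic_intros) (use moebius_upper_half_plane(1)[OF assms] in auto)

text \<open>As an equality of functions, so also where \<open>F\<close> is not differentiable and \<open>deriv\<close> is arbitrary.\<close>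

lemma deriv_diff_const: "deriv (\<lambda>w. F w - c) = deriv (F :: complex \<Rightarrow> complex)"
proof -
  have "((\<lambda>w. F w - c) has_field_derivative D) (at x) \<longleftrightarrow> (F has_field_derivative D) (at x)" for D x
  proof
    assume "((\<lambda>w. F w - c) has_field_derivative D) (at x)"
    from DERIV_add[OF this DERIV_const[of c]]
    show "(F has_field_derivative D) (at x)" by simp
  qed (auto intro!: derivative_eq_intros)
  then show ?thesis unfolding deriv_def by simp
qed

lemma eventually_at_eq_imp_eq:
  fixes F G :: "complex \<Rightarrow> complex"
  assumes "isCont F z" "isCont G z" "\<forall>\<^sub>F w in at z. F w = G w"
  shows "F z = G z"
proof -
  have "F \<midarrow>z\<rightarrow> F z" "G \<midarrow>z\<rightarrow> G z" using assms(1,2) isContD by blast+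
  moreover have "G \<midarrow>z\<rightarrow> F z"
    using filterlim_cong[OF refl refl assms(3), of "nhds (F z)"] calculation(1) by simp
  ultimately show ?thesis using LIM_unique by blast
qed

lemma eventually_analytic_at:
  assumes "(f :: complex \<Rightarrow> complex) analytic_on {z}"
  shows "\<forall>\<^sub>F w in nhds z. f analytic_on {w}"
proof -
  obtain r where r: "r > 0" "f holomorphic_on ball z r" using assms analytic_at_ball by blast
  have "\<forall>\<^sub>F w in nhds z. w \<in> ball z r" using r(1) by (intro eventually_nhds_in_open) auto
  then show ?thesis
    by eventually_elim (use r(2) holomorphic_on_imp_analytic_at in auto)
qed

text \<open>The function \<open>ram\<close> gives the ramification index of \<open>h\<close> over a point of the projective line. Where
  \<open>h\<close> is unramified and \<open>ram\<close> is 1 the equality is a consequence, since the local degree of a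
  nonconstant map is positive.\<close>

locale genus_0_quotient =
  fixes \<Gamma> :: "(real^2^2) set" and h :: "complex \<Rightarrow> complex" and ram :: "P1 \<Rightarrow> nat"
  assumes det_1: "\<And>M. M \<in> \<Gamma> \<Longrightarrow> Determinants.det M = 1"
    and quotient: "genus_0_quotient_map \<Gamma> h"
    and finite_branch: "finite {p. ram p \<noteq> 1}"
    and ramification: "\<And>z. z \<in> upper_half_plane \<Longrightarrow>
      ramification_index h z > 1 \<or> ram (P1_map h z) \<noteq> 1 \<Longrightarrow>
      ramification_index h z = int (ram (P1_map h z))"
begin

lemma nicely_meromorphic: "h nicely_meromorphic_on upper_half_plane"
  using quotient unfolding genus_0_quotient_map_def by blast

lemma surj: "\<exists>z\<in>upper_half_plane. P1_map h z = p"
  using quotient unfolding genus_0_quotient_map_def by (metis UNIV_I imageE)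

lemma fibre: "z \<in> upper_half_plane \<Longrightarrow> w \<in> upper_half_plane \<Longrightarrow> P1_map h z = P1_map h w \<longleftrightarrow> w \<in> orbit \<Gamma> z"
  using quotient unfolding genus_0_quotient_map_def by blast

lemma open_uhp: "open upper_half_plane" by (rule open_halfspace_Im_gt)

lemma eventually_uhp: "z \<in> upper_half_plane \<Longrightarrow> \<forall>\<^sub>F w in nhds z. w \<in> upper_half_plane"
  using open_uhp by (rule eventually_nhds_in_open)

lemma analytic: "z \<in> upper_half_plane \<Longrightarrow> \<not> is_pole h z \<Longrightarrow> h analytic_on {z}"
  using nicely_meromorphic nicely_meromorphic_on_imp_analytic_at by blast

lemma isolated: "z \<in> upper_half_plane \<Longrightarrow> isolated_singularity_at h z"
  using nicely_meromorphic unfolding nicely_meromorphic_on_def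
  by (metis (no_types, lifting) meromorphic_on_isolated_singularity meromorphic_on_subset empty_subsetI insert_subset)

lemma eventually_analytic:
  assumes "z \<in> upper_half_plane"
  shows "\<forall>\<^sub>F w in at z. w \<in> upper_half_plane \<and> \<not> is_pole h w \<and> h analytic_on {w}"
proof -
  obtain r where r: "r > 0" "h analytic_on ball z r - {z}"
    using isolated[OF assms] unfolding isolated_singularity_at_def by blast
  have "\<forall>\<^sub>F w in at z. w \<in> ball z r - {z}" using r(1) by (intro eventually_at_in_open) auto
  moreover have "\<forall>\<^sub>F w in at z. w \<in> upper_half_plane"
    using eventually_uhp[OF assms] eventually_nhds_conv_at by blast
  ultimately show ?thesis
  proof eventually_elim
    case (elim w)
    then have "h analytic_on {w}" using r(2) analytic_on_subset by blast
    then show ?case using elim analytic_at_imp_no_pole by blast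
  qed
qed

lemma not_locally_constant:
  assumes "z \<in> upper_half_plane"
  shows "\<forall>\<^sub>F w in at z. h w \<noteq> c"
proof (rule ccontr)
  assume "\<not> ?thesis"
  then have "\<exists>\<^sub>F w in at z. h w = c" by (simp add: frequently_def)
  then have c: "\<And>w. w \<in> upper_half_plane \<Longrightarrow> h w = c"
    using frequently_eq_meromorphic_imp_constant[OF _ nicely_meromorphic open_uhp _ assms]
      connected_halfspace_Im_gt by blast
  obtain p where p: "p \<in> upper_half_plane" "P1_map h p = None" using surj by blast
  have "\<forall>\<^sub>F w in at p. h w = c"
    using eventually_uhp[OF p(1)] c eventually_nhds_conv_at eventually_mono
    by (metis (mono_tags, lifting))
  then have "h \<midarrow>p\<rightarrow> c" by (simp add: tendsto_eventually)
  moreover have "is_pole h p" using p(2) by (simp add: P1_map_def split: if_splits)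
  ultimately show False unfolding is_pole_def
    using not_tendsto_and_filterlim_at_infinity at_neq_bot by blast
qed

lemma order_at_finite:
  assumes "z \<in> upper_half_plane" "\<not> is_pole h z"
  shows "has_order (\<lambda>w. h w - h z) z (int (ram (Some (h z))))" "ram (Some (h z)) \<ge> 1"
proof -
  let ?f = "\<lambda>w. h w - h z"
  let ?n = "zorder ?f z" and ?g = "zor_poly ?f z"
  obtain r where r: "r > 0" "h holomorphic_on ball z r"
    using analytic[OF assms] analytic_at_ball by blast
  have "\<forall>\<^sub>F w in at z. h w \<noteq> h z \<and> w \<in> ball z r - {z}"
    using r(1) by (intro eventually_conj not_locally_constant assms(1) eventually_at_in_open) auto
  then obtain w where w: "h w \<noteq> h z" "w \<in> ball z r"
    using eventually_happens[of _ "at z"] at_neq_bot by fastforce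
  have "(if ?f z = 0 then ?n > 0 else ?n = 0) \<and> (\<exists>r'. r' > 0 \<and> cball z r' \<subseteq> ball z r \<and> ?g holomorphic_on cball z r'
    \<and> (\<forall>w\<in>cball z r'. ?f w  = ?g w * (w-z) ^ nat ?n \<and> ?g w \<noteq> 0))"
    by (rule zorder_exist_zero) (use r w in \<open>auto intro!: holomorphic_intros\<close>)
  then obtain r' where n0: "?n > 0" and r': "r' > 0" "?g holomorphic_on cball z r'"
    "\<And>w. w \<in> cball z r' \<Longrightarrow> ?f w = ?g w * (w-z) ^ nat ?n \<and> ?g w \<noteq> 0"
    by auto
  have n: "?n = int (ram (Some (h z)))"
    using ramification[OF assms(1)] assms(2) n0
    by (cases "?n > 1 \<or> ram (Some (h z)) \<noteq> 1") (auto simp: ramification_index_def P1_map_def)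
  show "ram (Some (h z)) \<ge> 1" using n n0 by simp
  have "?g analytic_on {z}"
    using r' by (intro holomorphic_on_imp_analytic_at[of _ "ball z r'"]) (auto intro: holomorphic_on_subset)
  moreover have "?g z \<noteq> 0" using r'(1) r'(3)[of z] by simp
  moreover have "\<forall>\<^sub>F w in at z. ?f w = ?g w * (w - z) powi ?n"
  proof -
    have "\<forall>\<^sub>F w in at z. w \<in> ball z r' - {z}" using r'(1) by (intro eventually_at_in_open) auto
    then show ?thesis
    proof eventually_elim
      case (elim w)
      then show ?case using r'(3)[of w] n0 by (simp add: power_int_def)
    qed
  qed
  ultimately show "has_order ?f z (int (ram (Some (h z))))" unfolding has_order_def n[symmetric]
    by (intro exI[of _ ?g] conjI)
qed

lemma order_at_pole:
  assumes "z \<in> upper_half_plane" "is_pole h z"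
  shows "has_order h z (- int (ram None))" "ram None \<ge> 1"
proof -
  let ?n = "zorder h z" and ?g = "zor_poly h z"
  obtain r where r: "r > 0" "h analytic_on ball z r - {z}"
    using isolated[OF assms(1)] unfolding isolated_singularity_at_def by blast
  have "?n < 0 \<and> ?g z \<noteq> 0 \<and> (\<exists>r'. r' > 0 \<and> cball z r' \<subseteq> ball z r \<and> ?g holomorphic_on cball z r'
    \<and> (\<forall>w\<in>cball z r' - {z}. h w  = ?g w / (w-z) ^ nat (- ?n) \<and> ?g w \<noteq> 0))"
    by (rule zorder_exist_pole) (use r assms analytic_imp_holomorphic in auto)
  then obtain r' where n0: "?n < 0" and g: "?g z \<noteq> 0" and r': "r' > 0" "?g holomorphic_on cball z r'"
    "\<And>w. w \<in> cball z r' - {z} \<Longrightarrow> h w = ?g w / (w-z) ^ nat (- ?n)"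
    by auto
  have n: "- ?n = int (ram None)"
    using ramification[OF assms(1)] assms(2) n0
    by (cases "- ?n > 1 \<or> ram None \<noteq> 1") (auto simp: ramification_index_def P1_map_def)
  show "ram None \<ge> 1" using n n0 by simp
  have "?g analytic_on {z}"
    using r' by (intro holomorphic_on_imp_analytic_at[of _ "ball z r'"]) (auto intro: holomorphic_on_subset)
  moreover have "\<forall>\<^sub>F w in at z. h w = ?g w * (w - z) powi ?n"
  proof -
    have "\<forall>\<^sub>F w in at z. w \<in> ball z r' - {z}" using r'(1) by (intro eventually_at_in_open) auto
    then show ?thesis
    proof eventually_elim
      case (elim w)
      then show ?case using r'(3)[of w] n0 by (simp add: power_int_def power_inverse field_simps)
    qed
  qed
  moreover have n': "- int (ram None) = ?n" using n by simp
  ultimately show "has_order h z (- int (ram None))" unfolding has_order_def n' using g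
    by (intro exI[of _ ?g] conjI)
qed

lemma order_deriv_at_finite:
  assumes "z \<in> upper_half_plane" "\<not> is_pole h z"
  shows "has_order (deriv h) z (int (ram (Some (h z))) - 1)"
  using has_order_deriv[OF order_at_finite(1)[OF assms]] order_at_finite(2)[OF assms]
  unfolding deriv_diff_const by simp

lemma order_deriv_at_pole:
  assumes "z \<in> upper_half_plane" "is_pole h z"
  shows "has_order (deriv h) z (- int (ram None) - 1)"
  using has_order_deriv[OF order_at_pole(1)[OF assms]] order_at_pole(2)[OF assms] by simp

lemma deriv_nonzero_of_unramified:
  assumes "z \<in> upper_half_plane" "\<not> is_pole h z" "ram (Some (h z)) = 1"
  shows "deriv h z \<noteq> 0"
proof (rule has_order_0_imp_nonzero[of "deriv h" z])
  show "has_order (deriv h) z 0" using order_deriv_at_finite[OF assms(1,2)] assms(3) by simp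
  show "isCont (deriv h) z"
    using analytic_deriv[OF analytic[OF assms(1,2)]] analytic_at_imp_isCont by blast
qed

lemma eventually_regular:
  assumes "z \<in> upper_half_plane"
  shows "\<forall>\<^sub>F w in at z. w \<in> upper_half_plane \<and> \<not> is_pole h w \<and> deriv h w \<noteq> 0"
proof -
  have "\<forall>\<^sub>F w in at z. deriv h w \<noteq> 0"
    using has_order_eventually_nonzero[OF order_deriv_at_finite[OF assms]]
      has_order_eventually_nonzero[OF order_deriv_at_pole[OF assms]] by argo
  then show ?thesis using eventually_analytic[OF assms] by eventually_elim auto
qed

text \<open>The open mapping theorem: a property that holds near a point holds at some preimage of each value
  near the value at the point. In this way limits on the half plane become limits on the
  projective line.\<close>

lemma eventually_at_value:
  assumes z: "z \<in> upper_half_plane" "\<not> is_pole h z" and P: "\<forall>\<^sub>F w in at z. P w"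
  shows "\<forall>\<^sub>F a in at (h z). \<exists>w. P w \<and> h w = a"
proof -
  obtain r where r: "r > 0" "h holomorphic_on ball z r"
    using analytic[OF z] analytic_at_ball by blast
  have "\<forall>\<^sub>F w in at z. P w \<and> h w \<noteq> h z"
    using P not_locally_constant[OF z(1)] by (rule eventually_conj)
  then obtain s where s: "s > 0" "\<And>w. w \<in> ball z s - {z} \<Longrightarrow> P w \<and> h w \<noteq> h z"
    by (rule eventually_at_ballE) blast
  let ?B = "ball z (min r s)"
  have zB: "z \<in> ?B" using r s by simp
  have "open (h ` ?B)"
  proof (rule open_mapping_thm[of h ?B])
    show "h holomorphic_on ?B" using r(2) by (rule holomorphic_on_subset) auto
    define w where "w = z + of_real (min r s / 2)"
    have "w \<in> ?B" "w \<noteq> z" using r s by (auto simp: w_def dist_norm)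
    then have "h w \<noteq> h z" using s(2)[of w] by auto
    then show "\<not> h constant_on ?B" using zB \<open>w \<in> ?B\<close> unfolding constant_on_def by metis
  qed auto
  moreover have "h z \<in> h ` ?B" using zB by blast
  ultimately have "\<forall>\<^sub>F a in at (h z). a \<in> h ` ?B - {h z}" by (intro eventually_at_in_open) auto
  then show ?thesis
  proof eventually_elim
    case (elim a)
    then obtain w where w: "w \<in> ?B" "h w = a" "a \<noteq> h z" by blast
    then have "w \<noteq> z" by blast
    then show ?case using s(2)[of w] w by auto
  qed
qed

text \<open>The same at a pole, for \<open>1 / h\<close>, which extends to an open map near the pole.\<close>

lemma eventually_at_infinity_value:
  assumes z: "z \<in> upper_half_plane" "is_pole h z" and P: "\<forall>\<^sub>F w in at z. P w"
  shows "\<forall>\<^sub>F a in at_infinity. \<exists>w. P w \<and> h w = a"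
proof -
  define q where "q = remove_sings (\<lambda>w. inverse (h w))"
  have o: "order_ge (\<lambda>w. inverse (h w)) z (int (ram None))"
    using has_order_ge[OF has_order_inverse[OF order_at_pole(1)[OF z]]] by simp
  have e: "int (ram None) > 0" using order_at_pole(2)[OF z] by simp
  have "order_ge (\<lambda>w. inverse (h w)) z 0" using order_ge_mono[OF o] e by simp
  then have q: "q analytic_on {z}" "\<forall>\<^sub>F w in at z. q w = inverse (h w)"
    unfolding q_def by (rule order_ge_0_removable)+
  have qz: "q z = 0" unfolding q_def using order_ge_pos_tendsto[OF o e] by (rule remove_sings_eqI)
  obtain r where r: "r > 0" "q holomorphic_on ball z r" using q(1) analytic_at_ball by blast
  have "\<forall>\<^sub>F w in at z. P w \<and> q w = inverse (h w) \<and> h w \<noteq> 0"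
    using P q(2) not_locally_constant[OF z(1)] by (intro eventually_conj)
  then obtain s where s: "s > 0" "\<And>w. w \<in> ball z s - {z} \<Longrightarrow> P w \<and> q w = inverse (h w) \<and> h w \<noteq> 0"
    by (rule eventually_at_ballE) blast
  let ?B = "ball z (min r s)"
  have zB: "z \<in> ?B" using r s by simp
  have "open (q ` ?B)"
  proof (rule open_mapping_thm[of q ?B])
    show "q holomorphic_on ?B" using r(2) by (rule holomorphic_on_subset) auto
    define w where "w = z + of_real (min r s / 2)"
    have "w \<in> ?B" "w \<noteq> z" using r s by (auto simp: w_def dist_norm)
    then have "q w \<noteq> q z" using s(2)[of w] qz by auto
    then show "\<not> q constant_on ?B" using zB \<open>w \<in> ?B\<close> unfolding constant_on_def by metis
  qed auto
  moreover have "0 \<in> q ` ?B" using zB qz by (metis imageI)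
  ultimately have "\<forall>\<^sub>F a in at 0. a \<in> q ` ?B - {0}" by (intro eventually_at_in_open) auto
  then have "\<forall>\<^sub>F a in at_infinity. inverse a \<in> q ` ?B - {0}"
    unfolding at_to_infinity eventually_filtermap .
  then show ?thesis
  proof eventually_elim
    case (elim a)
    then obtain w where w: "w \<in> ?B" "q w = inverse a" "inverse a \<noteq> 0" by (metis DiffE imageE singletonI)
    then have "w \<noteq> z" using qz by auto
    then have "P w" "inverse (h w) = inverse a" using s(2)[of w] w by auto
    then have "P w" "h w = a" by (auto dest: inverse_eq_imp_eq)
    then show ?case by blast
  qed
qed

text \<open>\<open>h\<close> is constant on orbits, and \<open>h \<circ> M = h\<close> is differentiated.\<close>

lemma invariance:
  assumes "M \<in> \<Gamma>" "z \<in> upper_half_plane" "\<not> is_pole h z"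
  shows "moebius M z \<in> upper_half_plane" "\<not> is_pole h (moebius M z)" "h (moebius M z) = h z"
    "deriv h (moebius M z) * deriv (moebius M) z = deriv h z"
proof -
  have uhp: "moebius M w \<in> upper_half_plane" if "w \<in> upper_half_plane" for w
    using moebius_upper_half_plane(2)[OF det_1[OF assms(1)] that] .
  have P1: "P1_map h (moebius M w) = P1_map h w" if "w \<in> upper_half_plane" for w
    using fibre[OF that uhp[OF that]] assms(1) unfolding orbit_def by auto
  have inv: "\<not> is_pole h (moebius M w) \<and> h (moebius M w) = h w"
    if "w \<in> upper_half_plane" "\<not> is_pole h w" for w
    using P1[OF that(1)] that(2) by (simp add: P1_map_def split: if_splits)
  show "moebius M z \<in> upper_half_plane" "\<not> is_pole h (moebius M z)" "h (moebius M z) = h z"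
    using uhp inv assms by auto
  have "(h has_field_derivative deriv h (moebius M z)) (at (moebius M z))"
    using analytic[of "moebius M z"] uhp inv assms analytic_derivI by blast
  moreover have "(moebius M has_field_derivative deriv (moebius M) z) (at z)"
    using moebius_analytic[OF det_1[OF assms(1)] assms(2)] analytic_derivI by blast
  ultimately have "(h \<circ> moebius M has_field_derivative
      deriv h (moebius M z) * deriv (moebius M) z) (at z)"
    by (rule DERIV_chain)
  moreover have "\<forall>\<^sub>F w in nhds z. (h \<circ> moebius M) w = h w"
    using eventually_uhp[OF assms(2)] eventually_analytic_at[OF analytic[OF assms(2,3)]]
    by eventually_elim (use inv analytic_at_imp_no_pole in auto)
  ultimately have "(h has_field_derivative deriv h (moebius M z) * deriv (moebius M) z) (at z)"
    using DERIV_cong_ev[OF refl _ refl] by blast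
  then show "deriv h (moebius M z) * deriv (moebius M) z = deriv h z"
    by (simp add: DERIV_imp_deriv)
qed

end

section \<open>Automorphic forms as polynomials in the quotient map\<close>

lemma has_order_power_int:
  assumes "has_order F z m"
  shows "has_order (\<lambda>w. F w powi n) z (n * m)"
proof (cases "n \<ge> 0")
  case True
  then show ?thesis using has_order_power[OF assms, of "nat n"] by (simp add: power_int_def)
next
  case False
  then show ?thesis using has_order_power[OF has_order_inverse[OF assms], of "nat (- n)"]
    by (simp add: power_int_def)
qed

text \<open>The integer part of \<open>k (e - 1) / e\<close> with \<open>e = ram p\<close>, which is the coefficient of the divisor \<open>D^(k)\<close> at a
  branch point. At points with \<open>e = 1\<close> it vanishes.\<close>

definition branch_order :: "(P1 \<Rightarrow> nat) \<Rightarrow> nat \<Rightarrow> P1 \<Rightarrow> nat" where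
  "branch_order ram k p = k * (ram p - 1) div ram p"

definition branch_poly :: "(P1 \<Rightarrow> nat) \<Rightarrow> nat \<Rightarrow> complex poly" where
  "branch_poly ram k = (\<Prod>a\<in>{a. ram (Some a) \<noteq> 1}. [:- a, 1:] ^ branch_order ram k (Some a))"

text \<open>The degree of \<open>D^(k)\<close>, the canonical divisor of the projective line having degree -2.\<close>

definition forms_degree :: "(P1 \<Rightarrow> nat) \<Rightarrow> nat \<Rightarrow> int" where
  "forms_degree ram k = (\<Sum>p | ram p \<noteq> 1. int (branch_order ram k p)) - 2 * int k"

text \<open>The first bound makes \<open>P(h) h'^k / Q(h)\<close> holomorphic, and the second makes the singularities of
  \<open>f Q(h) / h'^k\<close>, as a function on the projective line, removable: they compare the order \<open>k (e - 1)\<close> of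
  \<open>h'^k\<close> with that of \<open>Q(h)\<close>.\<close>

lemma branch_order_bounds:
  assumes "ram p \<ge> 1"
  shows "int (ram p) * int (branch_order ram k p) \<le> int k * (int (ram p) - 1)"
    and "int k * (int (ram p) - 1) < int (ram p) * int (branch_order ram k p) + int (ram p)"
proof -
  let ?x = "k * (ram p - 1)"
  have x: "int ?x = int k * (int (ram p) - 1)" using assms by (simp add: of_nat_diff)
  have "ram p * (?x div ram p) \<le> ?x" by simp
  then have "int (ram p * (?x div ram p)) \<le> int ?x" by (simp only: of_nat_le_iff)
  then show "int (ram p) * int (branch_order ram k p) \<le> int k * (int (ram p) - 1)"
    unfolding x branch_order_def by (simp only: of_nat_mult)
  have "?x < ram p * (?x div ram p) + ram p"
    using dividend_less_div_times[of "ram p" ?x] assms by (simp add: algebra_simps)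
  then have "int ?x < int (ram p * (?x div ram p) + ram p)" by (simp only: of_nat_less_iff)
  then show "int k * (int (ram p) - 1) < int (ram p) * int (branch_order ram k p) + int (ram p)"
    unfolding x branch_order_def by (simp only: of_nat_mult of_nat_add)
qed

lemma branch_order_unramified [simp]: "ram p = 1 \<Longrightarrow> branch_order ram k p = 0"
  by (simp add: branch_order_def)

context genus_0_quotient
begin

lemma finite_affine_branch: "finite {a. ram (Some a) \<noteq> 1}"
  using sum_over_P1(2)[OF finite_branch, of "\<lambda>p. 0"] by simp

lemma forms_degree_eq:
  "forms_degree ram k = (\<Sum>a | ram (Some a) \<noteq> 1. int (branch_order ram k (Some a)))
     + int (branch_order ram k None) - 2 * int k"
  unfolding forms_degree_def
  by (subst sum_over_P1(1)[OF finite_branch]) (auto simp: branch_order_unramified)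

lemma point_over_affine:
  obtains z where "z \<in> upper_half_plane" "\<not> is_pole h z" "h z = a"
  using surj[of "Some a"] by (auto simp: P1_map_def split: if_splits)

lemma point_over_infinity:
  obtains z where "z \<in> upper_half_plane" "is_pole h z"
  using surj[of None] by (auto simp: P1_map_def split: if_splits)

lemma order_branch_poly_at_finite:
  assumes z: "z \<in> upper_half_plane" "\<not> is_pole h z"
  shows "has_order (\<lambda>w. poly (branch_poly ram k) (h w)) z
    (int (ram (Some (h z))) * int (branch_order ram k (Some (h z))))"
proof -
  let ?S = "{a. ram (Some a) \<noteq> 1}"
  let ?m = "\<lambda>a. if a = h z then int (branch_order ram k (Some (h z))) * int (ram (Some (h z))) else 0"
  have "has_order (\<lambda>w. \<Prod>a\<in>?S. (h w - a) ^ branch_order ram k (Some a)) z (\<Sum>a\<in>?S. ?m a)"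
  proof (rule has_order_prod)
    fix a
    show "has_order (\<lambda>w. (h w - a) ^ branch_order ram k (Some a)) z (?m a)"
    proof (cases "a = h z")
      case True
      then show ?thesis using has_order_power[OF order_at_finite(1)[OF z]] by simp
    next
      case False
      have "has_order (\<lambda>w. h w - a) z 0"
        by (rule has_order_analytic) (use False in \<open>auto intro!: analytic_intros analytic z\<close>)
      from has_order_power[OF this] show ?thesis using False by simp
    qed
  qed
  also have "(\<Sum>a\<in>?S. ?m a) = int (ram (Some (h z))) * int (branch_order ram k (Some (h z)))"
    using finite_affine_branch by (simp add: sum.delta)
  also have "(\<lambda>w. \<Prod>a\<in>?S. (h w - a) ^ branch_order ram k (Some a)) = (\<lambda>w. poly (branch_poly ram k) (h w))"
    by (simp add: branch_poly_def poly_prod poly_power)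
  finally show ?thesis .
qed

lemma order_branch_poly_at_pole:
  assumes z: "z \<in> upper_half_plane" "is_pole h z"
  shows "has_order (\<lambda>w. poly (branch_poly ram k) (h w)) z
    (- int (ram None) * (\<Sum>a | ram (Some a) \<noteq> 1. int (branch_order ram k (Some a))))"
proof -
  let ?S = "{a. ram (Some a) \<noteq> 1}"
  have "has_order (\<lambda>w. \<Prod>a\<in>?S. (h w - a) ^ branch_order ram k (Some a)) z
    (\<Sum>a\<in>?S. int (branch_order ram k (Some a)) * - int (ram None))"
    using order_at_pole[OF z]
    by (intro has_order_prod has_order_power has_order_diff_const) auto
  also have "(\<Sum>a\<in>?S. int (branch_order ram k (Some a)) * - int (ram None)) =
    - int (ram None) * (\<Sum>a\<in>?S. int (branch_order ram k (Some a)))"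
    by (simp add: sum_distrib_left sum_negf mult.commute)
  also have "(\<lambda>w. \<Prod>a\<in>?S. (h w - a) ^ branch_order ram k (Some a)) = (\<lambda>w. poly (branch_poly ram k) (h w))"
    by (simp add: branch_poly_def poly_prod poly_power)
  finally show ?thesis .
qed

lemma eventually_branch_poly_nonzero:
  assumes z: "z \<in> upper_half_plane"
  shows "\<forall>\<^sub>F w in at z. poly (branch_poly ram k) (h w) \<noteq> 0"
  using has_order_eventually_nonzero[OF order_branch_poly_at_finite[OF z, of k]]
    has_order_eventually_nonzero[OF order_branch_poly_at_pole[OF z, of k]] by argo

text \<open>The relation \<open>f = P(h) h'^k / Q(h)\<close> without denominators. Both sides are analytic wherever \<open>h\<close> is
  finite, so it may be checked off a discrete set and still holds at branch points.\<close>

definition corresponds :: "nat \<Rightarrow> (complex \<Rightarrow> complex) \<Rightarrow> complex poly \<Rightarrow> bool" where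
  "corresponds k f P \<longleftrightarrow> (\<forall>z\<in>upper_half_plane. \<not> is_pole h z \<longrightarrow>
     f z * poly (branch_poly ram k) (h z) = poly P (h z) * deriv h z ^ k)"

lemma form_analytic:
  assumes "f \<in> automorphic_forms \<Gamma> k" "z \<in> upper_half_plane"
  shows "f analytic_on {z}"
  using assms open_uhp holomorphic_on_imp_analytic_at unfolding automorphic_forms_def by blast

lemma poly_h_analytic:
  assumes "z \<in> upper_half_plane" "\<not> is_pole h z"
  shows "(\<lambda>w. poly P (h w)) analytic_on {z}"
  unfolding poly_altdef by (intro analytic_intros analytic assms)

text \<open>The invariant function \<open>\<phi> = f Q(h) / h'^k\<close> descends along \<open>h\<close> to a function \<open>\<Phi>\<close>. Away from the
  branch points \<open>h\<close> has local inverses, so \<open>\<Phi>\<close> is analytic there. At a branch point \<open>a\<close> the function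
  \<open>(h - a) \<phi>\<close> has positive order, so \<open>(w - a) \<Phi>\<close> tends to zero and the singularity is removable. The
  order at a pole of \<open>h\<close> bounds the growth of \<open>\<Phi>\<close>, and Liouville's theorem applies.\<close>

lemma corresponds_exists:
  assumes f: "f \<in> automorphic_forms \<Gamma> k"
  shows "\<exists>P\<in>polys_le (forms_degree ram k). corresponds k f P"
proof -
  define d where "d = forms_degree ram k"
  define Q where "Q = branch_poly ram k"
  define N where "N = (\<Sum>a | ram (Some a) \<noteq> 1. int (branch_order ram k (Some a)))"
  let ?S = "{a. ram (Some a) \<noteq> 1}"
  define good where "good = (\<lambda>z. z \<in> upper_half_plane \<and> \<not> is_pole h z \<and> deriv h z \<noteq> 0)"
  define \<phi> where "\<phi> = (\<lambda>z. f z * poly Q (h z) * inverse (deriv h z ^ k))"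
  \<comment> \<open>The preimages of a value form one orbit; if one of them is good, all of them are, with the same value of phi.\<close>
  define \<Phi> where "\<Phi> = (\<lambda>a. \<phi> (SOME z. z \<in> upper_half_plane \<and> \<not> is_pole h z \<and> h z = a))"
  have \<Phi>: "\<Phi> (h z) = \<phi> z" if "good z" for z
  proof -
    let ?z = "SOME z'. z' \<in> upper_half_plane \<and> \<not> is_pole h z' \<and> h z' = h z"
    have z: "z \<in> upper_half_plane" "\<not> is_pole h z" "deriv h z \<noteq> 0" using that by (auto simp: good_def)
    then have z': "?z \<in> upper_half_plane \<and> \<not> is_pole h ?z \<and> h ?z = h z"
      by (intro someI_ex[of "\<lambda>z'. z' \<in> upper_half_plane \<and> \<not> is_pole h z' \<and> h z' = h z"]) auto
    then have "?z \<in> orbit \<Gamma> z" using fibre[of z ?z] z by (simp add: P1_map_def)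
    then obtain M where M: "M \<in> \<Gamma>" "?z = moebius M z" unfolding orbit_def by blast
    have f': "f ?z * deriv (moebius M) z ^ k = f z"
      using f M z unfolding automorphic_forms_def by auto
    have d': "deriv h ?z * deriv (moebius M) z = deriv h z"
      using invariance(4)[OF M(1) z(1,2)] M(2) by simp
    have M0: "deriv (moebius M) z \<noteq> 0" using d' z(3) by auto
    have "\<phi> ?z = f ?z * poly Q (h z) * inverse (deriv h ?z ^ k)" using z' by (simp add: \<phi>_def)
    also have "\<dots> = f ?z * deriv (moebius M) z ^ k * poly Q (h z) *
        inverse ((deriv h ?z * deriv (moebius M) z) ^ k)"
      using M0 by (simp add: field_simps power_mult_distrib)
    also have "\<dots> = \<phi> z" unfolding f' d' \<phi>_def ..
    finally show ?thesis by (simp add: \<Phi>_def)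
  qed
  have ev_good: "\<forall>\<^sub>F w in at z. good w" if "z \<in> upper_half_plane" for z
    using eventually_regular[OF that] unfolding good_def .
  have f0: "order_ge f z 0" if "z \<in> upper_half_plane" for z
    using form_analytic[OF f that] by (rule order_ge_analytic)
  have ord_fin: "order_ge \<phi> z (int (ram (Some (h z))) * int (branch_order ram k (Some (h z)))
      - int k * (int (ram (Some (h z))) - 1))" if z: "z \<in> upper_half_plane" "\<not> is_pole h z" for z
    using order_ge_mult[OF order_ge_mult[OF f0[OF z(1)]
        has_order_ge[OF order_branch_poly_at_finite[OF z, of k]]]
      has_order_ge[OF has_order_inverse[OF has_order_power[OF order_deriv_at_finite[OF z], of k]]]]
    by (simp add: \<phi>_def Q_def)
  have ord_pole: "order_ge \<phi> z (- int (ram None) * N + int k * (int (ram None) + 1))"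
    if z: "z \<in> upper_half_plane" "is_pole h z" for z
    using order_ge_mult[OF order_ge_mult[OF f0[OF z(1)]
        has_order_ge[OF order_branch_poly_at_pole[OF z, of k]]]
      has_order_ge[OF has_order_inverse[OF has_order_power[OF order_deriv_at_pole[OF z], of k]]]]
    by (simp add: \<phi>_def Q_def N_def algebra_simps)
  have \<Phi>_analytic: "\<Phi> analytic_on {a}" if a: "a \<notin> ?S" for a
  proof -
    obtain z where z: "z \<in> upper_half_plane" "\<not> is_pole h z" "h z = a" by (rule point_over_affine)
    have d0: "deriv h z \<noteq> 0" using deriv_nonzero_of_unramified[OF z(1,2)] a z(3) by simp
    have "\<forall>\<^sub>F w in nhds z. deriv h w \<noteq> 0"
      using analytic_at_neq_imp_eventually_neq[OF analytic_deriv[OF analytic[OF z(1,2)]] d0] d0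
      by (simp add: eventually_nhds_conv_at)
    then have "\<forall>\<^sub>F w in nhds z. w \<in> upper_half_plane \<and> h analytic_on {w} \<and> deriv h w \<noteq> 0"
      using eventually_uhp[OF z(1)] eventually_analytic_at[OF analytic[OF z(1,2)]]
      by eventually_elim auto
    then obtain s where s: "s > 0"
      "\<And>w. w \<in> ball z s \<Longrightarrow> w \<in> upper_half_plane \<and> h analytic_on {w} \<and> deriv h w \<noteq> 0"
      unfolding eventually_nhds_metric by (auto simp: dist_commute)
    have hs: "h holomorphic_on ball z s"
      using s(2) analytic_on_analytic_at analytic_imp_holomorphic by blast
    obtain r where r: "r > 0" "ball z r \<subseteq> ball z s" "inj_on h (ball z r)"
      using has_complex_derivative_locally_injective[OF hs _ open_ball d0] s(1) by auto
    have hr: "h holomorphic_on ball z r" using hs r(2) holomorphic_on_subset by blast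
    obtain g where g: "g holomorphic_on h ` ball z r" "\<And>w. w \<in> ball z r \<Longrightarrow> g (h w) = w"
      using holomorphic_has_inverse[OF hr open_ball r(3)] by metis
    have "f holomorphic_on ball z r"
      using f r(2) s(2) holomorphic_on_subset unfolding automorphic_forms_def by blast
    then have "\<phi> holomorphic_on ball z r"
      unfolding \<phi>_def poly_altdef using r(2) s(2) hr by (intro holomorphic_intros) auto
    moreover have "g ` h ` ball z r \<subseteq> ball z r" using g(2) by auto
    ultimately have "(\<phi> \<circ> g) holomorphic_on h ` ball z r"
      using g(1) by (metis holomorphic_on_compose holomorphic_on_subset)
    then have "\<Phi> holomorphic_on h ` ball z r"
    proof (rule holomorphic_transform)
      fix x assume "x \<in> h ` ball z r"
      then obtain w where w: "w \<in> ball z r" "x = h w" by blast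
      then have "good w" using r(2) s(2)[of w] analytic_at_imp_no_pole unfolding good_def by blast
      then show "(\<phi> \<circ> g) x = \<Phi> x" using \<Phi> g(2) w by simp
    qed
    moreover have "open (h ` ball z r)" using open_mapping_thm3[OF hr open_ball r(3)] .
    moreover have "a \<in> h ` ball z r" using r(1) z(3) by auto
    ultimately show ?thesis using holomorphic_on_imp_analytic_at by blast
  qed
  have \<Phi>_lim: "(\<lambda>w. (w - a) * \<Phi> w) \<midarrow>a\<rightarrow> 0" for a
  proof -
    obtain z where z: "z \<in> upper_half_plane" "\<not> is_pole h z" "h z = a" by (rule point_over_affine)
    have "order_ge (\<lambda>w. (h w - a) * \<phi> w) z (int (ram (Some a)) +
        (int (ram (Some a)) * int (branch_order ram k (Some a)) - int k * (int (ram (Some a)) - 1)))"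
      using order_ge_mult[OF has_order_ge[OF order_at_finite(1)[OF z(1,2)]] ord_fin[OF z(1,2)]]
      unfolding z(3) .
    then have l: "(\<lambda>w. (h w - a) * \<phi> w) \<midarrow>z\<rightarrow> 0"
      by (rule order_ge_pos_tendsto)
         (use branch_order_bounds(2)[of ram "Some a" k] order_at_finite(2)[OF z(1,2)] z(3) in simp)
    show ?thesis
    proof (rule tendstoI)
      fix e :: real assume "e > 0"
      then have "\<forall>\<^sub>F w in at z. dist ((h w - a) * \<phi> w) 0 < e \<and> good w"
        using eventually_conj[OF tendstoD[OF l] ev_good[OF z(1)]] by simp
      from eventually_at_value[OF z(1,2) this]
      show "\<forall>\<^sub>F w in at a. dist ((w - a) * \<Phi> w) 0 < e"
        unfolding z(3) by eventually_elim (use \<Phi> in auto)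
    qed
  qed
  have \<Phi>_infinity: "((\<lambda>w. \<Phi> w * w powi (- (d + 1))) \<longlongrightarrow> 0) at_infinity"
  proof -
    obtain z where z: "z \<in> upper_half_plane" "is_pole h z" by (rule point_over_infinity)
    have "order_ge (\<lambda>w. \<phi> w * h w powi (- (d + 1))) z
        (- int (ram None) * N + int k * (int (ram None) + 1) + - (d + 1) * - int (ram None))"
      by (intro order_ge_mult ord_pole z has_order_ge has_order_power_int order_at_pole(1))
    moreover have "- int (ram None) * N + int k * (int (ram None) + 1) + - (d + 1) * - int (ram None)
      = int (ram None) * int (branch_order ram k None) + int (ram None) - int k * (int (ram None) - 1)"
      unfolding d_def forms_degree_eq N_def[symmetric] by (simp add: algebra_simps)
    ultimately have l: "(\<lambda>w. \<phi> w * h w powi (- (d + 1))) \<midarrow>z\<rightarrow> 0"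
      using branch_order_bounds(2)[of ram None k] order_at_pole(2)[OF z]
      by (intro order_ge_pos_tendsto) auto
    show ?thesis
    proof (rule tendstoI)
      fix e :: real assume "e > 0"
      then have "\<forall>\<^sub>F w in at z. dist (\<phi> w * h w powi (- (d + 1))) 0 < e \<and> good w"
        using eventually_conj[OF tendstoD[OF l] ev_good[OF z(1)]] by simp
      from eventually_at_infinity_value[OF z this]
      show "\<forall>\<^sub>F w in at_infinity. dist (\<Phi> w * w powi (- (d + 1))) 0 < e"
        by eventually_elim (use \<Phi> in auto)
    qed
  qed
  define \<Psi> where "\<Psi> = remove_sings \<Phi>"
  have "order_ge \<Phi> a 0" for a
  proof (cases "a \<in> ?S")
    case False
    then show ?thesis using \<Phi>_analytic order_ge_analytic by blast
  next
    case True
    have "open (- (?S - {a}))" 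
      by (intro open_Compl finite_imp_closed finite_Diff finite_affine_branch)
    then obtain r where r: "r > 0" "ball a r \<subseteq> - (?S - {a})"
      by (rule openE[of _ a]) auto
    have "\<Phi> analytic_on ball a r - {a}"
      unfolding analytic_on_analytic_at[of \<Phi> "ball a r - {a}"] using \<Phi>_analytic r(2) by blast
    then have "\<Phi> holomorphic_on ball a r - {a}" by (rule analytic_imp_holomorphic)
    then obtain g where g: "g holomorphic_on ball a r" "\<forall>z\<in>ball a r - {a}. g z = \<Phi> z"
      using holomorphic_on_extend_lim[of \<Phi> "ball a r" a] \<Phi>_lim[of a] r(1) by auto
    have "\<forall>\<^sub>F w in at a. w \<in> ball a r - {a}" using r(1) by (intro eventually_at_in_open) auto
    then have "\<forall>\<^sub>F w in at a. \<Phi> w = g w" by eventually_elim (use g(2) in auto)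
    moreover have "g analytic_on {a}"
      using g(1) r(1) by (intro holomorphic_on_imp_analytic_at[of _ "ball a r"]) auto
    ultimately show ?thesis unfolding order_ge_def by (intro exI[of _ g]) auto
  qed
  then have "\<Psi> analytic_on {a}" for a unfolding \<Psi>_def by (rule order_ge_0_removable)
  then have entire: "\<Psi> holomorphic_on UNIV"
    using analytic_on_analytic_at analytic_imp_holomorphic by blast
  have \<Psi>\<Phi>: "\<Psi> a = \<Phi> a" if "a \<notin> ?S" for a
    unfolding \<Psi>_def using \<Phi>_analytic[OF that] by simp
  have notS: "\<forall>\<^sub>F a in at_infinity. a \<notin> ?S"
  proof -
    obtain B where "\<And>a. a \<in> ?S \<Longrightarrow> norm a \<le> B"
      using finite_imp_bounded[OF finite_affine_branch] bounded_iff by metis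
    then show ?thesis unfolding eventually_at_infinity
      by (intro exI[of _ "B + 1"]) fastforce
  qed
  have lim\<Psi>: "((\<lambda>w. \<Psi> w * w powi (- (d + 1))) \<longlongrightarrow> 0) at_infinity"
    by (rule Lim_transform_eventually[OF \<Phi>_infinity])
       (use notS in eventually_elim, use \<Psi>\<Phi> in auto)
  \<comment> \<open>One more than the degree to be proved; the limit at infinity then excludes the top coefficient.\<close>
  let ?n = "nat (d + 1)"
  have "\<forall>\<^sub>F w in at_infinity. norm (\<Psi> w) \<le> 1 * norm w ^ ?n"
  proof -
    have "\<forall>\<^sub>F w in at_infinity. dist (\<Psi> w * w powi (- (d + 1))) 0 < 1"
      using tendstoD[OF lim\<Psi>, of 1] by simp
    moreover have "\<forall>\<^sub>F w::complex in at_infinity. norm w \<ge> 1"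
      by (auto simp: eventually_at_infinity)
    ultimately show ?thesis
    proof eventually_elim
      case (elim w)
      then have w: "w \<noteq> 0" by auto
      have "w powi (- (d + 1)) * w powi (d + 1) = 1"
        using power_int_add[of w "- (d + 1)" "d + 1"] w by simp
      then have "\<Psi> w = \<Psi> w * w powi (- (d + 1)) * w powi (d + 1)"
        by (simp only: mult.assoc mult_1_right)
      then have "norm (\<Psi> w) = norm (\<Psi> w * w powi (- (d + 1))) * norm (w powi (d + 1))"
        by (metis norm_mult)
      also have "\<dots> \<le> 1 * norm (w powi (d + 1))"
        using elim(1) by (intro mult_right_mono) auto
      also have "norm (w powi (d + 1)) \<le> norm w ^ ?n"
      proof (cases "d + 1 \<ge> 0")
        case True
        then show ?thesis by (simp add: norm_power power_int_def)
      next
        case False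
        then have "norm (w powi (d + 1)) = inverse (norm w ^ nat (- (d + 1)))"
          by (simp add: norm_power norm_inverse power_int_def power_inverse)
        also have "\<dots> \<le> 1" using elim(2) by (intro inverse_le_1_iff[THEN iffD2]) auto
        finally show ?thesis using False by simp
      qed
      finally show ?case by simp
    qed
  qed
  then obtain B where B: "\<And>w. B \<le> norm w \<Longrightarrow> norm (\<Psi> w) \<le> 1 * norm w ^ ?n"
    unfolding eventually_at_infinity by blast
  define P where "P = (\<Sum>i\<le>?n. monom ((deriv ^^ i) \<Psi> 0 / fact i) i)"
  have P: "poly P w = \<Psi> w" for w
    using Liouville_polynomial[OF entire B, where \<xi> = w] unfolding P_def by (simp add: poly_sum poly_monom)
  have "P \<in> polys_le d"
    unfolding polys_le_def using poly_tendsto_0_at_infinity_degree[of P d] lim\<Psi> P by auto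
  moreover have "corresponds k f P"
    unfolding corresponds_def
  proof (intro ballI impI)
    fix z assume z: "z \<in> upper_half_plane" "\<not> is_pole h z"
    have "\<forall>\<^sub>F w in at z. \<forall>a\<in>?S. h w \<noteq> a"
      using finite_affine_branch not_locally_constant[OF z(1)] by (intro eventually_ball_finite) auto
    then have "\<forall>\<^sub>F w in at z. f w * poly Q (h w) = poly P (h w) * deriv h w ^ k"
      using eventually_regular[OF z(1)]
    proof eventually_elim
      case (elim w)
      then have "poly P (h w) = \<phi> w" using P \<Psi>\<Phi>[of "h w"] \<Phi>[of w] by (auto simp: good_def)
      then show ?case using elim by (simp add: \<phi>_def)
    qed
    then show "f z * poly (branch_poly ram k) (h z) = poly P (h z) * deriv h z ^ k"
      unfolding Q_def
      by (intro eventually_at_eq_imp_eq[where F = "\<lambda>z. f z * poly (branch_poly ram k) (h z)" and G = "\<lambda>z. poly P (h z) * deriv h z ^ k"] analytic_at_imp_isCont)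
         (auto intro!: analytic_intros form_analytic[OF f] poly_h_analytic analytic z)
  qed
  ultimately show ?thesis unfolding d_def by blast
qed

lemma order_poly_at_pole:
  assumes z: "z \<in> upper_half_plane" "is_pole h z"
  shows "order_ge (\<lambda>w. poly P (h w)) z (- int (ram None) * int (degree P))"
  unfolding poly_altdef
proof (rule order_ge_sum)
  fix i assume "i \<in> {..degree P}"
  then have i: "int i * int (ram None) \<le> int (degree P) * int (ram None)"
    by (intro mult_right_mono) auto
  have "order_ge (\<lambda>w. coeff P i * h w ^ i) z (0 + int i * - int (ram None))"
    by (intro order_ge_mult order_ge_analytic has_order_ge has_order_power order_at_pole z)
       (auto intro: analytic_intros)
  then show "order_ge (\<lambda>w. coeff P i * h w ^ i) z (- int (ram None) * int (degree P))"
    by (rule order_ge_mono) (use i in \<open>simp add: mult.commute\<close>)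
qed

text \<open>The function \<open>F = P(h) h'^k / Q(h)\<close> has nonnegative order everywhere: over affine points by the
  choice of \<open>Q\<close>, and at the poles of \<open>h\<close> by the bound on the degree of \<open>P\<close>. As \<open>h'\<close>
  transforms like a form of weight 1, \<open>F\<close> transforms like one of weight \<open>k\<close>, at the exceptional points
  by continuity.\<close>

lemma corresponding_form_exists:
  assumes P: "P \<in> polys_le (forms_degree ram k)"
  shows "\<exists>f\<in>automorphic_forms \<Gamma> k. corresponds k f P"
proof -
  let ?Q = "branch_poly ram k"
  define F where "F = (\<lambda>z. poly P (h z) * deriv h z ^ k * inverse (poly ?Q (h z)))"
  define f where "f = (\<lambda>z. if z \<in> upper_half_plane then remove_sings F z else 0)"
  have ord: "order_ge F z 0" if z: "z \<in> upper_half_plane" for z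
  proof (cases "is_pole h z")
    case False
    have "order_ge F z (0 + int k * (int (ram (Some (h z))) - 1) +
        - (int (ram (Some (h z))) * int (branch_order ram k (Some (h z)))))"
      unfolding F_def
      by (intro order_ge_mult order_ge_analytic poly_h_analytic z False has_order_ge
          has_order_power order_deriv_at_finite has_order_inverse order_branch_poly_at_finite)
    then show ?thesis
      by (rule order_ge_mono)
         (use branch_order_bounds(1)[of ram "Some (h z)" k] order_at_finite(2)[OF z False] in simp)
  next
    case True
    define N where "N = (\<Sum>a | ram (Some a) \<noteq> 1. int (branch_order ram k (Some a)))"
    show ?thesis
    proof (cases "P = 0")
      case True
      then show ?thesis using order_ge_zero[of z 0] by (simp add: F_def)
    next
      case False
      then have "int (degree P) \<le> N + int (branch_order ram k None) - 2 * int k"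
        using P unfolding polys_le_def forms_degree_eq N_def by simp
      then have "int (ram None) * int (degree P) \<le>
          int (ram None) * (N + int (branch_order ram k None) - 2 * int k)"
        by (intro mult_left_mono) auto
      also have "\<dots> = int (ram None) * N + int (ram None) * int (branch_order ram k None) - 2 * int k * int (ram None)"
        by (simp add: algebra_simps)
      also have "\<dots> \<le> int (ram None) * N + int k * (int (ram None) - 1) - 2 * int k * int (ram None)"
        using branch_order_bounds(1)[of ram None k] order_at_pole(2)[OF z True] by simp
      finally have le: "0 \<le> - int (ram None) * int (degree P) + int k * (- int (ram None) - 1) +
          - (- int (ram None) * N)"
        by (simp add: algebra_simps)
      have "order_ge F z (- int (ram None) * int (degree P) + int k * (- int (ram None) - 1) +
          - (- int (ram None) * N))"
        unfolding F_def N_def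
        by (intro order_ge_mult order_poly_at_pole z True has_order_ge
            has_order_power order_deriv_at_pole has_order_inverse order_branch_poly_at_pole)
      then show ?thesis using le by (rule order_ge_mono)
    qed
  qed
  have f_F: "\<forall>\<^sub>F w in at z. f w = F w" if z: "z \<in> upper_half_plane" for z
  proof -
    have "\<forall>\<^sub>F w in at z. w \<in> upper_half_plane"
      using eventually_uhp[OF z] eventually_nhds_conv_at by blast
    then show ?thesis using order_ge_0_removable(2)[OF ord[OF z]]
      by eventually_elim (simp add: f_def)
  qed
  have "remove_sings F holomorphic_on upper_half_plane"
    using order_ge_0_removable(1)[OF ord] analytic_on_analytic_at[of "remove_sings F" upper_half_plane]
    by (intro analytic_imp_holomorphic) blast
  then have f_hol: "f holomorphic_on upper_half_plane"
    by (rule holomorphic_transform) (simp add: f_def)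
  then have f_an: "f analytic_on {z}" if "z \<in> upper_half_plane" for z
    using that open_uhp holomorphic_on_imp_analytic_at by blast
  have corr: "corresponds k f P"
    unfolding corresponds_def
  proof (intro ballI impI)
    fix z assume z: "z \<in> upper_half_plane" "\<not> is_pole h z"
    have "\<forall>\<^sub>F w in at z. f w * poly ?Q (h w) = poly P (h w) * deriv h w ^ k"
      using f_F[OF z(1)] eventually_branch_poly_nonzero[OF z(1), of k]
      by eventually_elim (simp add: F_def)
    then show "f z * poly ?Q (h z) = poly P (h z) * deriv h z ^ k"
      by (intro eventually_at_eq_imp_eq[where F = "\<lambda>z. f z * poly ?Q (h z)" and G = "\<lambda>z. poly P (h z) * deriv h z ^ k"] analytic_at_imp_isCont)
         (auto intro!: analytic_intros f_an poly_h_analytic analytic z)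
  qed
  have "f (moebius M z) * deriv (moebius M) z ^ k = f z"
    if M: "M \<in> \<Gamma>" and z: "z \<in> upper_half_plane" for M z
  proof -
    note M1 = det_1[OF M]
    have "\<forall>\<^sub>F w in at z. f (moebius M w) * deriv (moebius M) w ^ k = f w"
      using eventually_regular[OF z] eventually_branch_poly_nonzero[OF z, of k]
    proof eventually_elim
      case (elim w)
      then have w: "w \<in> upper_half_plane" "\<not> is_pole h w" by auto
      note inv = invariance[OF M w]
      have "f (moebius M w) * deriv (moebius M) w ^ k * poly ?Q (h w) =
          (f (moebius M w) * poly ?Q (h (moebius M w))) * deriv (moebius M) w ^ k"
        using inv(3) by simp
      also have "\<dots> = poly P (h w) * deriv h (moebius M w) ^ k * deriv (moebius M) w ^ k"
      proof -
        have "f (moebius M w) * poly ?Q (h (moebius M w)) =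
            poly P (h (moebius M w)) * deriv h (moebius M w) ^ k"
          using corr inv(1,2) unfolding corresponds_def by blast
        then show ?thesis using inv(3) by simp
      qed
      also have "\<dots> = poly P (h w) * deriv h w ^ k"
        unfolding inv(4)[symmetric] by (simp add: power_mult_distrib)
      also have "\<dots> = f w * poly ?Q (h w)"
        using corr w unfolding corresponds_def by simp
      finally show ?case using elim(2) by simp
    qed
    moreover have "isCont (\<lambda>w. f (moebius M w) * deriv (moebius M) w ^ k) z"
    proof -
      have "isCont (f \<circ> moebius M) z"
        using moebius_analytic[OF M1 z] f_an[OF moebius_upper_half_plane(2)[OF M1 z]]
        by (intro continuous_at_compose analytic_at_imp_isCont)
      then have "isCont (\<lambda>w. f (moebius M w)) z" by (simp add: o_def)
      moreover have "isCont (deriv (moebius M)) z"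
        by (intro analytic_at_imp_isCont analytic_deriv moebius_analytic M1 z)
      ultimately show ?thesis by (intro continuous_intros)
    qed
    ultimately show ?thesis
      using eventually_at_eq_imp_eq[where F = "\<lambda>w. f (moebius M w) * deriv (moebius M) w ^ k" and G = f]
        analytic_at_imp_isCont[OF f_an[OF z]] by blast
  qed
  then have "f \<in> automorphic_forms \<Gamma> k"
    using f_hol unfolding automorphic_forms_def by (auto simp: f_def)
  then show ?thesis using corr by blast
qed

lemma corresponding_form_unique:
  assumes "f \<in> automorphic_forms \<Gamma> k" "g \<in> automorphic_forms \<Gamma> k" "corresponds k f P" "corresponds k g P"
  shows "f = g"
proof
  fix z
  show "f z = g z"
  proof (cases "z \<in> upper_half_plane")
    case True
    have "\<forall>\<^sub>F w in at z. f w = g w"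
      using eventually_regular[OF True] eventually_branch_poly_nonzero[OF True, of k]
    proof eventually_elim
      case (elim w)
      then have "f w * poly (branch_poly ram k) (h w) = g w * poly (branch_poly ram k) (h w)"
        using assms(3,4) unfolding corresponds_def by simp
      then show ?case using elim(2) by simp
    qed
    then show ?thesis
      using analytic_at_imp_isCont[OF form_analytic[OF assms(1) True]]
        analytic_at_imp_isCont[OF form_analytic[OF assms(2) True]] eventually_at_eq_imp_eq by blast
  next
    case False
    then show ?thesis using assms(1,2) unfolding automorphic_forms_def by simp
  qed
qed

text \<open>\<open>h\<close> takes every affine value, and off the finitely many branch points \<open>h'\<close> does not vanish there.\<close>

lemma corresponding_poly_unique:
  assumes "corresponds k f P" "corresponds k f R"
  shows "P = R"
proof (rule ccontr)
  assume "P \<noteq> R"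
  then have fin: "finite {a. poly (P - R) a = 0}" by (intro poly_roots_finite) simp
  have "a \<in> {a. poly (P - R) a = 0} \<union> {a. ram (Some a) \<noteq> 1}" for a
  proof (cases "ram (Some a) = 1")
    case True
    obtain z where z: "z \<in> upper_half_plane" "\<not> is_pole h z" "h z = a" by (rule point_over_affine)
    have "deriv h z \<noteq> 0" using deriv_nonzero_of_unramified[OF z(1,2)] True z(3) by simp
    moreover have "poly P (h z) * deriv h z ^ k = poly R (h z) * deriv h z ^ k"
      using assms z unfolding corresponds_def by metis
    ultimately show ?thesis using z(3) by simp
  qed simp
  then have "(UNIV :: complex set) \<subseteq> {a. poly (P - R) a = 0} \<union> {a. ram (Some a) \<noteq> 1}" by blast
  then have "finite (UNIV :: complex set)"
    using fin finite_affine_branch finite_subset by blast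
  then show False using infinite_UNIV_char_0 by blast
qed

lemma automorphic_forms_param:
  "linear_iso_polys (\<lambda>c f z. c * f z) (forms_degree ram k) (automorphic_forms \<Gamma> k)"
proof -
  let ?D = "polys_le (forms_degree ram k)" and ?A = "automorphic_forms \<Gamma> k"
  have "\<forall>P\<in>?D. \<exists>f. f \<in> ?A \<and> corresponds k f P"
    using corresponding_form_exists by blast
  from bchoice[OF this] obtain T where T: "\<And>P. P \<in> ?D \<Longrightarrow> T P \<in> ?A \<and> corresponds k (T P) P"
    by blast
  have T_eq: "T P = f" if "P \<in> ?D" "f \<in> ?A" "corresponds k f P" for P f
    using corresponding_form_unique T that by blast
  show ?thesis
    unfolding linear_iso_polys_def
  proof (intro exI[of _ T] conjI ballI allI)
    show "bij_betw T ?D ?A"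
    proof (rule bij_betwI')
      fix P R assume PR: "P \<in> ?D" "R \<in> ?D"
      show "T P = T R \<longleftrightarrow> P = R"
        using T[OF PR(1)] T[OF PR(2)] corresponding_poly_unique by metis
    next
      fix f assume "f \<in> ?A"
      then show "\<exists>P\<in>?D. f = T P" using corresponds_exists T_eq by metis
    qed (use T in blast)
  next
    fix P R assume PR: "P \<in> ?D" "R \<in> ?D"
    have "P + R \<in> ?D"
      using PR degree_add_le_max[of P R] unfolding polys_le_def by auto
    moreover have "T P + T R \<in> ?A"
      using T[OF PR(1)] T[OF PR(2)] unfolding automorphic_forms_def
      by (auto intro!: holomorphic_intros simp: distrib_right plus_fun_def)
    moreover have "corresponds k (T P + T R) (P + R)"
      using T[OF PR(1)] T[OF PR(2)] unfolding corresponds_def by (simp add: distrib_right)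
    ultimately show "T (P + R) = T P + T R" by (rule T_eq)
  next
    fix c P assume P: "P \<in> ?D"
    have "Polynomial.smult c P \<in> ?D" using P unfolding polys_le_def by auto
    moreover have "(\<lambda>z. c * T P z) \<in> ?A"
      using T[OF P] unfolding automorphic_forms_def
      by (auto intro!: holomorphic_intros simp: mult.assoc)
    moreover have "corresponds k (\<lambda>z. c * T P z) (Polynomial.smult c P)"
      using T[OF P] unfolding corresponds_def by (simp add: mult.assoc)
    ultimately show "T (Polynomial.smult c P) = (\<lambda>z. c * T P z)" by (rule T_eq)
  qed
qed

end

section \<open>Poincare series\<close>

lemma divisor_degree_eq_sum:
  assumes "finite X" "{p. D p \<noteq> 0} \<subseteq> X"
  shows "divisor_degree D = (\<Sum>p\<in>X. D p)"
  unfolding divisor_degree_def using assms by (intro sum.mono_neutral_left) auto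

lemma orbit_divisor_degree:
  assumes "is_divisor D0" "length ps = length \<alpha>s"
  shows "is_divisor (orbit_divisor D0 ps \<alpha>s \<beta>s k)"
    and "divisor_degree (orbit_divisor D0 ps \<alpha>s \<beta>s k) = int k * divisor_degree D0 +
      (\<Sum>i<length \<alpha>s. \<lfloor>real k * ((real (\<alpha>s ! i) - real (\<beta>s ! i)) / real (\<alpha>s ! i))\<rfloor>)"
proof -
  let ?f = "\<lambda>i. \<lfloor>real k * ((real (\<alpha>s ! i) - real (\<beta>s ! i)) / real (\<alpha>s ! i))\<rfloor>"
  define X where "X = {p. D0 p \<noteq> 0} \<union> set ps"
  have X: "finite X" using assms(1) unfolding X_def is_divisor_def by simp
  have sub: "{p. orbit_divisor D0 ps \<alpha>s \<beta>s k p \<noteq> 0} \<subseteq> X"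
  proof
    fix p assume p: "p \<in> {p. orbit_divisor D0 ps \<alpha>s \<beta>s k p \<noteq> 0}"
    show "p \<in> X"
    proof (rule ccontr)
      assume "p \<notin> X"
      then have "D0 p = 0" "\<And>i. i < length ps \<Longrightarrow> p \<noteq> ps ! i" unfolding X_def by auto
      then have "orbit_divisor D0 ps \<alpha>s \<beta>s k p = 0" unfolding orbit_divisor_def by simp
      then show False using p by simp
    qed
  qed
  show "is_divisor (orbit_divisor D0 ps \<alpha>s \<beta>s k)"
    using finite_subset[OF sub X] unfolding is_divisor_def .
  have "divisor_degree (orbit_divisor D0 ps \<alpha>s \<beta>s k) =
      (\<Sum>p\<in>X. int k * D0 p + (\<Sum>i<length ps. if p = ps ! i then ?f i else 0))"
    unfolding divisor_degree_eq_sum[OF X sub] by (simp only: orbit_divisor_def)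
  also have "\<dots> = int k * (\<Sum>p\<in>X. D0 p) + (\<Sum>i<length ps. \<Sum>p\<in>X. if p = ps ! i then ?f i else 0)"
    unfolding sum.distrib sum_distrib_left by (subst sum.swap[of _ X]) simp
  also have "(\<Sum>p\<in>X. D0 p) = divisor_degree D0"
    using X by (intro divisor_degree_eq_sum[symmetric]) (auto simp: X_def)
  also have "(\<Sum>i<length ps. \<Sum>p\<in>X. if p = ps ! i then ?f i else 0) = (\<Sum>i<length ps. ?f i)"
    using X by (intro sum.cong) (auto simp: X_def)
  finally show "divisor_degree (orbit_divisor D0 ps \<alpha>s \<beta>s k) = int k * divisor_degree D0 +
      (\<Sum>i<length \<alpha>s. ?f i)" using assms(2) by simp
qed

text \<open>The degrees of \<open>D^(k)\<close> in the two cases, with the degree of \<open>D\<^sub>0\<close> inserted.\<close>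

definition kleinian_degree :: "nat list \<Rightarrow> nat \<Rightarrow> int" where
  "kleinian_degree \<alpha>s k = int k * (2 - int (length \<alpha>s)) + (\<Sum>i<length \<alpha>s. int (k div \<alpha>s ! i))"

definition fuchsian_degree :: "nat list \<Rightarrow> nat \<Rightarrow> int" where
  "fuchsian_degree \<alpha>s k = (\<Sum>i<length \<alpha>s. int (k * (\<alpha>s ! i - 1) div \<alpha>s ! i)) - 2 * int k"

lemma kleinian_dim:
  assumes "kleinian_algebra scl A \<alpha>s"
  shows "finite_dim scl (A k)" "vector_space.dim scl (A k) = nat (kleinian_degree \<alpha>s k + 1)"
proof -
  let ?\<beta>s = "map (\<lambda>\<alpha>. \<alpha> - 1) \<alpha>s"
  obtain D0 ps where A: "graded_algebra scl A" and \<alpha>: "\<forall>\<alpha>\<in>set \<alpha>s. \<alpha> \<ge> 2"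
    and D0: "is_divisor D0" "divisor_degree D0 + int (length \<alpha>s) = 2" "length ps = length \<alpha>s"
    and iso: "graded_algebra_iso scl A ratfun_scale (\<lambda>k. divisor_sections (orbit_divisor D0 ps \<alpha>s ?\<beta>s k))"
    using assms unfolding kleinian_algebra_def by blast
  let ?D = "orbit_divisor D0 ps \<alpha>s ?\<beta>s k"
  note D = orbit_divisor_degree[OF D0(1,3), of ?\<beta>s k]
  have floors: "(\<Sum>i<length \<alpha>s. \<lfloor>real k * ((real (\<alpha>s ! i) - real (?\<beta>s ! i)) / real (\<alpha>s ! i))\<rfloor>) =
      (\<Sum>i<length \<alpha>s. int (k div \<alpha>s ! i))"
  proof (intro sum.cong refl)
    fix i assume "i \<in> {..<length \<alpha>s}"
    then have i: "i < length \<alpha>s" "\<alpha>s ! i \<ge> 2" using \<alpha> by auto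
    then have "real k * ((real (\<alpha>s ! i) - real (?\<beta>s ! i)) / real (\<alpha>s ! i)) = real k / real (\<alpha>s ! i)"
      by (simp add: of_nat_diff)
    then show "\<lfloor>real k * ((real (\<alpha>s ! i) - real (?\<beta>s ! i)) / real (\<alpha>s ! i))\<rfloor> = int (k div \<alpha>s ! i)"
      by (simp only: floor_divide_of_nat_eq)
  qed
  have "divisor_degree D0 = 2 - int (length \<alpha>s)" using D0(2) by simp
  then have deg: "divisor_degree ?D = kleinian_degree \<alpha>s k"
    by (simp only: D(2) floors kleinian_degree_def)
  show "finite_dim scl (A k)" "vector_space.dim scl (A k) = nat (kleinian_degree \<alpha>s k + 1)"
    using graded_iso_piece_dim[OF A iso divisor_sections_param[OF D(1), unfolded deg]] by simp_all
qed

lemma fuchsian_orders: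
  assumes "fuchsian_genus_0_algebra scl A \<alpha>s" "\<alpha> \<in> set \<alpha>s"
  shows "\<alpha> \<ge> 2"
proof -
  obtain h ps where ps: "length ps = length \<alpha>s"
    "set ps = P1_map h ` {z\<in>upper_half_plane. ramification_index h z > 1}"
    "\<forall>i<length ps. \<forall>z\<in>upper_half_plane. P1_map h z = ps ! i \<longrightarrow> ramification_index h z = int (\<alpha>s ! i)"
    using assms(1) unfolding fuchsian_genus_0_algebra_def by blast
  obtain i where i: "i < length \<alpha>s" "\<alpha> = \<alpha>s ! i" using assms(2) by (metis in_set_conv_nth)
  then have "ps ! i \<in> P1_map h ` {z\<in>upper_half_plane. ramification_index h z > 1}"
    using ps(1,2) nth_mem by metis
  then obtain z where z: "z \<in> upper_half_plane" "ramification_index h z > 1" "P1_map h z = ps ! i" by auto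
  then have "ramification_index h z = int (\<alpha>s ! i)" using ps(1,3) i(1) by simp
  then show ?thesis using z(2) i(2) by simp
qed

lemma fuchsian_dim:
  assumes F: "fuchsian_genus_0_algebra scl A \<alpha>s"
  shows "finite_dim scl (A k)" "vector_space.dim scl (A k) = nat (fuchsian_degree \<alpha>s k + 1)"
proof -
  obtain \<Gamma> h ps where A: "graded_algebra scl A"
    and \<Gamma>: "cocompact_fuchsian_group \<Gamma>" "genus_0_quotient_map \<Gamma> h"
    and ps: "distinct ps" "length ps = length \<alpha>s"
      "set ps = P1_map h ` {z\<in>upper_half_plane. ramification_index h z > 1}"
      "\<forall>i<length ps. \<forall>z\<in>upper_half_plane. P1_map h z = ps ! i \<longrightarrow> ramification_index h z = int (\<alpha>s ! i)"
    and iso: "graded_algebra_iso scl A (\<lambda>c f z. c * f z) (automorphic_forms \<Gamma>)"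
    using F unfolding fuchsian_genus_0_algebra_def by blast
  define ram where "ram p = (case map_of (zip ps \<alpha>s) p of Some \<alpha> \<Rightarrow> \<alpha> | None \<Rightarrow> 1)" for p
  have ram_nth: "ram (ps ! i) = \<alpha>s ! i" if "i < length ps" for i
    using map_of_zip_nth[of ps \<alpha>s i] ps(1,2) that by (simp add: ram_def)
  have ram_other: "ram p = 1" if "p \<notin> set ps" for p
    using that ps(2) by (simp add: ram_def split: option.split) (metis map_of_SomeD set_zip_leftD)
  have sub: "{p. ram p \<noteq> 1} \<subseteq> set ps" using ram_other by blast
  interpret genus_0_quotient \<Gamma> h ram
  proof
    show "Determinants.det M = 1" if "M \<in> \<Gamma>" for M
      using \<Gamma>(1) that unfolding cocompact_fuchsian_group_def psl2R_subgroup_def by blast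
    show "genus_0_quotient_map \<Gamma> h" by (rule \<Gamma>(2))
    show "finite {p. ram p \<noteq> 1}" using finite_subset[OF sub] by simp
    show "ramification_index h z = int (ram (P1_map h z))"
      if z: "z \<in> upper_half_plane" and r: "ramification_index h z > 1 \<or> ram (P1_map h z) \<noteq> 1" for z
    proof -
      have "P1_map h z \<in> set ps" using r sub ps(3) z by blast
      then obtain i where "i < length ps" "P1_map h z = ps ! i" by (metis in_set_conv_nth)
      then show ?thesis using ps(4) z ram_nth by simp
    qed
  qed
  have deg: "forms_degree ram k = fuchsian_degree \<alpha>s k"
  proof -
    have "(\<Sum>p | ram p \<noteq> 1. int (branch_order ram k p)) = (\<Sum>p\<in>set ps. int (branch_order ram k p))"
      using sub by (intro sum.mono_neutral_left) auto
    also have "\<dots> = (\<Sum>i<length ps. int (branch_order ram k (ps ! i)))"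
      by (rule sum.reindex_bij_betw[OF bij_betw_nth[OF ps(1) refl refl], symmetric])
    also have "\<dots> = (\<Sum>i<length \<alpha>s. int (k * (\<alpha>s ! i - 1) div \<alpha>s ! i))"
      unfolding ps(2)[symmetric] by (intro sum.cong) (simp_all add: branch_order_def ram_nth)
    finally show ?thesis unfolding forms_degree_def fuchsian_degree_def by simp
  qed
  show "finite_dim scl (A k)" "vector_space.dim scl (A k) = nat (fuchsian_degree \<alpha>s k + 1)"
    using graded_iso_piece_dim[OF A iso automorphic_forms_param[of k, unfolded deg]] by simp_all
qed

lemma sum_list_inverse_nth:
  "(\<Sum>\<alpha>\<leftarrow>\<alpha>s. 1 / real \<alpha>) = (\<Sum>i<length \<alpha>s. 1 / real (\<alpha>s ! i))"
  by (simp add: sum_list_sum_nth atLeast0LessThan)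

text \<open>From \<open>\<lfloor>k / \<alpha>\<rfloor> \<ge> (k + 1) / \<alpha> - 1\<close> the degree exceeds \<open>k (2 - r) + (k + 1) (r - 2) - r = -2\<close>.\<close>

lemma kleinian_degree_ge:
  assumes "\<And>\<alpha>. \<alpha> \<in> set \<alpha>s \<Longrightarrow> \<alpha> \<ge> 1" "(\<Sum>\<alpha>\<leftarrow>\<alpha>s. 1 / real \<alpha>) > real (length \<alpha>s) - 2"
  shows "kleinian_degree \<alpha>s k \<ge> -1"
proof -
  let ?r = "length \<alpha>s"
  have "real (k div \<alpha>s ! i) \<ge> (real k + 1) * (1 / real (\<alpha>s ! i)) - 1" if "i < ?r" for i
  proof -
    let ?a = "\<alpha>s ! i"
    have a: "?a \<ge> 1" using assms(1) that by simp
    then have "k < (k div ?a) * ?a + ?a" using dividend_less_div_times[of ?a k] by simp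
    then have "k + 1 \<le> (k div ?a + 1) * ?a" by simp
    then have "real (k + 1) \<le> real ((k div ?a + 1) * ?a)" by (simp only: of_nat_le_iff)
    then have "real k + 1 \<le> (real (k div ?a) + 1) * real ?a" by (simp only: of_nat_mult of_nat_add of_nat_1)
    then have "(real k + 1) / real ?a \<le> real (k div ?a) + 1" using a by (simp add: pos_divide_le_eq)
    then show ?thesis by simp
  qed
  then have "(\<Sum>i<?r. (real k + 1) * (1 / real (\<alpha>s ! i)) - 1) \<le> (\<Sum>i<?r. real (k div \<alpha>s ! i))"
    by (intro sum_mono) simp
  then have "(real k + 1) * (\<Sum>i<?r. 1 / real (\<alpha>s ! i)) - real ?r \<le> (\<Sum>i<?r. real (k div \<alpha>s ! i))"
    by (simp only: sum_subtractf sum_distrib_left) simp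
  moreover have "(real k + 1) * (real ?r - 2) < (real k + 1) * (\<Sum>i<?r. 1 / real (\<alpha>s ! i))"
    using assms(2) unfolding sum_list_inverse_nth by (intro mult_strict_left_mono) auto
  ultimately have "real k * (2 - real ?r) + (\<Sum>i<?r. real (k div \<alpha>s ! i)) > -2"
    by (simp add: algebra_simps)
  moreover have "real_of_int (kleinian_degree \<alpha>s k) = real k * (2 - real ?r) + (\<Sum>i<?r. real (k div \<alpha>s ! i))"
    unfolding kleinian_degree_def by simp
  ultimately have "real_of_int (kleinian_degree \<alpha>s k) > real_of_int (-2)" by simp
  then show ?thesis by linarith
qed

text \<open>From \<open>\<lfloor>k (\<alpha> - 1) / \<alpha>\<rfloor> \<ge> (k - 1) (1 - 1 / \<alpha>)\<close> the degree exceeds \<open>2 (k - 1) - 2 k = -2\<close>; the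
  inequality is strict only for \<open>k \<ge> 2\<close>.\<close>

lemma fuchsian_degree_ge:
  assumes "\<And>\<alpha>. \<alpha> \<in> set \<alpha>s \<Longrightarrow> \<alpha> \<ge> 1" "(\<Sum>\<alpha>\<leftarrow>\<alpha>s. 1 / real \<alpha>) < real (length \<alpha>s) - 2" "k \<ge> 2"
  shows "fuchsian_degree \<alpha>s k \<ge> -1"
proof -
  let ?r = "length \<alpha>s"
  let ?c = "\<lambda>i. k * (\<alpha>s ! i - 1) div \<alpha>s ! i"
  have "real (?c i) \<ge> (real k - 1) * (1 - 1 / real (\<alpha>s ! i))" if "i < ?r" for i
  proof -
    let ?a = "\<alpha>s ! i"
    have a: "?a \<ge> 1" using assms(1) that by simp
    then have "k * (?a - 1) < ?c i * ?a + ?a" using dividend_less_div_times[of ?a "k * (?a - 1)"] by simp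
    then have "k * (?a - 1) + 1 \<le> (?c i + 1) * ?a" by simp
    then have "real (k * (?a - 1) + 1) \<le> real ((?c i + 1) * ?a)" by (simp only: of_nat_le_iff)
    then have "real k * (real ?a - 1) + 1 \<le> (real (?c i) + 1) * real ?a"
      using a by (simp only: of_nat_mult of_nat_add of_nat_1 of_nat_diff)
    then have "(real k - 1) * (real ?a - 1) \<le> real (?c i) * real ?a" by (simp add: algebra_simps)
    then have "(real k - 1) * (real ?a - 1) / real ?a \<le> real (?c i)" using a by (simp add: pos_divide_le_eq)
    moreover have "(real k - 1) * (1 - 1 / real ?a) = (real k - 1) * (real ?a - 1) / real ?a"
      using a by (simp add: field_simps)
    ultimately show ?thesis by simp
  qed
  then have "(\<Sum>i<?r. (real k - 1) * (1 - 1 / real (\<alpha>s ! i))) \<le> (\<Sum>i<?r. real (?c i))"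
    by (intro sum_mono) simp
  then have "(real k - 1) * (real ?r - (\<Sum>i<?r. 1 / real (\<alpha>s ! i))) \<le> (\<Sum>i<?r. real (?c i))"
    by (simp only: sum_distrib_left[symmetric] sum_subtractf) simp
  moreover have "(real k - 1) * 2 < (real k - 1) * (real ?r - (\<Sum>i<?r. 1 / real (\<alpha>s ! i)))"
    using assms(2,3) unfolding sum_list_inverse_nth by (intro mult_strict_left_mono) auto
  ultimately have "(\<Sum>i<?r. real (?c i)) - 2 * real k > -2" by simp
  moreover have "real_of_int (fuchsian_degree \<alpha>s k) = (\<Sum>i<?r. real (?c i)) - 2 * real k"
    unfolding fuchsian_degree_def by simp
  ultimately have "real_of_int (fuchsian_degree \<alpha>s k) > real_of_int (-2)" by simp
  then show ?thesis by linarith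
qed

definition fps_ones :: "rat fps" where "fps_ones = Abs_fps (\<lambda>k. 1)"

definition fps_nats :: "rat fps" where "fps_nats = Abs_fps of_nat"

lemma fps_ones_mult: "fps_ones * (1 - fps_X) = 1"
  by (rule fps_ext) (simp add: fps_ones_def algebra_simps)

lemma fps_nats_mult: "fps_nats * (1 - fps_X) ^ 2 = fps_X"
proof -
  have "fps_nats * (1 - fps_X) = fps_X * fps_ones"
    by (rule fps_ext) (auto simp: fps_nats_def fps_ones_def algebra_simps of_nat_diff)
  then have "fps_nats * (1 - fps_X) ^ 2 = fps_X * (fps_ones * (1 - fps_X))"
    by (simp only: power2_eq_square mult.assoc[symmetric])
  then show ?thesis by (simp add: fps_ones_mult)
qed

text \<open>Both series below satisfy a recurrence with step \<open>n\<close>, which is the hypothesis; the conclusion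
  follows from \<open>1 - t^n = (1 - t) q n\<close>.\<close>

lemma arm_quotient:
  assumes "F * (1 - fps_X ^ n) = G * fps_ones" "n \<ge> 1"
  shows "F * (1 - fps_X) ^ 2 = G * inverse (qnum n)"
proof -
  have "F * (1 - fps_X) ^ 2 = F * ((1 - fps_X) * qnum n) * (1 - fps_X) * inverse (qnum n)"
    using qnum_unit[OF assms(2)] by (simp add: power2_eq_square mult.assoc mult.left_commute)
  also have "\<dots> = G * (fps_ones * (1 - fps_X)) * inverse (qnum n)"
    unfolding qnum_closed assms(1) by (simp only: mult.assoc)
  finally show ?thesis by (simp add: fps_ones_mult)
qed

lemma floor_series:
  assumes "n \<ge> 1"
  shows "Abs_fps (\<lambda>k. of_nat (k div n)) * (1 - fps_X) ^ 2 = fps_X - fps_X * (qnum (n - 1) * inverse (qnum n))"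
proof -
  have "Abs_fps (\<lambda>k. of_nat (k div n)) * (1 - fps_X ^ n) = fps_X ^ n * fps_ones"
  proof (rule fps_ext)
    fix k
    show "fps_nth (Abs_fps (\<lambda>k. of_nat (k div n)) * (1 - fps_X ^ n)) k = fps_nth (fps_X ^ n * fps_ones) k"
    proof (cases "k < n")
      case True
      then show ?thesis
        by (simp add: right_diff_distrib fps_X_power_mult_nth fps_X_power_mult_right_nth fps_ones_def)
    next
      case False
      then have "k div n = Suc ((k - n) div n)" using assms by (simp add: le_div_geq)
      then show ?thesis using False
        by (simp add: right_diff_distrib fps_X_power_mult_nth fps_X_power_mult_right_nth fps_ones_def)
    qed
  qed
  from arm_quotient[OF this assms]
  have 1: "Abs_fps (\<lambda>k. of_nat (k div n)) * (1 - fps_X) ^ 2 = fps_X ^ n * inverse (qnum n)" .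
  obtain m where m: "n = Suc m" using assms by (cases n) auto
  have "fps_X * qnum n = fps_X * qnum (n - 1) + fps_X ^ n"
    unfolding m by (simp add: qnum_def distrib_left)
  then have "fps_X ^ n * inverse (qnum n) = fps_X * (qnum n * inverse (qnum n)) - fps_X * (qnum (n - 1) * inverse (qnum n))"
    by (simp only: mult.assoc[symmetric] left_diff_distrib[symmetric]) simp
  then show ?thesis using 1 qnum_unit[OF assms] by simp
qed

text \<open>\<open>\<lfloor>k (n - 1) / n\<rfloor> = k - \<lceil>k / n\<rceil>\<close>, and the round-up \<open>e k\<close> grows by one when \<open>k\<close> grows by \<open>n\<close>.\<close>

lemma cofloor_series:
  assumes "n \<ge> 1"
  shows "Abs_fps (\<lambda>k. of_nat (k * (n - 1) div n)) * (1 - fps_X) ^ 2 =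
    fps_X * (fps_X * (qnum (n - 1) * inverse (qnum n)))"
proof -
  define e where "e k = - ((- int k) div int n)" for k
  have c: "int (k * (n - 1) div n) = int k - e k" for k
  proof -
    have "int (k * (n - 1) div n) = (int k * (int n - 1)) div int n"
      using assms by (simp add: zdiv_int of_nat_diff)
    also have "int k * (int n - 1) = - int k + int k * int n" by (simp add: algebra_simps)
    also have "(- int k + int k * int n) div int n = int k + (- int k) div int n"
      using assms by (intro div_mult_self1) simp
    finally show ?thesis by (simp add: e_def)
  qed
  have e_step: "e k = e (k - n) + 1" if "k \<ge> n" for k
  proof -
    have "- int (k - n) = - int k + 1 * int n" using that by (simp add: of_nat_diff)
    then have "(- int (k - n)) div int n = 1 + (- int k) div int n"
      using assms by (simp only:) (intro div_mult_self1, simp)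
    then show ?thesis by (simp add: e_def)
  qed
  have e_small: "e k = (if k = 0 then 0 else 1)" if "k < n" for k
  proof (cases "k = 0")
    case False
    have "(- int k) div int n = -1"
      by (rule int_div_pos_eq[of _ _ _ "int n - int k"]) (use that False in \<open>auto simp: algebra_simps\<close>)
    then show ?thesis using False by (simp add: e_def)
  qed (simp add: e_def)
  define E where "E = Abs_fps (\<lambda>k. of_int (e k) :: rat)"
  have "E * (1 - fps_X ^ n) = fps_X * fps_ones"
  proof (rule fps_ext)
    fix k
    have "fps_nth (E * (1 - fps_X ^ n)) k = of_int (e k) - (if k < n then 0 else of_int (e (k - n)))"
      by (simp add: right_diff_distrib fps_X_power_mult_right_nth E_def)
    also have "\<dots> = (if k = 0 then 0 else 1)"
    proof (cases "k < n")
      case True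
      then show ?thesis using e_small[OF True] by simp
    next
      case False
      then show ?thesis using e_step[of k] assms by simp
    qed
    also have "\<dots> = fps_nth (fps_X * fps_ones) k" by (simp add: fps_ones_def)
    finally show "fps_nth (E * (1 - fps_X ^ n)) k = fps_nth (fps_X * fps_ones) k" .
  qed
  from arm_quotient[OF this assms]
  have E: "E * (1 - fps_X) ^ 2 = fps_X * inverse (qnum n)" .
  have "Abs_fps (\<lambda>k. of_nat (k * (n - 1) div n)) = fps_nats - E"
  proof (rule fps_ext)
    fix k
    have "(of_nat (k * (n - 1) div n) :: rat) = of_int (int (k * (n - 1) div n))" by simp
    also have "\<dots> = of_nat k - of_int (e k)" unfolding c by simp
    finally show "fps_nth (Abs_fps (\<lambda>k. of_nat (k * (n - 1) div n))) k = fps_nth (fps_nats - E) k"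
      by (simp add: fps_nats_def E_def)
  qed
  then have "Abs_fps (\<lambda>k. of_nat (k * (n - 1) div n)) * (1 - fps_X) ^ 2 = fps_X - fps_X * inverse (qnum n)"
    by (simp add: left_diff_distrib fps_nats_mult E)
  also have "\<dots> = fps_X * ((qnum n - 1) * inverse (qnum n))"
    using qnum_unit[OF assms] by (simp add: algebra_simps)
  also have "qnum n - 1 = fps_X * qnum (n - 1)"
    using qnum_Suc[of "n - 1"] assms by simp
  finally show ?thesis by (simp add: mult.assoc)
qed

lemma Abs_fps_sum: "Abs_fps (\<lambda>k. \<Sum>i\<in>I. f i k) = (\<Sum>i\<in>I. Abs_fps (f i))"
  by (rule fps_ext) (simp add: fps_sum_nth)

lemma kleinian_series:
  assumes "\<And>\<alpha>. \<alpha> \<in> set \<alpha>s \<Longrightarrow> \<alpha> \<ge> 1"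
  shows "Abs_fps (\<lambda>k. of_int (kleinian_degree \<alpha>s k + 1)) * (1 - fps_X) ^ 2 = 1 + fps_X - arm_sum \<alpha>s"
proof -
  let ?r = "length \<alpha>s"
  have "Abs_fps (\<lambda>k. of_int (kleinian_degree \<alpha>s k + 1)) =
      fps_ones + fps_const (2 - of_nat ?r) * fps_nats + (\<Sum>i<?r. Abs_fps (\<lambda>k. of_nat (k div \<alpha>s ! i)))"
    unfolding Abs_fps_sum[symmetric]
    by (rule fps_ext) (simp add: kleinian_degree_def fps_ones_def fps_nats_def mult.commute)
  then have "Abs_fps (\<lambda>k. of_int (kleinian_degree \<alpha>s k + 1)) * (1 - fps_X) ^ 2 =
      fps_ones * (1 - fps_X) ^ 2 + fps_const (2 - of_nat ?r) * (fps_nats * (1 - fps_X) ^ 2)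
      + (\<Sum>i<?r. Abs_fps (\<lambda>k. of_nat (k div \<alpha>s ! i)) * (1 - fps_X) ^ 2)"
    by (simp add: distrib_right sum_distrib_right mult.assoc)
  also have "fps_ones * (1 - fps_X) ^ 2 = 1 - fps_X"
    using fps_ones_mult by (simp add: power2_eq_square mult.assoc[symmetric])
  also have "(\<Sum>i<?r. Abs_fps (\<lambda>k. of_nat (k div \<alpha>s ! i)) * (1 - fps_X) ^ 2) =
      (\<Sum>i<?r. fps_X - fps_X * (qnum (\<alpha>s ! i - 1) * inverse (qnum (\<alpha>s ! i))))"
    by (intro sum.cong refl floor_series assms) simp
  also have "\<dots> = of_nat ?r * fps_X - arm_sum \<alpha>s"
    unfolding arm_sum_def sum_subtractf by (simp add: sum_distrib_left)
  also have "1 - fps_X + fps_const (2 - of_nat ?r) * (fps_nats * (1 - fps_X) ^ 2) + (of_nat ?r * fps_X - arm_sum \<alpha>s)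
      = 1 + fps_X - arm_sum \<alpha>s"
  proof -
    have "fps_const (2 - of_nat ?r) = (2 - of_nat ?r :: rat fps)"
      by (simp add: fps_of_nat[symmetric] numeral_fps_const)
    then show ?thesis unfolding fps_nats_mult by (simp only:) (simp add: algebra_simps)
  qed
  finally show ?thesis .
qed

lemma fuchsian_series:
  assumes "\<And>\<alpha>. \<alpha> \<in> set \<alpha>s \<Longrightarrow> \<alpha> \<ge> 1"
  shows "Abs_fps (\<lambda>k. of_int (fuchsian_degree \<alpha>s k + 1)) * (1 - fps_X) ^ 2 =
    1 - 3 * fps_X + fps_X * arm_sum \<alpha>s"
proof -
  let ?r = "length \<alpha>s"
  have "Abs_fps (\<lambda>k. of_int (fuchsian_degree \<alpha>s k + 1)) =
      fps_ones - 2 * fps_nats + (\<Sum>i<?r. Abs_fps (\<lambda>k. of_nat (k * (\<alpha>s ! i - 1) div \<alpha>s ! i)))"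
    unfolding Abs_fps_sum[symmetric]
    by (rule fps_ext) (simp add: fuchsian_degree_def fps_ones_def fps_nats_def numeral_fps_const)
  then have "Abs_fps (\<lambda>k. of_int (fuchsian_degree \<alpha>s k + 1)) * (1 - fps_X) ^ 2 =
      fps_ones * (1 - fps_X) ^ 2 - 2 * (fps_nats * (1 - fps_X) ^ 2)
      + (\<Sum>i<?r. Abs_fps (\<lambda>k. of_nat (k * (\<alpha>s ! i - 1) div \<alpha>s ! i)) * (1 - fps_X) ^ 2)"
    by (simp add: distrib_right left_diff_distrib sum_distrib_right mult.assoc)
  also have "fps_ones * (1 - fps_X) ^ 2 = 1 - fps_X"
    using fps_ones_mult by (simp add: power2_eq_square mult.assoc[symmetric])
  also have "(\<Sum>i<?r. Abs_fps (\<lambda>k. of_nat (k * (\<alpha>s ! i - 1) div \<alpha>s ! i)) * (1 - fps_X) ^ 2) =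
      (\<Sum>i<?r. fps_X * (fps_X * (qnum (\<alpha>s ! i - 1) * inverse (qnum (\<alpha>s ! i)))))"
    by (intro sum.cong refl cofloor_series assms) simp
  also have "\<dots> = fps_X * arm_sum \<alpha>s"
    unfolding arm_sum_def by (simp add: sum_distrib_left)
  finally show ?thesis unfolding fps_nats_mult by simp
qed

lemma Delta_zero_nonzero:
  assumes "\<And>\<alpha>. \<alpha> \<in> set \<alpha>s \<Longrightarrow> \<alpha> \<ge> 2"
  shows "fps_of_int_poly (Delta_zero \<alpha>s) \<noteq> 0"
proof -
  have "qnum (\<alpha>s ! i) \<noteq> 0" if "i < length \<alpha>s" for i
  proof -
    have "\<alpha>s ! i \<ge> 2" using assms that by simp
    then show ?thesis using qnum_unit[of "\<alpha>s ! i"] by auto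
  qed
  moreover have "(1 - fps_X :: rat fps) \<noteq> 0"
    using fps_ones_mult by (metis mult_zero_right zero_neq_one)
  moreover have "fps_of_int_poly (Delta_zero \<alpha>s) = (\<Prod>i<length \<alpha>s. qnum (\<alpha>s ! i)) * (1 - fps_X) ^ 2"
    by (intro Delta_formulas(2) assms)
  ultimately show ?thesis by (simp add: prod_zero_iff)
qed

lemma poincare_series_kleinian:
  assumes K: "kleinian_algebra scl A \<alpha>s"
  shows "poincare_series scl A = fps_of_int_poly (Delta_minus \<alpha>s) / fps_of_int_poly (Delta_zero \<alpha>s)"
proof -
  have \<alpha>2: "\<alpha> \<ge> 2" if "\<alpha> \<in> set \<alpha>s" for \<alpha> using K that unfolding kleinian_algebra_def by blast
  then have \<alpha>1: "\<alpha> \<ge> 1" if "\<alpha> \<in> set \<alpha>s" for \<alpha> using that by fastforce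
  have "poincare_series scl A = Abs_fps (\<lambda>k. of_int (kleinian_degree \<alpha>s k + 1))"
  proof (rule fps_ext)
    fix k
    have "kleinian_degree \<alpha>s k \<ge> -1"
      using K by (intro kleinian_degree_ge \<alpha>1) (auto simp: kleinian_algebra_def)
    then show "fps_nth (poincare_series scl A) k = fps_nth (Abs_fps (\<lambda>k. of_int (kleinian_degree \<alpha>s k + 1))) k"
      by (simp add: poincare_series_def kleinian_dim[OF K])
  qed
  then have "poincare_series scl A * fps_of_int_poly (Delta_zero \<alpha>s) =
      (\<Prod>i<length \<alpha>s. qnum (\<alpha>s ! i)) * (Abs_fps (\<lambda>k. of_int (kleinian_degree \<alpha>s k + 1)) * (1 - fps_X) ^ 2)"
    using Delta_formulas(2)[of \<alpha>s] \<alpha>2 by (simp only: ac_simps)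
  also have "\<dots> = fps_of_int_poly (Delta_minus \<alpha>s)"
    using Delta_formulas(1)[of \<alpha>s] \<alpha>2 kleinian_series[of \<alpha>s] \<alpha>1 by simp
  finally show ?thesis
    using Delta_zero_nonzero[OF \<alpha>2] by (metis nonzero_mult_div_cancel_right)
qed

text \<open>The summand \<open>t\<close> corrects the coefficient at \<open>k = 1\<close>: there the degree is -2, and the dimension is 0
  instead of -1.\<close>

lemma poincare_series_fuchsian:
  assumes F: "fuchsian_genus_0_algebra scl A \<alpha>s"
  shows "poincare_series scl A = fps_of_int_poly (Delta_plus \<alpha>s) / fps_of_int_poly (Delta_zero \<alpha>s)"
proof -
  have \<alpha>2: "\<alpha> \<ge> 2" if "\<alpha> \<in> set \<alpha>s" for \<alpha> using fuchsian_orders[OF F that] .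
  then have \<alpha>1: "\<alpha> \<ge> 1" if "\<alpha> \<in> set \<alpha>s" for \<alpha> using that by fastforce
  have "poincare_series scl A = Abs_fps (\<lambda>k. of_int (fuchsian_degree \<alpha>s k + 1)) + fps_X"
  proof (rule fps_ext)
    fix k :: nat
    consider "k = 0" | "k = 1" | "k \<ge> 2" by linarith
    then show "fps_nth (poincare_series scl A) k =
        fps_nth (Abs_fps (\<lambda>k. of_int (fuchsian_degree \<alpha>s k + 1)) + fps_X) k"
    proof cases
      case 1
      then show ?thesis by (simp add: poincare_series_def fuchsian_dim[OF F] fuchsian_degree_def)
    next
      case 2
      have "(\<alpha>s ! i - 1) div \<alpha>s ! i = 0" if "i < length \<alpha>s" for i
        using \<alpha>1[of "\<alpha>s ! i"] that by (intro div_less) simp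
      then have "fuchsian_degree \<alpha>s 1 = -2" unfolding fuchsian_degree_def by simp
      then show ?thesis unfolding 2 by (simp add: poincare_series_def fuchsian_dim[OF F])
    next
      case 3
      have "fuchsian_degree \<alpha>s k \<ge> -1"
        using F 3 by (intro fuchsian_degree_ge \<alpha>1) (auto simp: fuchsian_genus_0_algebra_def)
      then show ?thesis using 3 by (simp add: poincare_series_def fuchsian_dim[OF F] fps_X_def)
    qed
  qed
  then have "poincare_series scl A * fps_of_int_poly (Delta_zero \<alpha>s) =
      (\<Prod>i<length \<alpha>s. qnum (\<alpha>s ! i)) *
      (Abs_fps (\<lambda>k. of_int (fuchsian_degree \<alpha>s k + 1)) * (1 - fps_X) ^ 2 + fps_X * (1 - fps_X) ^ 2)"
    using Delta_formulas(2)[of \<alpha>s] \<alpha>2 by (simp only: ac_simps distrib_left)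
  also have "Abs_fps (\<lambda>k. of_int (fuchsian_degree \<alpha>s k + 1)) * (1 - fps_X) ^ 2 = 1 - 3 * fps_X + fps_X * arm_sum \<alpha>s"
    by (intro fuchsian_series \<alpha>1)
  also have "1 - 3 * fps_X + fps_X * arm_sum \<alpha>s + fps_X * (1 - fps_X) ^ 2 =
      (1 + fps_X) * (1 - fps_X) ^ 2 - fps_X * (1 + fps_X - arm_sum \<alpha>s)"
    by (simp add: algebra_simps power2_eq_square)
  also have "(\<Prod>i<length \<alpha>s. qnum (\<alpha>s ! i)) * \<dots> = fps_of_int_poly (Delta_plus \<alpha>s)"
    using Delta_formulas(3)[of \<alpha>s] \<alpha>2 by simp
  finally show ?thesis
    using Delta_zero_nonzero[OF \<alpha>2] by (metis nonzero_mult_div_cancel_right)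
qed

theorem theorem1:
  fixes scl :: "complex \<Rightarrow> 'a::comm_ring_1 \<Rightarrow> 'a"
    and A :: "nat \<Rightarrow> 'a set"
    and \<alpha>s :: "nat list"
  shows "(kleinian_algebra scl A \<alpha>s \<longrightarrow>
            (\<forall>k. finite_dim scl (A k)) \<and>
            poincare_series scl A =
              fps_of_int_poly (Delta_minus \<alpha>s) / fps_of_int_poly (Delta_zero \<alpha>s)) \<and>
         (fuchsian_genus_0_algebra scl A \<alpha>s \<longrightarrow>
            (\<forall>k. finite_dim scl (A k)) \<and>
            poincare_series scl A =
              fps_of_int_poly (Delta_plus \<alpha>s) / fps_of_int_poly (Delta_zero \<alpha>s))"
  using kleinian_dim(1) fuchsian_dim(1) poincare_series_kleinian poincare_series_fuchsian by blast

end
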